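(* Let $M$ be a module of dimension $r\ge 1$, let $\mathbb M=\{M_n\}$ be a good $\mathfrak q$-filtration of $M$, and let $J$ be the ideal generated by a maximal $\mathbb M$-superficial sequence for $\mathfrak q$. Then, coefficientwise, $$P_{\mathbb M}(z)\le \frac{\lambda(M/M_1)+\lambda(M_1/JM)\,z}{(1-z)^r}.$$ If equality holds, then $gr_{\mathbb M}(M)$ is Cohen-Macaulay, and hence $M$ is Cohen-Macaulay.
   Context: $(A,\mathfrak m)$ is a commutative Noetherian local ring, $\mathfrak q$ is a (proper) $\mathfrak m$-primary ideal of $A$, $M$ is a nonzero finitely generated $A$-module, and $\lambda(\cdot)$ denotes length. A good $\mathfrak q$-filtration $\mathbb M=\{M_n\}_{n\ge 0}$ of $M$ is a chain of submodules $M=M_0\supseteq M_1\supseteq M_2\supseteq\cdots$ with $\mathfrak qM_n\subseteq M_{n+1}$ for all $n$ and $M_{n+1}=\mathfrak qM_n$ for all large $n$. The associated graded module $gr_{\mathbb M}(M)=\bigoplus_{n\ge0}M_n/M_{n+1}$ is a graded module over $gr_{\mathfrak q}(A)=\bigoplus_{n\ge 0}\mathfrak q^n/\mathfrak q^{n+1}$. The Hilbert series of $\mathbb M$ is $P_{\mathbb M}(z)=\sum_{n\ge0}\lambda(M_n/M_{n+1})z^n$. The inequality between power series means inequality of all corresponding coefficients. For a submodule $N$ of $M$, $\mathbb M/N$ is the good $\mathfrak q$-filtration $\{(M_n+N)/N\}$ of $M/N$. An element $a\in\mathfrak q$ is $\mathbb M$-superficial for $\mathfrak q$ if there is $c\ge0$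 such that $(M_{n+1}:_Ma)\cap M_c=M_n$ for all $n\ge c$. A sequence $a_1,\dots,a_t\in\mathfrak q$ is an $\mathbb M$-superficial sequence for $\mathfrak q$ if each $a_i$ is $\mathbb M/(a_1,\dots,a_{i-1})M$-superficial for $\mathfrak q$. It is maximal if $\mathbb M/(a_1,\dots,a_t)M$ is nilpotent (its $n$-th term is $0$ for $n\gg0$) but $\mathbb M/(a_1,\dots,a_{t-1})M$ is not; when $\dim M=r\ge1$ a maximal superficial sequence has length $t=r$. *)

theory Defs
  imports
    "HOL-Algebra.Module"
    "HOL-Algebra.QuotRing"
    "HOL-Algebra.Ideal_Product"
    "HOL-Algebra.Ring_Divisibility"
    "HOL-Library.Extended_Nat"
    "HOL-Computational_Algebra.Formal_Power_Series"
begin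

section \<open>Local rings and primary ideals\<close>

definition local_ring :: "('a, 'k) ring_scheme \<Rightarrow> 'a set \<Rightarrow> bool" where
  "local_ring R \<mm> \<longleftrightarrow> cring R \<and> maximalideal \<mm> R \<and> (\<forall>I. maximalideal I R \<longrightarrow> I = \<mm>)"

definition primary_ideal :: "('a, 'k) ring_scheme \<Rightarrow> 'a set \<Rightarrow> bool" where
  "primary_ideal R \<qq> \<longleftrightarrow> ideal \<qq> R \<and> \<qq> \<noteq> carrier R \<and>
     (\<forall>a\<in>carrier R. \<forall>b\<in>carrier R.
        a \<otimes>\<^bsub>R\<^esub> b \<in> \<qq> \<longrightarrow> a \<in> \<qq> \<or> (\<exists>n::nat. b [^]\<^bsub>R\<^esub> n \<in> \<qq>))"

definition ideal_radical :: "('a, 'k) ring_scheme \<Rightarrow> 'a set \<Rightarrow> 'a set" where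
  "ideal_radical R I = {a \<in> carrier R. \<exists>n::nat. a [^]\<^bsub>R\<^esub> n \<in> I}"

definition primary_to :: "('a, 'k) ring_scheme \<Rightarrow> 'a set \<Rightarrow> 'a set \<Rightarrow> bool" where
  "primary_to R \<mm> \<qq> \<longleftrightarrow> primary_ideal R \<qq> \<and> ideal_radical R \<qq> = \<mm>"

section \<open>Submodules, quotients, length and dimension\<close>

definition submodule_span :: "('a, 'k) ring_scheme \<Rightarrow> ('a, 'b) module \<Rightarrow> 'b set \<Rightarrow> 'b set" where
  "submodule_span R M S = \<Inter>{N. submodule N R M \<and> S \<subseteq> N}"

definition fin_gen_module :: "('a, 'k) ring_scheme \<Rightarrow> ('a, 'b) module \<Rightarrow> bool" where
  "fin_gen_module R M \<longleftrightarrow>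
     (\<exists>S. finite S \<and> S \<subseteq> carrier M \<and> submodule_span R M S = carrier M)"

definition ideal_smult ::
  "('a, 'k) ring_scheme \<Rightarrow> ('a, 'b) module \<Rightarrow> 'a set \<Rightarrow> 'b set \<Rightarrow> 'b set" where
  "ideal_smult R M I N = submodule_span R M {a \<odot>\<^bsub>M\<^esub> x | a x. a \<in> I \<and> x \<in> N}"

text \<open>A submodule \<open>N\<close> of \<open>M\<close>, viewed as a module, is \<open>M\<lparr>carrier := N\<rparr>\<close>.  The fields
  \<open>mult\<close> and \<open>one\<close> of a module record carry no meaning.\<close>

definition quot_module :: "('a, 'b) module \<Rightarrow> 'b set \<Rightarrow> ('a, 'b set) module" where
  "quot_module M N =
     \<lparr>carrier = a_rcosets\<^bsub>M\<^esub> N, monoid.mult = undefined, monoid.one = undefined, zero = N,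
      add = set_add M, smult = (\<lambda>a X. \<Union>x\<in>X. N +>\<^bsub>M\<^esub> (a \<odot>\<^bsub>M\<^esub> x))\<rparr>"

definition module_length :: "('a, 'k) ring_scheme \<Rightarrow> ('a, 'b) module \<Rightarrow> enat" where
  "module_length R M = Sup {enat n | n. \<exists>N :: nat \<Rightarrow> 'b set.
     (\<forall>i\<le>n. submodule (N i) R M) \<and> (\<forall>i<n. N i \<subset> N (Suc i))}"

text \<open>\<open>subquot_length R M N L\<close> is the length of \<open>N/L\<close>, for submodules \<open>L \<subseteq> N\<close> of \<open>M\<close>.
  It is a natural number; if the length were infinite its value would be meaningless, but
  all the lengths used below are finite because \<open>\<qq>\<close> is primary to the maximal ideal.\<close>

definition subquot_length ::
  "('a, 'k) ring_scheme \<Rightarrow> ('a, 'b) module \<Rightarrow> 'b set \<Rightarrow> 'b set \<Rightarrow> nat" where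
  "subquot_length R M N L = the_enat (module_length R (quot_module (M\<lparr>carrier := N\<rparr>) L))"

text \<open>With suprema in \<^typ>\<open>enat\<close>, the zero ring and the zero module get dimension 0.\<close>

definition krull_dim :: "('a, 'k) ring_scheme \<Rightarrow> enat" where
  "krull_dim R = Sup {enat n | n. \<exists>p :: nat \<Rightarrow> 'a set.
     (\<forall>i\<le>n. primeideal (p i) R) \<and> (\<forall>i<n. p i \<subset> p (Suc i))}"

definition annihilator :: "('a, 'k) ring_scheme \<Rightarrow> ('a, 'b) module \<Rightarrow> 'a set" where
  "annihilator R M = {a \<in> carrier R. \<forall>x\<in>carrier M. a \<odot>\<^bsub>M\<^esub> x = \<zero>\<^bsub>M\<^esub>}"

definition module_dim :: "('a, 'k) ring_scheme \<Rightarrow> ('a, 'b) module \<Rightarrow> enat" where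
  "module_dim R M = krull_dim (R Quot (annihilator R M))"

section \<open>Depth and Cohen-Macaulay modules\<close>

text \<open>\<open>seq_submodule R M [x\<^sub>1, \<dots>, x\<^sub>k]\<close> is the submodule \<open>(x\<^sub>1, \<dots>, x\<^sub>k)M\<close>.\<close>

definition seq_submodule ::
  "('a, 'k) ring_scheme \<Rightarrow> ('a, 'b) module \<Rightarrow> 'a list \<Rightarrow> 'b set" where
  "seq_submodule R M xs = ideal_smult R M (Idl\<^bsub>R\<^esub> (set xs)) (carrier M)"

definition nonzerodivisor_on :: "('a, 'b) module \<Rightarrow> 'a \<Rightarrow> bool" where
  "nonzerodivisor_on M a \<longleftrightarrow> (\<forall>x\<in>carrier M. a \<odot>\<^bsub>M\<^esub> x = \<zero>\<^bsub>M\<^esub> \<longrightarrow> x = \<zero>\<^bsub>M\<^esub>)"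

definition regular_sequence ::
  "('a, 'k) ring_scheme \<Rightarrow> ('a, 'b) module \<Rightarrow> 'a list \<Rightarrow> bool" where
  "regular_sequence R M xs \<longleftrightarrow> set xs \<subseteq> carrier R \<and>
     (\<forall>i<length xs.
        nonzerodivisor_on (quot_module M (seq_submodule R M (take i xs))) (xs ! i)) \<and>
     seq_submodule R M xs \<noteq> carrier M"

definition depth :: "('a, 'k) ring_scheme \<Rightarrow> 'a set \<Rightarrow> ('a, 'b) module \<Rightarrow> enat" where
  "depth R I M = Sup {enat (length xs) | xs. set xs \<subseteq> I \<and> regular_sequence R M xs}"

text \<open>The ideal \<open>I\<close> is the maximal ideal if \<open>R\<close> is local, and the unique maximal homogeneous
  ideal if \<open>R\<close> is an associated graded ring and \<open>M\<close> is a graded module over it.  In the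
  second case \<open>R\<close> is not local, but its degree zero part \<open>A/\<qq>\<close> is, so depth is taken with respect
  to this ideal, as usual for graded modules.\<close>

definition cohen_macaulay :: "('a, 'k) ring_scheme \<Rightarrow> 'a set \<Rightarrow> ('a, 'b) module \<Rightarrow> bool" where
  "cohen_macaulay R I M \<longleftrightarrow> depth R I M = module_dim R M"

section \<open>Good filtrations and superficial sequences\<close>

definition good_filtration ::
  "('a, 'k) ring_scheme \<Rightarrow> 'a set \<Rightarrow> ('a, 'b) module \<Rightarrow> (nat \<Rightarrow> 'b set) \<Rightarrow> bool" where
  "good_filtration R \<qq> M F \<longleftrightarrow>
     F 0 = carrier M \<and>
     (\<forall>n. submodule (F n) R M) \<and>
     (\<forall>n. F (Suc n) \<subseteq> F n) \<and>
     (\<forall>n. ideal_smult R M \<qq> (F n) \<subseteq> F (Suc n)) \<and>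
     (\<exists>k. \<forall>n\<ge>k. F (Suc n) = ideal_smult R M \<qq> (F n))"

text \<open>The filtration of \<open>M/N\<close> with terms \<open>(F n + N)/N\<close>.\<close>

definition quot_filtration ::
  "('a, 'b) module \<Rightarrow> (nat \<Rightarrow> 'b set) \<Rightarrow> 'b set \<Rightarrow> nat \<Rightarrow> 'b set set" where
  "quot_filtration M F N n = (\<lambda>x. N +>\<^bsub>M\<^esub> x) ` (F n <+>\<^bsub>M\<^esub> N)"

definition nilpotent_filtration :: "('a, 'b) module \<Rightarrow> (nat \<Rightarrow> 'b set) \<Rightarrow> bool" where
  "nilpotent_filtration M F \<longleftrightarrow> (\<exists>k. \<forall>n\<ge>k. F n = {\<zero>\<^bsub>M\<^esub>})"

definition colon_submodule :: "('a, 'b) module \<Rightarrow> 'b set \<Rightarrow> 'a \<Rightarrow> 'b set" where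
  "colon_submodule M N a = {x \<in> carrier M. a \<odot>\<^bsub>M\<^esub> x \<in> N}"

definition superficial_element ::
  "'a set \<Rightarrow> ('a, 'b) module \<Rightarrow> (nat \<Rightarrow> 'b set) \<Rightarrow> 'a \<Rightarrow> bool" where
  "superficial_element \<qq> M F a \<longleftrightarrow>
     a \<in> \<qq> \<and> (\<exists>c. \<forall>n\<ge>c. colon_submodule M (F (Suc n)) a \<inter> F c = F n)"

definition superficial_sequence ::
  "('a, 'k) ring_scheme \<Rightarrow> 'a set \<Rightarrow> ('a, 'b) module \<Rightarrow> (nat \<Rightarrow> 'b set) \<Rightarrow> 'a list \<Rightarrow> bool" where
  "superficial_sequence R \<qq> M F as \<longleftrightarrow>
     (\<forall>i<length as.
        superficial_element \<qq>
          (quot_module M (seq_submodule R M (take i as)))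
          (quot_filtration M F (seq_submodule R M (take i as)))
          (as ! i))"

definition maximal_superficial_sequence ::
  "('a, 'k) ring_scheme \<Rightarrow> 'a set \<Rightarrow> ('a, 'b) module \<Rightarrow> (nat \<Rightarrow> 'b set) \<Rightarrow> 'a list \<Rightarrow> bool" where
  "maximal_superficial_sequence R \<qq> M F as \<longleftrightarrow>
     as \<noteq> [] \<and>
     superficial_sequence R \<qq> M F as \<and>
     nilpotent_filtration
       (quot_module M (seq_submodule R M as))
       (quot_filtration M F (seq_submodule R M as)) \<and>
     \<not> nilpotent_filtration
       (quot_module M (seq_submodule R M (butlast as)))
       (quot_filtration M F (seq_submodule R M (butlast as)))"

section \<open>Hilbert series and associated graded objects\<close>

definition hilbert_series ::
  "('a, 'k) ring_scheme \<Rightarrow> ('a, 'b) module \<Rightarrow> (nat \<Rightarrow> 'b set) \<Rightarrow> real fps" where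
  "hilbert_series R M F = Abs_fps (\<lambda>n. real (subquot_length R M (F n) (F (Suc n))))"

definition gr_piece ::
  "('a, 'b) module \<Rightarrow> (nat \<Rightarrow> 'b set) \<Rightarrow> nat \<Rightarrow> ('a, 'b set) module" where
  "gr_piece M F n = quot_module (M\<lparr>carrier := F n\<rparr>) (F (Suc n))"

text \<open>Elements of the direct sum of the pieces are the finitely supported families.\<close>

definition gr_carrier :: "('a, 'b) module \<Rightarrow> (nat \<Rightarrow> 'b set) \<Rightarrow> (nat \<Rightarrow> 'b set) set" where
  "gr_carrier M F = {f. (\<forall>n. f n \<in> carrier (gr_piece M F n)) \<and>
                        finite {n. f n \<noteq> \<zero>\<^bsub>gr_piece M F n\<^esub>}}"

definition gr_zero :: "('a, 'b) module \<Rightarrow> (nat \<Rightarrow> 'b set) \<Rightarrow> nat \<Rightarrow> 'b set" where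
  "gr_zero M F = (\<lambda>n. \<zero>\<^bsub>gr_piece M F n\<^esub>)"

definition gr_add ::
  "('a, 'b) module \<Rightarrow> (nat \<Rightarrow> 'b set) \<Rightarrow> (nat \<Rightarrow> 'b set) \<Rightarrow> (nat \<Rightarrow> 'b set) \<Rightarrow> nat \<Rightarrow> 'b set" where
  "gr_add M F f g = (\<lambda>n. f n \<oplus>\<^bsub>gr_piece M F n\<^esub> g n)"

text \<open>On cosets, \<open>(a + \<qq>\<^bsup>i+1\<^esup>)(x + F(j+1)) = ax + F(i+j+1)\<close>; \<open>coset_smult\<close> is this product
  with \<open>N = F(i+j+1)\<close>.\<close>

definition coset_smult :: "('a, 'b) module \<Rightarrow> 'b set \<Rightarrow> 'a set \<Rightarrow> 'b set \<Rightarrow> 'b set" where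
  "coset_smult M N X Y = (\<Union>a\<in>X. \<Union>x\<in>Y. N +>\<^bsub>M\<^esub> (a \<odot>\<^bsub>M\<^esub> x))"

definition gr_smult ::
  "('a, 'b) module \<Rightarrow> (nat \<Rightarrow> 'b set) \<Rightarrow> (nat \<Rightarrow> 'a set) \<Rightarrow> (nat \<Rightarrow> 'b set) \<Rightarrow> nat \<Rightarrow> 'b set" where
  "gr_smult M F f g =
     (\<lambda>n. \<Oplus>\<^bsub>gr_piece M F n\<^esub>i\<in>{..n}. coset_smult M (F (Suc n)) (f i) (g (n - i)))"

definition self_module :: "('a, 'k) ring_scheme \<Rightarrow> ('a, 'a) module" where
  "self_module R =
     \<lparr>carrier = carrier R, monoid.mult = monoid.mult R, monoid.one = \<one>\<^bsub>R\<^esub>,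
      zero = \<zero>\<^bsub>R\<^esub>, add = add R, smult = monoid.mult R\<rparr>"

definition adic_filtration :: "('a, 'k) ring_scheme \<Rightarrow> 'a set \<Rightarrow> nat \<Rightarrow> 'a set" where
  "adic_filtration R \<qq> n = \<qq> [^]\<^bsub>ideals_set R\<^esub> n"

text \<open>Multiplication in the associated graded ring is the graded action of the ring on the
  graded module of its own adic filtration.\<close>

definition gr_ring :: "('a, 'k) ring_scheme \<Rightarrow> 'a set \<Rightarrow> (nat \<Rightarrow> 'a set) ring" where
  "gr_ring R \<qq> = (let A = self_module R; Q = adic_filtration R \<qq> in
     \<lparr>carrier = gr_carrier A Q,
      monoid.mult = gr_smult A Q,
      monoid.one = (\<lambda>n. if n = 0 then Q 1 +>\<^bsub>A\<^esub> \<one>\<^bsub>R\<^esub> else \<zero>\<^bsub>gr_piece A Q n\<^esub>),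
      zero = gr_zero A Q,
      add = gr_add A Q\<rparr>)"

definition gr_module ::
  "('a, 'b) module \<Rightarrow> (nat \<Rightarrow> 'b set) \<Rightarrow> (nat \<Rightarrow> 'a set, nat \<Rightarrow> 'b set) module" where
  "gr_module M F =
     \<lparr>carrier = gr_carrier M F, monoid.mult = undefined, monoid.one = undefined,
      zero = gr_zero M F, add = gr_add M F, smult = gr_smult M F\<rparr>"

text \<open>The maximal homogeneous ideal \<open>\<mm>/\<qq> \<oplus> \<qq>/\<qq>\<^sup>2 \<oplus> \<qq>\<^sup>2/\<qq>\<^sup>3 \<oplus> \<dots>\<close> of \<open>gr_ring R \<qq>\<close>.\<close>

definition gr_max_ideal ::
  "('a, 'k) ring_scheme \<Rightarrow> 'a set \<Rightarrow> 'a set \<Rightarrow> (nat \<Rightarrow> 'a set) set" where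
  "gr_max_ideal R \<mm> \<qq> = {f \<in> carrier (gr_ring R \<qq>). f 0 \<subseteq> \<mm>}"

end

(*
  Let a_1, ..., a_t be the superficial sequence, L_i = (a_1, ..., a_i)M, and let h_i be the Hilbert
  function of the filtration induced on M/L_i.  Comparing kernel and cokernel of multiplication by
  a = a_{i+1} from M/(F_n + L_i) to M/(F_{n+1} + L_i) gives the exact formula

    h_i(n) + length(((F_{n+1} + L_i) : a) / (F_n + L_i)) = h_{i+1}(0) + ... + h_{i+1}(n),

  so h_0 is bounded by the t-fold iterated partial sums of h_t, and these by the right-hand side
  with exponent t; the superficial conditions give a chain of primes showing t <= r.  In the case of
  equality t = r and all the colon modules are as small as possible.  By Nakayama's lemma the a_i
  then form a regular sequence on M, and by the argument of Valabrega and Valla their initial forms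
  form a regular sequence on gr(M).  Depth never exceeds dimension, and dim gr(M) <= r because a
  chain of k + 1 primes of gr(A) containing the annihilator of gr(M) forces the growth of gr(M) to
  have degree at least k.
*)
theory Submission
  imports Defs
begin

text \<open>The numerator enters only through its partial sums. For n >= 1 they equal lambda(M/M_1)
  + lambda(M_1/JM) = lambda(M/JM), which caps lambda(M/(F_{n+1} + JM)); for n = 0 both are
  lambda(M/M_1), since JM lies in F_1. Hence the partial sums of h_t, not h_t itself, are compared
  with those of the numerator, and t >= 1 provides the summation that this uses up. Dividing by 1 -
  z is summation, so raising the exponent from t to r enlarges a nonnegative function, strictly
  unless it is zero; as lambda(M/JM) > 0, equality forces t = r. Summation is injective, so equality
  at the two ends of the chain of inequalities holds at every link, and the colon modules become
  minimal for every n, while superficiality speaks only of large n. This gives regularity modulo the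
  intersections of all F_n + L_i, which descending induction from L_t reduces to L_i. The inequality
  itself, summed once more, bounds lambda(M/F_n) by lambda(M/JM) n^r; this is the growth rate that
  limits dim gr(M).\<close>

section \<open>Chains of sets and their heights\<close>

definition chain_in :: "'a set set \<Rightarrow> nat \<Rightarrow> (nat \<Rightarrow> 'a set) \<Rightarrow> bool" where
  "chain_in S n p \<longleftrightarrow> (\<forall>i\<le>n. p i \<in> S) \<and> (\<forall>i<n. p i \<subset> p (Suc i))"

text \<open>Module length and Krull dimension are both heights of families ordered by inclusion, so
  one theory of chains serves both. A chain of height \<open>n\<close> has \<open>n + 1\<close>
  members, and the empty family gets height 0.\<close>

definition height :: "'a set set \<Rightarrow> enat" where
  "height S = Sup {enat n | n. \<exists>p. chain_in S n p}"

lemma module_length_height: "module_length R M = height {N. submodule N R M}"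
  by (simp add: module_length_def height_def chain_in_def)

lemma krull_dim_height: "krull_dim R = height {P. primeideal P R}"
  by (simp add: krull_dim_def height_def chain_in_def)

lemma height_geI: "chain_in S n p \<Longrightarrow> enat n \<le> height S"
  unfolding height_def by (rule Sup_upper) auto

lemma height_leI: "(\<And>n p. chain_in S n p \<Longrightarrow> enat n \<le> k) \<Longrightarrow> height S \<le> k"
  unfolding height_def by (rule Sup_least) auto

lemma chain_in_map:
  assumes "\<And>X. X \<in> S \<Longrightarrow> \<Phi> X \<in> T"
    and "\<And>X Y. X \<in> S \<Longrightarrow> Y \<in> S \<Longrightarrow> X \<subset> Y \<Longrightarrow> \<Phi> X \<subset> \<Phi> Y"
    and "chain_in S n p"
  shows "chain_in T n (\<lambda>i. \<Phi> (p i))"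
  using assms unfolding chain_in_def by (metis Suc_leI less_imp_le_nat)

text \<open>Most comparisons of lengths and dimensions below are instances of this, with an explicit
  strictly monotone map between two families.\<close>

lemma height_mono_map:
  assumes "\<And>X. X \<in> S \<Longrightarrow> \<Phi> X \<in> T"
    and "\<And>X Y. X \<in> S \<Longrightarrow> Y \<in> S \<Longrightarrow> X \<subset> Y \<Longrightarrow> \<Phi> X \<subset> \<Phi> Y"
  shows "height S \<le> height T"
  by (rule height_leI) (rule height_geI, rule chain_in_map[OF assms])

lemma height_mono: "S \<subseteq> T \<Longrightarrow> height S \<le> height T"
  by (rule height_mono_map[where \<Phi>="\<lambda>X. X"]) auto

lemma chain_in_le: "chain_in S n p \<Longrightarrow> m \<le> n \<Longrightarrow> chain_in S m p"
  by (auto simp: chain_in_def)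

text \<open>Chains can be truncated, so if none has \<open>k + 1\<close> steps, none has more and
  the height is at most \<open>k\<close>. Nonemptiness settles \<open>n = 0\<close>, where the
  supremum over no chains would also be 0.\<close>

lemma height_ge_iff:
  assumes "S \<noteq> {}"
  shows "enat n \<le> height S \<longleftrightarrow> (\<exists>p. chain_in S n p)"
proof
  assume h: "enat n \<le> height S"
  show "\<exists>p. chain_in S n p"
  proof (rule ccontr)
    assume c: "\<not> ?thesis"
    then obtain k where k: "n = Suc k"
      using assms by (cases n) (auto simp: chain_in_def)
    have "height S \<le> enat k"
    proof (rule height_leI)
      fix m p assume "chain_in S m p"
      hence "\<not> n \<le> m" using c chain_in_le by blast
      thus "enat m \<le> enat k" using k by simp
    qed
    hence "enat (Suc k) \<le> enat k" using h k by (metis order_trans)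
    thus False by simp
  qed
qed (auto intro: height_geI)

lemma chain_in_snoc:
  assumes "chain_in S n p" "p n \<subset> X" "X \<in> S"
  shows "chain_in S (Suc n) (p(Suc n := X))"
  using assms unfolding chain_in_def by (auto simp: le_Suc_eq less_Suc_eq)

lemma chain_in_const: "X \<in> S \<Longrightarrow> chain_in S 0 (\<lambda>_. X)"
  by (simp add: chain_in_def)

text \<open>Project a chain by \<open>f\<close> and by \<open>g\<close>. Each of its steps stays
  strict in at least one projection; deleting repetitions leaves two chains whose lengths add up to
  at least \<open>n\<close>.\<close>

lemma height_le_add:
  assumes f: "\<And>X. X \<in> S \<Longrightarrow> f X \<in> S1" "\<And>X Y. X \<in> S \<Longrightarrow> Y \<in> S \<Longrightarrow> X \<subset> Y \<Longrightarrow> f X \<subseteq> f Y"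
    and g: "\<And>X. X \<in> S \<Longrightarrow> g X \<in> S2" "\<And>X Y. X \<in> S \<Longrightarrow> Y \<in> S \<Longrightarrow> X \<subset> Y \<Longrightarrow> g X \<subseteq> g Y"
    and strict: "\<And>X Y. X \<in> S \<Longrightarrow> Y \<in> S \<Longrightarrow> X \<subset> Y \<Longrightarrow> f X \<noteq> f Y \<or> g X \<noteq> g Y"
  shows "height S \<le> height S1 + height S2"
proof (rule height_leI)
  fix n p assume p: "chain_in S n p"
  \<comment> \<open>The last members of both projected chains are recorded, since the next strict
    step is appended to them.\<close>
  have "\<exists>a b r s. n \<le> a + b \<and> chain_in S1 a r \<and> r a = f (p n) \<and> chain_in S2 b s \<and> s b = g (p n)"
    using p
  proof (induction n)
    case 0
    hence "p 0 \<in> S" by (simp add: chain_in_def)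
    thus ?case using f(1) g(1) chain_in_const by (metis le_add1 plus_nat.add_0)
  next
    case (Suc n)
    have "chain_in S n p" using Suc.prems chain_in_le by (metis le_SucI order_refl)
    then obtain a b r s where *: "n \<le> a + b" "chain_in S1 a r" "r a = f (p n)"
      "chain_in S2 b s" "s b = g (p n)" using Suc.IH by blast
    have pp: "p n \<in> S" "p (Suc n) \<in> S" "p n \<subset> p (Suc n)"
      using Suc.prems by (auto simp: chain_in_def)
    obtain a' r' where 1: "chain_in S1 a' r'" "r' a' = f (p (Suc n))"
      "a \<le> a'" "f (p n) \<noteq> f (p (Suc n)) \<Longrightarrow> a < a'"
    proof (cases "f (p n) = f (p (Suc n))")
      case True thus ?thesis using * that by force
    next
      case False
      hence "r a \<subset> f (p (Suc n))" using f(2)[OF pp] * by auto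
      from chain_in_snoc[OF *(2) this f(1)[OF pp(2)]]
      show ?thesis by (rule that) auto
    qed
    obtain b' s' where 2: "chain_in S2 b' s'" "s' b' = g (p (Suc n))"
      "b \<le> b'" "g (p n) \<noteq> g (p (Suc n)) \<Longrightarrow> b < b'"
    proof (cases "g (p n) = g (p (Suc n))")
      case True thus ?thesis using * that by force
    next
      case False
      hence "s b \<subset> g (p (Suc n))" using g(2)[OF pp] * by auto
      from chain_in_snoc[OF *(4) this g(1)[OF pp(2)]]
      show ?thesis by (rule that) auto
    qed
    have "Suc n \<le> a' + b'" using 1 2 *(1) strict[OF pp] by linarith
    thus ?case using 1 2 by blast
  qed
  then obtain a b r s where *: "n \<le> a + b" "chain_in S1 a r" "chain_in S2 b s" by blast
  have "enat n \<le> enat a + enat b" using *(1) by simp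
  also have "\<dots> \<le> height S1 + height S2" by (intro add_mono height_geI[OF *(2)] height_geI[OF *(3)])
  finally show "enat n \<le> height S1 + height S2" .
qed

lemma height_add_le:
  assumes "S1 \<noteq> {}" "S2 \<noteq> {}" "S1 \<subseteq> S" "S2 \<subseteq> S"
    and le: "\<And>X Y. X \<in> S1 \<Longrightarrow> Y \<in> S2 \<Longrightarrow> X \<subseteq> Y"
  shows "height S1 + height S2 \<le> height S"
proof -
  have *: "enat (a + b) \<le> height S" if ab: "enat a \<le> height S1" "enat b \<le> height S2" for a b
  proof -
    obtain p q where p: "chain_in S1 a p" and q: "chain_in S2 b q"
      using ab height_ge_iff assms(1,2) by metis
    \<comment> \<open>The top \<open>p a\<close> of the lower chain is dropped: at the junction,
      strictness comes from \<open>p (a - 1) \<subset> p a \<subseteq> q 0\<close>, while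
      \<open>p a = q 0\<close> is possible.\<close>
    have "chain_in S (a + b) (\<lambda>i. if i < a then p i else q (i - a))"
      unfolding chain_in_def
    proof (intro conjI allI impI)
      fix i assume "i \<le> a + b"
      thus "(if i < a then p i else q (i - a)) \<in> S"
        using p q assms(3,4) by (auto simp: chain_in_def)
    next
      fix i assume i: "i < a + b"
      consider "Suc i < a" | "Suc i = a" | "a \<le> i" by linarith
      thus "(if i < a then p i else q (i - a)) \<subset> (if Suc i < a then p (Suc i) else q (Suc i - a))"
      proof cases
        case 2
        have "p i \<subset> p a" "p a \<subseteq> q 0" using p q le 2 by (auto simp: chain_in_def)
        thus ?thesis using 2 by auto
      qed (use p q i in \<open>auto simp: chain_in_def Suc_diff_le\<close>)
    qed
    thus ?thesis by (rule height_geI)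
  qed
  show ?thesis
  proof (cases "height S1 = \<infinity> \<or> height S2 = \<infinity>")
    case True
    have "enat n \<le> height S" for n
      using True *[of n 0] *[of 0 n] by (auto simp: zero_enat_def[symmetric])
    hence "height S = \<infinity>" by (metis enat_ord_simps(1) not_less_eq_eq enat.exhaust)
    thus ?thesis by simp
  next
    case False
    then obtain a b where "height S1 = enat a" "height S2 = enat b" by auto
    thus ?thesis using *[of a b] by simp
  qed
qed

section \<open>Modules\<close>

locale rmodule = module R M for R :: "('a, 'k) ring_scheme" (structure) and M :: "('a, 'b) module" (structure)

lemma rmoduleI: "Module.module R M \<Longrightarrow> rmodule R M"
  by (simp add: rmodule_def)

lemma a_r_coset_carrier_update [simp]: "L +>\<^bsub>M\<lparr>carrier := N\<rparr>\<^esub> x = L +>\<^bsub>M\<^esub> x"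
  by (simp add: a_r_coset_def')

context rmodule
begin

abbreviation sub where "sub N \<equiv> submodule N R M"

lemmas submodule_mem_carrier = subsetD[OF submoduleE(1)]
lemmas submodule_add = submoduleE(5)
lemmas submodule_smult = submoduleE(4)
lemmas submodule_neg = submoduleE(3)

lemma submodule_zero: "sub N \<Longrightarrow> \<zero>\<^bsub>M\<^esub> \<in> N"
  by (metis monoid.simps(2) subgroup.one_closed submodule.axioms(1))

lemma submodule_diff: "sub N \<Longrightarrow> x \<in> N \<Longrightarrow> y \<in> N \<Longrightarrow> x \<ominus>\<^bsub>M\<^esub> y \<in> N"
  by (simp add: a_minus_def submodule_add submodule_neg)

lemma submodule_add_iff:
  assumes N: "sub N" and x: "x \<in> N" and y: "y \<in> carrier M"
  shows "x \<oplus>\<^bsub>M\<^esub> y \<in> N \<longleftrightarrow> y \<in> N"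
proof
  assume "x \<oplus>\<^bsub>M\<^esub> y \<in> N"
  hence "\<ominus>\<^bsub>M\<^esub> x \<oplus>\<^bsub>M\<^esub> (x \<oplus>\<^bsub>M\<^esub> y) \<in> N"
    by (rule submodule_add[OF N submodule_neg[OF N x]])
  thus "y \<in> N" using submodule_mem_carrier[OF N x] y by (simp add: M.r_neg1)
qed (use submodule_add[OF N x] in auto)

lemma submodule_Inter:
  assumes "\<And>N. N \<in> S \<Longrightarrow> sub N" "S \<noteq> {}" shows "sub (\<Inter>S)"
  by (rule submoduleI) (use assms in \<open>auto intro: submodule_add submodule_smult submodule_neg
    submodule_zero dest: submodule_mem_carrier\<close>)

lemma submodule_Int: "sub N \<Longrightarrow> sub L \<Longrightarrow> sub (N \<inter> L)"
  using submodule_Inter[of "{N, L}"] by auto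

lemma mem_sum_iff: "x \<in> N <+>\<^bsub>M\<^esub> L \<longleftrightarrow> (\<exists>n\<in>N. \<exists>l\<in>L. x = n \<oplus>\<^bsub>M\<^esub> l)"
  by (auto simp: set_add_def')

lemma submodule_sum:
  assumes N: "sub N" and L: "sub L" shows "sub (N <+>\<^bsub>M\<^esub> L)"
proof (rule submoduleI)
  note mem = submodule_mem_carrier[OF N] submodule_mem_carrier[OF L]
  show "N <+>\<^bsub>M\<^esub> L \<subseteq> carrier M" using mem by (auto simp: mem_sum_iff)
  show "\<zero>\<^bsub>M\<^esub> \<in> N <+>\<^bsub>M\<^esub> L"
    using submodule_zero[OF N] submodule_zero[OF L] by (force simp: mem_sum_iff)
  fix a assume "a \<in> N <+>\<^bsub>M\<^esub> L"
  then obtain n l where a: "n \<in> N" "l \<in> L" "a = n \<oplus>\<^bsub>M\<^esub> l" by (auto simp: mem_sum_iff)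
  have "\<ominus>\<^bsub>M\<^esub> a = \<ominus>\<^bsub>M\<^esub> n \<oplus>\<^bsub>M\<^esub> \<ominus>\<^bsub>M\<^esub> l" using a mem by (simp add: M.minus_add)
  thus "\<ominus>\<^bsub>M\<^esub> a \<in> N <+>\<^bsub>M\<^esub> L"
    using a submodule_neg[OF N] submodule_neg[OF L] by (auto simp: mem_sum_iff)
  fix b assume "b \<in> N <+>\<^bsub>M\<^esub> L"
  then obtain n' l' where b: "n' \<in> N" "l' \<in> L" "b = n' \<oplus>\<^bsub>M\<^esub> l'" by (auto simp: mem_sum_iff)
  have "a \<oplus>\<^bsub>M\<^esub> b = (n \<oplus>\<^bsub>M\<^esub> n') \<oplus>\<^bsub>M\<^esub> (l \<oplus>\<^bsub>M\<^esub> l')"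
    using a b mem by (simp add: M.a_ac)
  thus "a \<oplus>\<^bsub>M\<^esub> b \<in> N <+>\<^bsub>M\<^esub> L"
    using a b submodule_add[OF N] submodule_add[OF L] unfolding mem_sum_iff by blast
next
  note mem = submodule_mem_carrier[OF N] submodule_mem_carrier[OF L]
  fix a x assume a: "a \<in> carrier R" and "x \<in> N <+>\<^bsub>M\<^esub> L"
  then obtain n l where x: "n \<in> N" "l \<in> L" "x = n \<oplus>\<^bsub>M\<^esub> l" by (auto simp: mem_sum_iff)
  have "a \<odot>\<^bsub>M\<^esub> x = a \<odot>\<^bsub>M\<^esub> n \<oplus>\<^bsub>M\<^esub> a \<odot>\<^bsub>M\<^esub> l" using a x mem by (simp add: smult_r_distr)
  thus "a \<odot>\<^bsub>M\<^esub> x \<in> N <+>\<^bsub>M\<^esub> L"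
    using a x submodule_smult[OF N] submodule_smult[OF L] unfolding mem_sum_iff by metis
qed

lemma sum_upper1: assumes N: "sub N" and L: "sub L" shows "N \<subseteq> N <+>\<^bsub>M\<^esub> L"
proof
  fix x assume "x \<in> N"
  thus "x \<in> N <+>\<^bsub>M\<^esub> L" using submodule_zero[OF L] submodule_mem_carrier[OF N] M.r_zero
    unfolding mem_sum_iff by metis
qed

lemma sum_upper2: assumes N: "sub N" and L: "sub L" shows "L \<subseteq> N <+>\<^bsub>M\<^esub> L"
proof
  fix x assume "x \<in> L"
  thus "x \<in> N <+>\<^bsub>M\<^esub> L" using submodule_zero[OF N] submodule_mem_carrier[OF L] M.l_zero
    unfolding mem_sum_iff by metis
qed

lemma sum_least: "sub X \<Longrightarrow> N \<subseteq> X \<Longrightarrow> L \<subseteq> X \<Longrightarrow> N <+>\<^bsub>M\<^esub> L \<subseteq> X"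
  by (auto simp: mem_sum_iff intro!: submodule_add)

lemma sum_mono: "N \<subseteq> N' \<Longrightarrow> L \<subseteq> L' \<Longrightarrow> N <+>\<^bsub>M\<^esub> L \<subseteq> N' <+>\<^bsub>M\<^esub> L'"
  unfolding set_add_def' by blast

lemma sum_absorb: "sub N \<Longrightarrow> sub L \<Longrightarrow> N \<subseteq> L \<Longrightarrow> N <+>\<^bsub>M\<^esub> L = L"
  by (simp add: subset_antisym sum_least sum_upper2)

lemma submodule_span:
  assumes "S \<subseteq> carrier M"
  shows "sub (submodule_span R M S)" "S \<subseteq> submodule_span R M S"
  unfolding submodule_span_def
  by (rule submodule_Inter) (use assms carrier_is_submodule in auto)

lemma span_minimal: "sub N \<Longrightarrow> S \<subseteq> N \<Longrightarrow> submodule_span R M S \<subseteq> N"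
  unfolding submodule_span_def by blast

lemma span_mono: "S \<subseteq> T \<Longrightarrow> submodule_span R M S \<subseteq> submodule_span R M T"
  unfolding submodule_span_def by blast

lemma span_of_submodule: "sub N \<Longrightarrow> submodule_span R M N = N"
  using span_minimal submodule_span(2) submoduleE(1) by (metis subset_antisym subset_refl)

lemma submodule_smult_image:
  assumes N: "sub N" and a: "a \<in> carrier R"
  shows "sub ((\<lambda>x. a \<odot>\<^bsub>M\<^esub> x) ` N)"
proof (rule submoduleI)
  note mem = submodule_mem_carrier[OF N]
  show "(\<odot>\<^bsub>M\<^esub>) a ` N \<subseteq> carrier M" using a mem by auto
  show "\<zero>\<^bsub>M\<^esub> \<in> (\<odot>\<^bsub>M\<^esub>) a ` N" using smult_r_null[OF a] submodule_zero[OF N] by (metis imageI)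
  show "\<ominus>\<^bsub>M\<^esub> x \<in> (\<odot>\<^bsub>M\<^esub>) a ` N" if "x \<in> (\<odot>\<^bsub>M\<^esub>) a ` N" for x
    using that a mem submodule_neg[OF N] by (auto simp: smult_r_minus[symmetric])
  show "x \<oplus>\<^bsub>M\<^esub> y \<in> (\<odot>\<^bsub>M\<^esub>) a ` N" if "x \<in> (\<odot>\<^bsub>M\<^esub>) a ` N" "y \<in> (\<odot>\<^bsub>M\<^esub>) a ` N" for x y
    using that a mem submodule_add[OF N] by (auto simp: smult_r_distr[symmetric])
  show "b \<odot>\<^bsub>M\<^esub> x \<in> (\<odot>\<^bsub>M\<^esub>) a ` N" if "b \<in> carrier R" "x \<in> (\<odot>\<^bsub>M\<^esub>) a ` N" for b x
  proof -
    from that obtain y where y: "y \<in> N" "x = a \<odot>\<^bsub>M\<^esub> y" by auto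
    have "b \<odot>\<^bsub>M\<^esub> x = a \<odot>\<^bsub>M\<^esub> (b \<odot>\<^bsub>M\<^esub> y)"
      using y that a mem by (metis R.m_comm smult_assoc1)
    thus ?thesis using y that submodule_smult[OF N] by auto
  qed
qed

lemma submodule_line:
  assumes s: "s \<in> carrier M" shows "sub ((\<lambda>a. a \<odot>\<^bsub>M\<^esub> s) ` carrier R)"
proof (rule submoduleI)
  show "(\<lambda>a. a \<odot>\<^bsub>M\<^esub> s) ` carrier R \<subseteq> carrier M" using s by auto
  show "\<zero>\<^bsub>M\<^esub> \<in> (\<lambda>a. a \<odot>\<^bsub>M\<^esub> s) ` carrier R" using smult_l_null[OF s] by (metis imageI R.zero_closed)
  show "\<ominus>\<^bsub>M\<^esub> x \<in> (\<lambda>a. a \<odot>\<^bsub>M\<^esub> s) ` carrier R" if "x \<in> (\<lambda>a. a \<odot>\<^bsub>M\<^esub> s) ` carrier R" for x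
    using that s by (auto simp: smult_l_minus[symmetric])
  show "x \<oplus>\<^bsub>M\<^esub> y \<in> (\<lambda>a. a \<odot>\<^bsub>M\<^esub> s) ` carrier R"
    if "x \<in> (\<lambda>a. a \<odot>\<^bsub>M\<^esub> s) ` carrier R" "y \<in> (\<lambda>a. a \<odot>\<^bsub>M\<^esub> s) ` carrier R" for x y
    using that s by (auto simp: smult_l_distr[symmetric])
  show "b \<odot>\<^bsub>M\<^esub> x \<in> (\<lambda>a. a \<odot>\<^bsub>M\<^esub> s) ` carrier R"
    if "b \<in> carrier R" "x \<in> (\<lambda>a. a \<odot>\<^bsub>M\<^esub> s) ` carrier R" for b x
    using that s by (auto simp: smult_assoc1[symmetric])
qed

lemma span_insert:
  assumes s: "s \<in> carrier M" and S: "S \<subseteq> carrier M"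
  shows "submodule_span R M (insert s S) = (\<lambda>a. a \<odot>\<^bsub>M\<^esub> s) ` carrier R <+>\<^bsub>M\<^esub> submodule_span R M S"
    (is "?L = ?l <+>\<^bsub>M\<^esub> ?S")
proof
  note sl = submodule_line[OF s] and sS = submodule_span[OF S]
  have "s \<in> ?l" using s by (metis imageI R.one_closed smult_one)
  thus "?L \<subseteq> ?l <+>\<^bsub>M\<^esub> ?S"
    by (intro span_minimal submodule_sum sl sS)
      (use sum_upper1[OF sl sS(1)] sum_upper2[OF sl sS(1)] sS(2) in auto)
  have L: "sub ?L" "insert s S \<subseteq> ?L" using submodule_span[of "insert s S"] s S by auto
  show "?l <+>\<^bsub>M\<^esub> ?S \<subseteq> ?L"
  proof (intro sum_least L)
    show "?l \<subseteq> ?L" using L submodule_smult[OF L(1)] by auto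
    show "?S \<subseteq> ?L" by (rule span_mono) auto
  qed
qed

lemma mem_span_insert:
  assumes "s \<in> carrier M" "S \<subseteq> carrier M"
  shows "x \<in> submodule_span R M (insert s S) \<longleftrightarrow>
    (\<exists>a\<in>carrier R. \<exists>y\<in>submodule_span R M S. x = a \<odot>\<^bsub>M\<^esub> s \<oplus>\<^bsub>M\<^esub> y)"
  unfolding span_insert[OF assms] mem_sum_iff by blast

lemma span_empty: "submodule_span R M {} = {\<zero>\<^bsub>M\<^esub>}"
proof -
  have "sub {\<zero>\<^bsub>M\<^esub>}" by (rule submoduleI) auto
  thus ?thesis using span_minimal[of "{\<zero>\<^bsub>M\<^esub>}" "{}"] submodule_zero[OF submodule_span(1)[of "{}"]]
    by auto
qed

lemma ideal_smult_gens_subset: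
  "I \<subseteq> carrier R \<Longrightarrow> N \<subseteq> carrier M \<Longrightarrow> {a \<odot>\<^bsub>M\<^esub> x |a x. a \<in> I \<and> x \<in> N} \<subseteq> carrier M"
  by auto

lemma submodule_ideal_smult:
  "I \<subseteq> carrier R \<Longrightarrow> N \<subseteq> carrier M \<Longrightarrow> sub (ideal_smult R M I N)"
  unfolding ideal_smult_def by (intro submodule_span ideal_smult_gens_subset)

lemma mem_ideal_smult:
  "I \<subseteq> carrier R \<Longrightarrow> N \<subseteq> carrier M \<Longrightarrow> a \<in> I \<Longrightarrow> x \<in> N \<Longrightarrow> a \<odot>\<^bsub>M\<^esub> x \<in> ideal_smult R M I N"
  unfolding ideal_smult_def using submodule_span(2)[OF ideal_smult_gens_subset] by blast

lemma ideal_smult_minimal: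
  "sub X \<Longrightarrow> (\<And>a x. a \<in> I \<Longrightarrow> x \<in> N \<Longrightarrow> a \<odot>\<^bsub>M\<^esub> x \<in> X) \<Longrightarrow> ideal_smult R M I N \<subseteq> X"
  unfolding ideal_smult_def by (rule span_minimal) auto

lemma ideal_smult_mono: "I \<subseteq> I' \<Longrightarrow> N \<subseteq> N' \<Longrightarrow> ideal_smult R M I N \<subseteq> ideal_smult R M I' N'"
  unfolding ideal_smult_def by (rule span_mono) auto

lemma ideal_smult_le: "sub N \<Longrightarrow> I \<subseteq> carrier R \<Longrightarrow> ideal_smult R M I N \<subseteq> N"
  by (rule ideal_smult_minimal) (auto intro: submodule_smult)

text \<open>The colon ideal of \<open>N\<close> into \<open>X\<close>. A property of this shape is
  checked on generators of an ideal by placing them here, and the prime chains below are built over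
  such ideals.\<close>

lemma ideal_transporter:
  assumes X: "sub X" and N: "N \<subseteq> carrier M"
  shows "ideal {a \<in> carrier R. \<forall>x\<in>N. a \<odot>\<^bsub>M\<^esub> x \<in> X} R"
proof (rule idealI)
  have x: "x \<in> carrier M" if "x \<in> N" for x using that N by auto
  show "subgroup {a \<in> carrier R. \<forall>x\<in>N. a \<odot>\<^bsub>M\<^esub> x \<in> X} (add_monoid R)"
    by (rule subgroup.intro)
      (use X x in \<open>auto simp: smult_l_distr smult_l_minus submodule_add submodule_neg submodule_zero
        simp flip: a_inv_def\<close>)
  fix a y assume a: "a \<in> {a \<in> carrier R. \<forall>x\<in>N. a \<odot>\<^bsub>M\<^esub> x \<in> X}" and y: "y \<in> carrier R"
  show "y \<otimes> a \<in> {a \<in> carrier R. \<forall>x\<in>N. a \<odot>\<^bsub>M\<^esub> x \<in> X}"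
    using a y x X by (auto simp: smult_assoc1 submodule_smult)
  thus "a \<otimes> y \<in> {a \<in> carrier R. \<forall>x\<in>N. a \<odot>\<^bsub>M\<^esub> x \<in> X}"
    using a y by (simp add: R.m_comm)
qed (rule R.ring_axioms)

lemma ideal_smult_Idl_subset:
  assumes S: "S \<subseteq> carrier R" and N: "sub N" and X: "sub X"
    and "\<And>a x. a \<in> S \<Longrightarrow> x \<in> N \<Longrightarrow> a \<odot>\<^bsub>M\<^esub> x \<in> X"
  shows "ideal_smult R M (Idl S) N \<subseteq> X"
proof -
  have "Idl S \<subseteq> {a \<in> carrier R. \<forall>x\<in>N. a \<odot>\<^bsub>M\<^esub> x \<in> X}"
    by (rule R.genideal_minimal[OF ideal_transporter[OF X submoduleE(1)[OF N]]]) (use assms in auto)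
  thus ?thesis by (intro ideal_smult_minimal X) auto
qed

lemma ideal_smult_insert:
  assumes a: "a \<in> carrier R" and S: "S \<subseteq> carrier R" and N: "sub N"
  shows "ideal_smult R M (Idl (insert a S)) N = ideal_smult R M (Idl S) N <+>\<^bsub>M\<^esub> (\<odot>\<^bsub>M\<^esub>) a ` N"
    (is "?L = ?A <+>\<^bsub>M\<^esub> ?B")
proof
  have I: "Idl S \<subseteq> carrier R" "Idl (insert a S) \<subseteq> carrier R"
    using R.genideal_ideal a S by (meson ideal.Icarr insert_subset subsetI)+
  have A: "sub ?A" and B: "sub ?B" using I N a
    by (auto intro!: submodule_ideal_smult submodule_smult_image dest: submodule_mem_carrier)
  have Nc: "N \<subseteq> carrier M" using N by (rule submoduleE(1))
  have AB: "?A \<subseteq> ?A <+>\<^bsub>M\<^esub> ?B" "?B \<subseteq> ?A <+>\<^bsub>M\<^esub> ?B" using sum_upper1[OF A B] sum_upper2[OF A B] .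
  show "?L \<subseteq> ?A <+>\<^bsub>M\<^esub> ?B"
  proof (rule ideal_smult_Idl_subset)
    fix b x assume b: "b \<in> insert a S" and x: "x \<in> N"
    show "b \<odot>\<^bsub>M\<^esub> x \<in> ?A <+>\<^bsub>M\<^esub> ?B"
    proof (cases "b = a")
      case True thus ?thesis using AB x by auto
    next
      case False
      hence "b \<in> Idl S" using b R.genideal_self[OF S] by auto
      thus ?thesis using AB mem_ideal_smult[OF I(1) Nc] x by auto
    qed
  qed (use a S N submodule_sum[OF A B] in auto)
  have "a \<in> Idl (insert a S)" using R.genideal_self[of "insert a S"] a S by auto
  hence "?B \<subseteq> ?L" using mem_ideal_smult[OF I(2) Nc] by auto
  moreover have "?A \<subseteq> ?L"
    by (rule ideal_smult_mono) (use R.subset_Idl_subset[of "insert a S" S] a S in auto)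
  ultimately show "?A <+>\<^bsub>M\<^esub> ?B \<subseteq> ?L"
    by (intro sum_least submodule_ideal_smult I Nc)
qed

lemma genideal_empty: "Idl {} = {\<zero>}"
  using R.genideal_minimal[OF R.zeroideal, of "{}"] R.genideal_ideal[of "{}"]
  by (metis additive_subgroup.zero_closed empty_subsetI ideal.axioms(1) insert_absorb insert_subset
      subset_singletonD singleton_insert_inj_eq)

lemma seq_submodule_Nil: "seq_submodule R M [] = {\<zero>\<^bsub>M\<^esub>}"
proof -
  have s: "sub {\<zero>\<^bsub>M\<^esub>}" by (rule submoduleI) auto
  have "ideal_smult R M {\<zero>} (carrier M) \<subseteq> {\<zero>\<^bsub>M\<^esub>}"
    by (rule ideal_smult_minimal[OF s]) auto
  moreover have "\<zero>\<^bsub>M\<^esub> \<in> ideal_smult R M {\<zero>} (carrier M)"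
    by (intro submodule_zero submodule_ideal_smult) auto
  ultimately show ?thesis unfolding seq_submodule_def by (auto simp: genideal_empty)
qed

lemma submodule_seq_submodule: "set xs \<subseteq> carrier R \<Longrightarrow> sub (seq_submodule R M xs)"
  unfolding seq_submodule_def
  by (intro submodule_ideal_smult) (auto intro: ideal.Icarr[OF R.genideal_ideal])

lemma seq_submodule_snoc:
  assumes "set xs \<subseteq> carrier R" "a \<in> carrier R"
  shows "seq_submodule R M (xs @ [a]) = seq_submodule R M xs <+>\<^bsub>M\<^esub> (\<odot>\<^bsub>M\<^esub>) a ` carrier M"
  using ideal_smult_insert[OF assms(2,1) carrier_is_submodule]
  unfolding seq_submodule_def by simp

end

section \<open>Prime ideals\<close>

text \<open>Zorn's lemma in a form with two uses: a multiplicative \<open>S\<close> leads to a prime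
  ideal, and \<open>S = {\<one>}\<close> to a maximal ideal.\<close>

lemma (in ring) exists_maximal_disjoint_ideal:
  assumes "ideal I R" "I \<inter> S = {}"
  shows "\<exists>P. ideal P R \<and> I \<subseteq> P \<and> P \<inter> S = {} \<and>
    (\<forall>J. ideal J R \<longrightarrow> P \<subseteq> J \<longrightarrow> J \<inter> S = {} \<longrightarrow> J = P)"
proof -
  let ?A = "{J. ideal J R \<and> I \<subseteq> J \<and> J \<inter> S = {}}"
  have "\<exists>P\<in>?A. \<forall>X\<in>?A. P \<subseteq> X \<longrightarrow> X = P"
  proof (rule subset_Zorn_nonempty)
    fix C assume C: "C \<noteq> {}" "subset.chain ?A C"
    have "subset.chain {J. ideal J R} C" using C(2) by (auto simp: subset_chain_def)
    hence "ideal (\<Union>C) R" using chain_Union_is_ideal[of C] C(1) by simp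
    thus "\<Union>C \<in> ?A" using C by (auto simp: subset_chain_def)
  qed (use assms in auto)
  then obtain P where P: "P \<in> ?A" "\<forall>X\<in>?A. P \<subseteq> X \<longrightarrow> X = P" by auto
  hence "J = P" if "ideal J R" "P \<subseteq> J" "J \<inter> S = {}" for J using that by auto
  thus ?thesis using P(1) by blast
qed

text \<open>If \<open>a\<close> and \<open>b\<close> lie outside the maximal choice
  \<open>P\<close>, then \<open>S\<close> contains elements \<open>p + r a\<close> and
  \<open>p' + r' b\<close>. Their product is again in \<open>S\<close>, but it would be in
  \<open>P\<close> if \<open>a b\<close> were.\<close>

lemma (in cring) exists_prime_disjoint:
  assumes I: "ideal I R" and IS: "I \<inter> S = {}" and S: "S \<subseteq> carrier R" "\<one> \<in> S"
    and mult: "\<And>s t. s \<in> S \<Longrightarrow> t \<in> S \<Longrightarrow> s \<otimes> t \<in> S"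
  obtains P where "primeideal P R" "I \<subseteq> P" "P \<inter> S = {}"
proof -
  obtain P where P: "ideal P R" "I \<subseteq> P" "P \<inter> S = {}"
    "\<And>J. ideal J R \<Longrightarrow> P \<subseteq> J \<Longrightarrow> J \<inter> S = {} \<Longrightarrow> J = P"
    using exists_maximal_disjoint_ideal[OF I IS] by auto
  interpret P: ideal P R by fact
  have *: "\<exists>p\<in>P. \<exists>r\<in>carrier R. p \<oplus> r \<otimes> a \<in> S" if a: "a \<in> carrier R" "a \<notin> P" for a
  proof -
    let ?J = "P <+>\<^bsub>R\<^esub> PIdl a"
    have J: "ideal ?J R" by (rule add_ideals[OF P(1) cgenideal_ideal[OF a(1)]])
    have mem: "x \<in> ?J \<longleftrightarrow> (\<exists>p\<in>P. \<exists>r\<in>carrier R. x = p \<oplus> r \<otimes> a)" for x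
      by (auto simp: set_add_def' cgenideal_def)
    have "P \<subseteq> ?J"
    proof
      fix p assume p: "p \<in> P"
      hence "p = p \<oplus> \<zero> \<otimes> a" using a P.Icarr by simp
      thus "p \<in> ?J" using mem p by blast
    qed
    moreover have "a \<in> ?J"
    proof -
      have "a = \<zero> \<oplus> \<one> \<otimes> a" using a by simp
      thus ?thesis using mem P.zero_closed by blast
    qed
    ultimately have "?J \<inter> S \<noteq> {}" using P(4)[OF J] a(2) by auto
    then obtain x where "x \<in> ?J" "x \<in> S" by auto
    thus ?thesis using mem[of x] by auto
  qed
  have "primeideal P R"
  proof (rule primeidealI[OF P(1) is_cring])
    show "carrier R \<noteq> P" using P(3) S by auto
    fix a b assume ab: "a \<in> carrier R" "b \<in> carrier R" "a \<otimes> b \<in> P"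
    show "a \<in> P \<or> b \<in> P"
    proof (rule ccontr)
      assume "\<not> ?thesis"
      hence n: "a \<notin> P" "b \<notin> P" by auto
      obtain p r where 1: "p \<in> P" "r \<in> carrier R" "p \<oplus> r \<otimes> a \<in> S" using *[OF ab(1) n(1)] by blast
      obtain p' r' where 2: "p' \<in> P" "r' \<in> carrier R" "p' \<oplus> r' \<otimes> b \<in> S"
        using *[OF ab(2) n(2)] by blast
      have c: "p \<in> carrier R" "p' \<in> carrier R" using 1 2 P.Icarr by auto
      have "(p \<oplus> r \<otimes> a) \<otimes> (p' \<oplus> r' \<otimes> b) =
        p \<otimes> (p' \<oplus> r' \<otimes> b) \<oplus> ((r \<otimes> a) \<otimes> p' \<oplus> (r \<otimes> r') \<otimes> (a \<otimes> b))"
        using c 1 2 ab by (simp add: l_distr r_distr m_ac a_ac)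
      moreover have "p \<otimes> (p' \<oplus> r' \<otimes> b) \<in> P" using c 1 2 ab by (intro P.I_r_closed) auto
      moreover have "(r \<otimes> a) \<otimes> p' \<in> P" using c 1 2 ab by (intro P.I_l_closed) auto
      moreover have "(r \<otimes> r') \<otimes> (a \<otimes> b) \<in> P" by (rule P.I_l_closed) (use 1 2 ab in auto)
      ultimately have "(p \<oplus> r \<otimes> a) \<otimes> (p' \<oplus> r' \<otimes> b) \<in> P" by (simp add: P.a_closed)
      thus False using mult[OF 1(3) 2(3)] P(3) by auto
    qed
  qed
  thus ?thesis using that P by blast
qed

text \<open>The principal ideal of a nonunit misses 1, hence extends to a maximal ideal, which can
  only be \<open>\<mm>\<close>.\<close>

lemma local_ring_unit:
  fixes R (structure)
  assumes loc: "local_ring R \<mm>" and a: "a \<in> carrier R" "a \<notin> \<mm>"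
  shows "a \<in> Units R"
proof (rule ccontr)
  assume nu: "a \<notin> Units R"
  interpret cring R using loc by (simp add: local_ring_def)
  have "PIdl a \<inter> {\<one>} = {}"
    using nu a unfolding cgenideal_def by (auto simp: Units_def) (metis m_comm)
  then obtain P where P: "ideal P R" "PIdl a \<subseteq> P" "P \<inter> {\<one>} = {}"
    "\<And>J. ideal J R \<Longrightarrow> P \<subseteq> J \<Longrightarrow> J \<inter> {\<one>} = {} \<Longrightarrow> J = P"
    using exists_maximal_disjoint_ideal[OF cgenideal_ideal[OF a(1)]] by metis
  have "maximalideal P R"
  proof (rule maximalidealI[OF P(1)])
    show "carrier R \<noteq> P" using P(3) by auto
    fix J assume "ideal J R" "P \<subseteq> J" "J \<subseteq> carrier R"
    thus "J = P \<or> J = carrier R" using P(4)[of J] ideal.one_imp_carrier[of J R] by auto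
  qed
  hence "P = \<mm>" using loc by (simp add: local_ring_def)
  thus False using cgenideal_self[OF a(1)] P(2) a(2) by auto
qed

section \<open>Lengths of intervals of submodules\<close>

definition interval :: "('a, 'k) ring_scheme \<Rightarrow> ('a, 'b) module \<Rightarrow> 'b set \<Rightarrow> 'b set \<Rightarrow> 'b set set" where
  "interval R M L N = {X. submodule X R M \<and> L \<subseteq> X \<and> X \<subseteq> N}"

text \<open>This is the length of \<open>N/L\<close>, read off from the submodules between
  \<open>L\<close> and \<open>N\<close>. Without forming quotients, all lengths live in one ambient
  module and can be added directly; \<open>module_length_quot\<close> links them to
  quotients.\<close>

definition seg_length :: "('a, 'k) ring_scheme \<Rightarrow> ('a, 'b) module \<Rightarrow> 'b set \<Rightarrow> 'b set \<Rightarrow> enat" where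
  "seg_length R M L N = height (interval R M L N)"

context rmodule
begin

abbreviation len where "len \<equiv> seg_length R M"
abbreviation span where "span \<equiv> submodule_span R M"

text \<open>The modular law, in the form that a strict inclusion stays visible after intersecting
  with \<open>K\<close> or after adding \<open>K\<close>.\<close>

lemma modular:
  assumes X: "sub X" and Y: "sub Y" and K: "sub K" and "X \<subseteq> Y"
    and i: "X \<inter> K = Y \<inter> K" and s: "X <+>\<^bsub>M\<^esub> K = Y <+>\<^bsub>M\<^esub> K"
  shows "X = Y"
proof
  show "Y \<subseteq> X"
  proof
    fix y assume y: "y \<in> Y"
    hence "y \<in> X <+>\<^bsub>M\<^esub> K" using s sum_upper1[OF Y K] by auto
    then obtain x k where x: "x \<in> X" "k \<in> K" "y = x \<oplus>\<^bsub>M\<^esub> k" by (auto simp: mem_sum_iff)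
    have "k \<in> Y" using submodule_add_iff[OF Y, of x k] x y assms(4) submodule_mem_carrier[OF K] by auto
    hence "k \<in> X" using x i by blast
    thus "y \<in> X" using x submodule_add[OF X] by auto
  qed
qed fact

text \<open>Upper bound: by \<open>modular\<close>, a step of a chain from \<open>L\<close> to
  \<open>N\<close> is strict in its trace on \<open>K\<close> or in its sum with \<open>K\<close>.
  Lower bound: chains below and above \<open>K\<close> are concatenated.\<close>

lemma len_add:
  assumes L: "sub L" and K: "sub K" and N: "sub N" and LK: "L \<subseteq> K" and KN: "K \<subseteq> N"
  shows "len L N = len L K + len K N"
proof (rule antisym)
  show "len L N \<le> len L K + len K N"
    unfolding seg_length_def
  proof (rule height_le_add[where f="\<lambda>X. X \<inter> K" and g="\<lambda>X. X <+>\<^bsub>M\<^esub> K"])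
    fix X assume X: "X \<in> interval R M L N"
    hence X': "sub X" "L \<subseteq> X" "X \<subseteq> N" by (auto simp: interval_def)
    show "X \<inter> K \<in> interval R M L K"
      using X' submodule_Int[OF X'(1) K] LK by (auto simp: interval_def)
    show "X <+>\<^bsub>M\<^esub> K \<in> interval R M K N"
      using X' submodule_sum[OF X'(1) K] sum_upper2[OF X'(1) K] sum_least[OF N X'(3) KN]
      by (auto simp: interval_def)
    fix Y assume Y: "Y \<in> interval R M L N" and XY: "X \<subset> Y"
    show "X \<inter> K \<subseteq> Y \<inter> K" using XY by auto
    show "X <+>\<^bsub>M\<^esub> K \<subseteq> Y <+>\<^bsub>M\<^esub> K" using XY by (intro sum_mono) auto
    show "X \<inter> K \<noteq> Y \<inter> K \<or> X <+>\<^bsub>M\<^esub> K \<noteq> Y <+>\<^bsub>M\<^esub> K"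
      using modular[OF X'(1) _ K, of Y] XY Y by (auto simp: interval_def)
  qed
  show "len L K + len K N \<le> len L N"
    unfolding seg_length_def
    by (rule height_add_le) (use assms in \<open>auto simp: interval_def\<close>)
qed

lemma len_self [simp]: "len N N = 0"
proof -
  have "len N N \<le> 0" unfolding seg_length_def
  proof (rule height_leI)
    fix n p assume c: "chain_in (interval R M N N) n p"
    have "n = 0"
    proof (rule ccontr)
      assume "n \<noteq> 0"
      hence "p 0 \<subset> p (Suc 0)" "p 0 = N" "p (Suc 0) = N"
        using c by (simp_all add: chain_in_def interval_def subset_antisym)
      thus False by simp
    qed
    thus "enat n \<le> 0" by (simp add: zero_enat_def)
  qed
  thus ?thesis by simp
qed

lemma len_eq_0D:
  assumes "sub L" "sub N" "L \<subseteq> N" "len L N = 0"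
  shows "L = N"
proof (rule ccontr)
  assume "L \<noteq> N"
  hence "chain_in (interval R M L N) 1 (\<lambda>i. if i = 0 then L else N)"
    using assms by (auto simp: chain_in_def interval_def)
  from height_geI[OF this] assms(4) show False
    by (simp add: seg_length_def zero_enat_def)
qed

end

text \<open>A linear map out of \<open>N\<close> induces \<open>N/h\<^sup>-\<^sup>1(L') \<rightarrow> N'/L'\<close>, which is injective.\<close>

locale partial_hom = rmodule R M + M': rmodule R M' for R :: "('a, 'k) ring_scheme" (structure)
    and M :: "('a, 'b) module" (structure) and M' :: "('a, 'c) module" (structure) +
  fixes N :: "'b set" and h :: "'b \<Rightarrow> 'c"
  assumes N: "submodule N R M"
    and h_closed: "x \<in> N \<Longrightarrow> h x \<in> carrier M'"
    and h_add: "x \<in> N \<Longrightarrow> y \<in> N \<Longrightarrow> h (x \<oplus>\<^bsub>M\<^esub> y) = h x \<oplus>\<^bsub>M'\<^esub> h y"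
    and h_smult: "a \<in> carrier R \<Longrightarrow> x \<in> N \<Longrightarrow> h (a \<odot>\<^bsub>M\<^esub> x) = a \<odot>\<^bsub>M'\<^esub> h x"
begin

lemma h_neg: "x \<in> N \<Longrightarrow> h (\<ominus>\<^bsub>M\<^esub> x) = \<ominus>\<^bsub>M'\<^esub> h x"
proof -
  assume x: "x \<in> N"
  have "\<ominus>\<^bsub>M\<^esub> x = (\<ominus>\<^bsub>R\<^esub> \<one>\<^bsub>R\<^esub>) \<odot>\<^bsub>M\<^esub> x"
    using submodule_mem_carrier[OF N x] by (simp add: smult_l_minus)
  thus ?thesis using h_smult[of "\<ominus>\<^bsub>R\<^esub> \<one>\<^bsub>R\<^esub>" x] x h_closed by (simp add: M'.smult_l_minus)
qed

lemma h_zero: "h \<zero>\<^bsub>M\<^esub> = \<zero>\<^bsub>M'\<^esub>"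
  using h_smult[of "\<zero>\<^bsub>R\<^esub>" "\<zero>\<^bsub>M\<^esub>"] submodule_zero[OF N] h_closed by simp

lemma submodule_image:
  assumes X: "sub X" "X \<subseteq> N"
  shows "M'.sub (h ` X)"
proof (rule M'.submoduleI)
  have c: "x \<in> N" if "x \<in> X" for x using that X by auto
  show "h ` X \<subseteq> carrier M'" using c h_closed by auto
  show "\<zero>\<^bsub>M'\<^esub> \<in> h ` X" using h_zero submodule_zero[OF X(1)] by (metis imageI)
  show "\<ominus>\<^bsub>M'\<^esub> y \<in> h ` X" if "y \<in> h ` X" for y
    using that c submodule_neg[OF X(1)] by (auto simp: h_neg[symmetric])
  show "y \<oplus>\<^bsub>M'\<^esub> z \<in> h ` X" if "y \<in> h ` X" "z \<in> h ` X" for y z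
    using that c submodule_add[OF X(1)] by (auto simp: h_add[symmetric])
  show "a \<odot>\<^bsub>M'\<^esub> y \<in> h ` X" if "a \<in> carrier R" "y \<in> h ` X" for a y
    using that c submodule_smult[OF X(1)] by (auto simp: h_smult[symmetric])
qed

lemma submodule_preimage:
  assumes Y: "M'.sub Y"
  shows "sub {x \<in> N. h x \<in> Y}"
  by (rule submoduleI)
    (use Y N in \<open>auto simp: h_zero h_neg h_add h_smult M'.submodule_zero M'.submodule_neg
      M'.submodule_add M'.submodule_smult submodule_zero submodule_neg submodule_add
      submodule_smult dest: submodule_mem_carrier\<close>)

text \<open>Sending \<open>X\<close> to \<open>h(X) + L'\<close> is strictly monotone on submodules
  containing the preimage of \<open>L'\<close>.\<close>

lemma len_preimage_le:
  assumes L': "M'.sub L'" and N': "M'.sub N'" and sub: "L' \<subseteq> N'" "h ` N \<subseteq> N'"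
  shows "len {x \<in> N. h x \<in> L'} N \<le> M'.len L' N'"
  unfolding seg_length_def
proof (rule height_mono_map[where \<Phi>="\<lambda>X. h ` X <+>\<^bsub>M'\<^esub> L'"])
  fix X assume "X \<in> interval R M {x \<in> N. h x \<in> L'} N"
  hence X: "sub X" "{x \<in> N. h x \<in> L'} \<subseteq> X" "X \<subseteq> N" by (auto simp: interval_def)
  have hX: "M'.sub (h ` X)" by (rule submodule_image[OF X(1,3)])
  have "h ` X \<subseteq> N'" using X(3) sub(2) by blast
  thus "h ` X <+>\<^bsub>M'\<^esub> L' \<in> interval R M' L' N'"
    using M'.submodule_sum[OF hX L'] M'.sum_upper2[OF hX L'] M'.sum_least[OF N' _ sub(1)]
    by (auto simp: interval_def)
  fix Y assume "Y \<in> interval R M {x \<in> N. h x \<in> L'} N" and XY: "X \<subset> Y"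
  hence Y: "sub Y" "Y \<subseteq> N" by (auto simp: interval_def)
  obtain y where y: "y \<in> Y" "y \<notin> X" using XY by auto
  \<comment> \<open>If \<open>h y = h x + l\<close>, then \<open>y - x\<close> is mapped into
    \<open>L'\<close>, so it already belongs to \<open>X\<close>.\<close>
  have "h y \<notin> h ` X <+>\<^bsub>M'\<^esub> L'"
  proof
    assume "h y \<in> h ` X <+>\<^bsub>M'\<^esub> L'"
    then obtain x l where x: "x \<in> X" "l \<in> L'" "h y = h x \<oplus>\<^bsub>M'\<^esub> l" by (auto simp: M'.mem_sum_iff)
    have yN: "y \<in> N" and xN: "x \<in> N" using y Y x X by auto
    have nx: "\<ominus>\<^bsub>M\<^esub> x \<in> N" using xN submodule_neg[OF N] by auto
    have "h (\<ominus>\<^bsub>M\<^esub> x \<oplus>\<^bsub>M\<^esub> y) = \<ominus>\<^bsub>M'\<^esub> h x \<oplus>\<^bsub>M'\<^esub> (h x \<oplus>\<^bsub>M'\<^esub> l)"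
      using h_add[OF nx yN] h_neg[OF xN] x by simp
    also have "\<dots> = l" using h_closed[OF xN] M'.submodule_mem_carrier[OF L' x(2)]
      by (simp add: M'.M.r_neg1)
    finally have "\<ominus>\<^bsub>M\<^esub> x \<oplus>\<^bsub>M\<^esub> y \<in> X" using X(2) submodule_add[OF N nx yN] x by auto
    hence "y \<in> X" using submodule_add_iff[OF X(1) submodule_neg[OF X(1) x(1)]]
      submodule_mem_carrier[OF N yN] by blast
    thus False using y by simp
  qed
  moreover have "h y \<in> h ` Y <+>\<^bsub>M'\<^esub> L'"
    using M'.sum_upper1[OF submodule_image[OF Y] L'] y by auto
  moreover have "h ` X <+>\<^bsub>M'\<^esub> L' \<subseteq> h ` Y <+>\<^bsub>M'\<^esub> L'" using XY by (intro M'.sum_mono) auto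
  ultimately show "h ` X <+>\<^bsub>M'\<^esub> L' \<subset> h ` Y <+>\<^bsub>M'\<^esub> L'" by auto
qed

lemma len_preimage_eq:
  assumes L': "M'.sub L'"
  shows "len {x \<in> N. h x \<in> L'} N = M'.len L' (h ` N <+>\<^bsub>M'\<^esub> L')"
proof (rule antisym)
  have hN: "M'.sub (h ` N)" by (rule submodule_image[OF N subset_refl])
  show "len {x \<in> N. h x \<in> L'} N \<le> M'.len L' (h ` N <+>\<^bsub>M'\<^esub> L')"
    by (rule len_preimage_le[OF L' M'.submodule_sum[OF hN L'] M'.sum_upper2[OF hN L']
      M'.sum_upper1[OF hN L']])
  show "M'.len L' (h ` N <+>\<^bsub>M'\<^esub> L') \<le> len {x \<in> N. h x \<in> L'} N"
    unfolding seg_length_def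
  proof (rule height_mono_map[where \<Phi>="\<lambda>Y. {x \<in> N. h x \<in> Y}"])
    fix Y assume "Y \<in> interval R M' L' (h ` N <+>\<^bsub>M'\<^esub> L')"
    hence Y: "M'.sub Y" "L' \<subseteq> Y" "Y \<subseteq> h ` N <+>\<^bsub>M'\<^esub> L'" by (auto simp: interval_def)
    show "{x \<in> N. h x \<in> Y} \<in> interval R M {x \<in> N. h x \<in> L'} N"
      using submodule_preimage[OF Y(1)] Y by (auto simp: interval_def)
    fix Z assume "Z \<in> interval R M' L' (h ` N <+>\<^bsub>M'\<^esub> L')" and YZ: "Y \<subset> Z"
    hence Z: "M'.sub Z" "Z \<subseteq> h ` N <+>\<^bsub>M'\<^esub> L'" by (auto simp: interval_def)
    \<comment> \<open>An element of \<open>Z\<close> outside \<open>Y\<close> can be corrected by an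
      element of \<open>L' \<subseteq> Y\<close> to lie in the image of \<open>h\<close>; this makes
      taking preimages strictly monotone.\<close>
    obtain z where z: "z \<in> Z" "z \<notin> Y" using YZ by auto
    have "z \<in> h ` N <+>\<^bsub>M'\<^esub> L'" using z Z by blast
    then obtain x l where x: "x \<in> N" "l \<in> L'" "z = h x \<oplus>\<^bsub>M'\<^esub> l"
      unfolding M'.mem_sum_iff by blast
    have hx: "h x \<in> carrier M'" using h_closed x by auto
    have lY: "l \<in> Y" "l \<in> Z" using x Y YZ by auto
    have z': "z = l \<oplus>\<^bsub>M'\<^esub> h x" using x hx M'.submodule_mem_carrier[OF L'] by (simp add: M'.M.a_comm)
    have "h x \<in> Z" "h x \<notin> Y"
      using M'.submodule_add_iff[OF Z(1) lY(2) hx] M'.submodule_add_iff[OF Y(1) lY(1) hx] z z' by auto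
    thus "{x \<in> N. h x \<in> Y} \<subset> {x \<in> N. h x \<in> Z}" using x YZ by auto
  qed
qed

end

context rmodule
begin

lemma smult_partial_hom:
  assumes N: "sub N" and a: "a \<in> carrier R"
  shows "partial_hom R M M N (\<lambda>x. a \<odot>\<^bsub>M\<^esub> x)"
proof (intro partial_hom.intro rmodule_axioms partial_hom_axioms.intro N)
  note mem = submodule_mem_carrier[OF N]
  show "a \<odot>\<^bsub>M\<^esub> x \<in> carrier M" if "x \<in> N" for x using that mem a by simp
  show "a \<odot>\<^bsub>M\<^esub> (x \<oplus>\<^bsub>M\<^esub> y) = a \<odot>\<^bsub>M\<^esub> x \<oplus>\<^bsub>M\<^esub> a \<odot>\<^bsub>M\<^esub> y" if "x \<in> N" "y \<in> N" for x y
    using that mem a by (simp add: smult_r_distr)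
  show "a \<odot>\<^bsub>M\<^esub> (b \<odot>\<^bsub>M\<^esub> x) = b \<odot>\<^bsub>M\<^esub> (a \<odot>\<^bsub>M\<^esub> x)" if "b \<in> carrier R" "x \<in> N" for b x
    using that mem[OF that(2)] a by (simp add: smult_assoc1[symmetric] R.m_comm)
qed

text \<open>Multiplication by \<open>a\<close> identifies \<open>M/(L : a)\<close> with
  \<open>(aM + L)/L\<close>. This is how colon modules enter the count of lengths.\<close>

lemma len_colon:
  assumes L: "sub L" and a: "a \<in> carrier R"
  shows "len {x \<in> carrier M. a \<odot>\<^bsub>M\<^esub> x \<in> L} (carrier M) = len L ((\<odot>\<^bsub>M\<^esub>) a ` carrier M <+>\<^bsub>M\<^esub> L)"
  using partial_hom.len_preimage_eq[OF smult_partial_hom[OF carrier_is_submodule a] L] .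

section \<open>Quotient modules\<close>

lemma mem_coset: "sub L \<Longrightarrow> x \<in> carrier M \<Longrightarrow> y \<in> L +>\<^bsub>M\<^esub> x \<longleftrightarrow> y \<in> carrier M \<and> y \<ominus>\<^bsub>M\<^esub> x \<in> L"
proof -
  assume L: "sub L" and x: "x \<in> carrier M"
  have "y \<in> L +>\<^bsub>M\<^esub> x \<longleftrightarrow> (\<exists>l\<in>L. y = l \<oplus>\<^bsub>M\<^esub> x)" by (auto simp: a_r_coset_def')
  moreover have "y = (y \<ominus>\<^bsub>M\<^esub> x) \<oplus>\<^bsub>M\<^esub> x" if "y \<in> carrier M"
    using that x by (simp add: a_minus_def M.a_assoc M.l_neg)
  moreover have "(l \<oplus>\<^bsub>M\<^esub> x) \<ominus>\<^bsub>M\<^esub> x = l" if "l \<in> L" for l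
    using that x submodule_mem_carrier[OF L] by (simp add: a_minus_def M.a_assoc M.r_neg)
  ultimately show ?thesis using x submodule_mem_carrier[OF L] by (metis M.add.m_closed)
qed

lemma submodule_abelian_subgroup: "sub L \<Longrightarrow> abelian_subgroup L M"
  by (intro abelian_subgroupI3 additive_subgroupI submodule.axioms M.abelian_group_axioms)

lemma coset_eq_iff:
  assumes L: "sub L" and x: "x \<in> carrier M" and y: "y \<in> carrier M"
  shows "L +>\<^bsub>M\<^esub> x = L +>\<^bsub>M\<^esub> y \<longleftrightarrow> x \<ominus>\<^bsub>M\<^esub> y \<in> L"
proof -
  interpret abelian_subgroup L M by (rule submodule_abelian_subgroup[OF L])
  show ?thesis using mem_coset[OF L y, of x] a_repr_independence'[of x y] a_rcos_self x y by auto
qed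

lemma coset_eq_self_iff:
  assumes L: "sub L" and x: "x \<in> carrier M"
  shows "L +>\<^bsub>M\<^esub> x = L \<longleftrightarrow> x \<in> L"
proof -
  have "x \<ominus>\<^bsub>M\<^esub> \<zero>\<^bsub>M\<^esub> = x" using x by (metis M.minus_equality M.r_zero M.zero_closed a_minus_def)
  thus ?thesis using coset_eq_iff[OF L x M.zero_closed] submoduleE(1)[OF L] x by simp
qed

lemma coset_add:
  assumes L: "sub L" and x: "x \<in> carrier M" and y: "y \<in> carrier M"
  shows "(L +>\<^bsub>M\<^esub> x) <+>\<^bsub>M\<^esub> (L +>\<^bsub>M\<^esub> y) = L +>\<^bsub>M\<^esub> (x \<oplus>\<^bsub>M\<^esub> y)"
proof -
  interpret abelian_subgroup L M by (rule submodule_abelian_subgroup[OF L])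
  show ?thesis using a_rcos_sum x y by simp
qed

lemma coset_smult:
  assumes L: "sub L" and a: "a \<in> carrier R" and x: "x \<in> carrier M"
  shows "(\<Union>y\<in>L +>\<^bsub>M\<^esub> x. L +>\<^bsub>M\<^esub> (a \<odot>\<^bsub>M\<^esub> y)) = L +>\<^bsub>M\<^esub> (a \<odot>\<^bsub>M\<^esub> x)"
proof -
  interpret abelian_subgroup L M by (rule submodule_abelian_subgroup[OF L])
  have "L +>\<^bsub>M\<^esub> (a \<odot>\<^bsub>M\<^esub> y) = L +>\<^bsub>M\<^esub> (a \<odot>\<^bsub>M\<^esub> x)" if "y \<in> L +>\<^bsub>M\<^esub> x" for y
  proof -
    have y: "y \<in> carrier M" "y \<ominus>\<^bsub>M\<^esub> x \<in> L" using mem_coset[OF L x] that by auto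
    have "a \<odot>\<^bsub>M\<^esub> y \<ominus>\<^bsub>M\<^esub> a \<odot>\<^bsub>M\<^esub> x = a \<odot>\<^bsub>M\<^esub> (y \<ominus>\<^bsub>M\<^esub> x)"
      using y x a by (simp add: a_minus_def smult_r_distr smult_r_minus)
    thus ?thesis using coset_eq_iff[OF L] y x a submodule_smult[OF L a y(2)] by simp
  qed
  moreover have "L +>\<^bsub>M\<^esub> x \<noteq> {}" using a_rcos_self[OF x] by blast
  ultimately show ?thesis by (metis (no_types, lifting) SUP_eq_const)
qed

lemma carrier_quot_module: "carrier (quot_module M L) = (\<lambda>x. L +>\<^bsub>M\<^esub> x) ` carrier M"
  by (auto simp: quot_module_def A_RCOSETS_def')

lemma quot_module_simps [simp]:
  "zero (quot_module M L) = L"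
  "sub L \<Longrightarrow> x \<in> carrier M \<Longrightarrow> y \<in> carrier M \<Longrightarrow>
    (L +>\<^bsub>M\<^esub> x) \<oplus>\<^bsub>quot_module M L\<^esub> (L +>\<^bsub>M\<^esub> y) = L +>\<^bsub>M\<^esub> (x \<oplus>\<^bsub>M\<^esub> y)"
  "sub L \<Longrightarrow> a \<in> carrier R \<Longrightarrow> x \<in> carrier M \<Longrightarrow>
    a \<odot>\<^bsub>quot_module M L\<^esub> (L +>\<^bsub>M\<^esub> x) = L +>\<^bsub>M\<^esub> (a \<odot>\<^bsub>M\<^esub> x)"
  by (simp_all add: quot_module_def coset_add coset_smult)

lemma quot_module_is_module:
  assumes L: "sub L"
  shows "rmodule R (quot_module M L)"
proof (rule rmoduleI, rule moduleI)
  let ?Q = "quot_module M L"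
  have z: "L = L +>\<^bsub>M\<^esub> \<zero>\<^bsub>M\<^esub>" using coset_eq_self_iff[OF L M.zero_closed] submodule_zero[OF L] by simp
  have r: "\<exists>x\<in>carrier M. X = L +>\<^bsub>M\<^esub> x" if "X \<in> carrier ?Q" for X
    using that by (auto simp: carrier_quot_module)
  show "abelian_group ?Q"
  proof (rule abelian_groupI)
    fix X Y assume X: "X \<in> carrier ?Q" and Y: "Y \<in> carrier ?Q"
    show "X \<oplus>\<^bsub>?Q\<^esub> Y \<in> carrier ?Q" using r[OF X] r[OF Y] L by (auto simp: carrier_quot_module)
    show "X \<oplus>\<^bsub>?Q\<^esub> Y = Y \<oplus>\<^bsub>?Q\<^esub> X" using r[OF X] r[OF Y] L by (auto simp: M.a_comm)
    fix Z assume Z: "Z \<in> carrier ?Q"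
    show "X \<oplus>\<^bsub>?Q\<^esub> Y \<oplus>\<^bsub>?Q\<^esub> Z = X \<oplus>\<^bsub>?Q\<^esub> (Y \<oplus>\<^bsub>?Q\<^esub> Z)"
      using r[OF X] r[OF Y] r[OF Z] L by (auto simp: M.a_assoc)
  next
    show "\<zero>\<^bsub>?Q\<^esub> \<in> carrier ?Q" using z by (auto simp: carrier_quot_module)
    fix X assume X: "X \<in> carrier ?Q"
    then obtain x where x: "x \<in> carrier M" "X = L +>\<^bsub>M\<^esub> x" using r by auto
    show "\<zero>\<^bsub>?Q\<^esub> \<oplus>\<^bsub>?Q\<^esub> X = X"
      using quot_module_simps(2)[OF L M.zero_closed x(1)] x z by simp
    have "(L +>\<^bsub>M\<^esub> (\<ominus>\<^bsub>M\<^esub> x)) \<oplus>\<^bsub>?Q\<^esub> X = \<zero>\<^bsub>?Q\<^esub>" using x L z by (simp add: M.l_neg)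
    thus "\<exists>Y\<in>carrier ?Q. Y \<oplus>\<^bsub>?Q\<^esub> X = \<zero>\<^bsub>?Q\<^esub>" using x by (auto simp: carrier_quot_module)
  qed
  fix a X assume a: "a \<in> carrier R" and X: "X \<in> carrier ?Q"
  show "a \<odot>\<^bsub>?Q\<^esub> X \<in> carrier ?Q" using r[OF X] a L by (auto simp: carrier_quot_module)
  fix b assume b: "b \<in> carrier R"
  show "(a \<oplus> b) \<odot>\<^bsub>?Q\<^esub> X = a \<odot>\<^bsub>?Q\<^esub> X \<oplus>\<^bsub>?Q\<^esub> b \<odot>\<^bsub>?Q\<^esub> X"
    using r[OF X] a b L by (auto simp: smult_l_distr)
  show "(a \<otimes> b) \<odot>\<^bsub>?Q\<^esub> X = a \<odot>\<^bsub>?Q\<^esub> (b \<odot>\<^bsub>?Q\<^esub> X)"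
    using r[OF X] a b L by (auto simp: smult_assoc1)
next
  let ?Q = "quot_module M L"
  fix a X Y assume a: "a \<in> carrier R" and "X \<in> carrier ?Q" "Y \<in> carrier ?Q"
  thus "a \<odot>\<^bsub>?Q\<^esub> (X \<oplus>\<^bsub>?Q\<^esub> Y) = a \<odot>\<^bsub>?Q\<^esub> X \<oplus>\<^bsub>?Q\<^esub> a \<odot>\<^bsub>?Q\<^esub> Y"
    using L by (auto simp: smult_r_distr carrier_quot_module)
next
  fix X assume "X \<in> carrier (quot_module M L)"
  thus "\<one> \<odot>\<^bsub>quot_module M L\<^esub> X = X" using L by (auto simp: carrier_quot_module)
qed (rule R.is_cring)

lemma submodule_quot_iff:
  assumes L: "sub L" and Y: "submodule Y R (quot_module M L)"
  shows "sub {x \<in> carrier M. L +>\<^bsub>M\<^esub> x \<in> Y}"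
proof -
  interpret Q: rmodule R "quot_module M L" by (rule quot_module_is_module[OF L])
  have "L +>\<^bsub>M\<^esub> \<ominus>\<^bsub>M\<^esub> x = (\<ominus>\<^bsub>R\<^esub> \<one>\<^bsub>R\<^esub>) \<odot>\<^bsub>quot_module M L\<^esub> (L +>\<^bsub>M\<^esub> x)" if "x \<in> carrier M" for x
    using that L by (simp add: smult_l_minus)
  moreover have "L +>\<^bsub>M\<^esub> \<zero>\<^bsub>M\<^esub> = L"
    using coset_eq_self_iff[OF L M.zero_closed] submodule_zero[OF L] by simp
  ultimately show ?thesis
    using Q.submodule_zero[OF Y] Q.submodule_add[OF Y] Q.submodule_smult[OF Y] L
    by (intro submoduleI) (auto simp: quot_module_simps(2,3)[symmetric] simp del: quot_module_simps(2,3))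
qed

lemma submodule_quot_image:
  assumes L: "sub L" and X: "sub X"
  shows "submodule ((\<lambda>x. L +>\<^bsub>M\<^esub> x) ` X) R (quot_module M L)"
proof -
  have "partial_hom R M (quot_module M L) X (\<lambda>x. L +>\<^bsub>M\<^esub> x)"
    unfolding partial_hom_def partial_hom_axioms_def
    using quot_module_is_module[OF L] X L submodule_mem_carrier[OF X] rmodule_axioms
    by (auto simp: carrier_quot_module)
  from partial_hom.submodule_image[OF this X] show ?thesis by simp
qed

lemma module_length_quot:
  assumes L: "sub L"
  shows "module_length R (quot_module M L) = len L (carrier M)"
  unfolding module_length_height seg_length_def
proof (rule antisym)
  interpret Q: rmodule R "quot_module M L" by (rule quot_module_is_module[OF L])
  show "height {N. submodule N R (quot_module M L)} \<le> height (interval R M L (carrier M))"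
  proof (rule height_mono_map[where \<Phi>="\<lambda>Y. {x \<in> carrier M. L +>\<^bsub>M\<^esub> x \<in> Y}"])
    fix Y assume "Y \<in> {N. submodule N R (quot_module M L)}"
    hence Y: "submodule Y R (quot_module M L)" by simp
    have "L +>\<^bsub>M\<^esub> x \<in> Y" "x \<in> carrier M" if "x \<in> L" for x
    proof -
      show xc: "x \<in> carrier M" using submodule_mem_carrier[OF L that] .
      have "L +>\<^bsub>M\<^esub> x = L" using coset_eq_self_iff[OF L xc] that by blast
      moreover have "L \<in> Y" using Q.submodule_zero[OF Y] by simp
      ultimately show "L +>\<^bsub>M\<^esub> x \<in> Y" by (simp only:)
    qed
    hence "L \<subseteq> {x \<in> carrier M. L +>\<^bsub>M\<^esub> x \<in> Y}" by blast
    thus "{x \<in> carrier M. L +>\<^bsub>M\<^esub> x \<in> Y} \<in> interval R M L (carrier M)"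
      using submodule_quot_iff[OF L Y] by (auto simp: interval_def)
    fix Z assume "Z \<in> {N. submodule N R (quot_module M L)}" and YZ: "Y \<subset> Z"
    then obtain z where z: "z \<in> Z" "z \<notin> Y" "z \<in> carrier (quot_module M L)"
      using Q.submoduleE(1)[of Z] by blast
    then obtain x where "x \<in> carrier M" "z = L +>\<^bsub>M\<^esub> x" by (auto simp: carrier_quot_module)
    thus "{x \<in> carrier M. L +>\<^bsub>M\<^esub> x \<in> Y} \<subset> {x \<in> carrier M. L +>\<^bsub>M\<^esub> x \<in> Z}" using z YZ by auto
  qed
  show "height (interval R M L (carrier M)) \<le> height {N. submodule N R (quot_module M L)}"
  proof (rule height_mono_map[where \<Phi>="\<lambda>X. (\<lambda>x. L +>\<^bsub>M\<^esub> x) ` X"])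
    fix X assume "X \<in> interval R M L (carrier M)"
    hence X: "sub X" "L \<subseteq> X" by (auto simp: interval_def)
    show "(\<lambda>x. L +>\<^bsub>M\<^esub> x) ` X \<in> {N. submodule N R (quot_module M L)}"
      using submodule_quot_image[OF L X(1)] by simp
    fix Y assume "Y \<in> interval R M L (carrier M)" and XY: "X \<subset> Y"
    hence Y: "sub Y" by (auto simp: interval_def)
    obtain y where y: "y \<in> Y" "y \<notin> X" using XY by auto
    have yc: "y \<in> carrier M" using submodule_mem_carrier[OF Y] y by auto
    have "L +>\<^bsub>M\<^esub> y \<notin> (\<lambda>x. L +>\<^bsub>M\<^esub> x) ` X"
    proof
      assume "L +>\<^bsub>M\<^esub> y \<in> (\<lambda>x. L +>\<^bsub>M\<^esub> x) ` X"
      then obtain x where x: "x \<in> X" "L +>\<^bsub>M\<^esub> y = L +>\<^bsub>M\<^esub> x" by auto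
      have xc: "x \<in> carrier M" using submodule_mem_carrier[OF X(1)] x by auto
      have "y \<ominus>\<^bsub>M\<^esub> x \<in> X" using x coset_eq_iff[OF L yc xc] X by auto
      hence "x \<oplus>\<^bsub>M\<^esub> (y \<ominus>\<^bsub>M\<^esub> x) \<in> X" using x submodule_add[OF X(1)] by auto
      moreover have "x \<oplus>\<^bsub>M\<^esub> (y \<ominus>\<^bsub>M\<^esub> x) = y" using xc yc by (simp add: a_minus_def M.a_lcomm[of x y] M.r_neg)
      ultimately show False using y by simp
    qed
    thus "(\<lambda>x. L +>\<^bsub>M\<^esub> x) ` X \<subset> (\<lambda>x. L +>\<^bsub>M\<^esub> x) ` Y" using y XY by blast
  qed
qed

lemma submodule_restrict:
  assumes N: "sub N"
  shows "rmodule R (M\<lparr>carrier := N\<rparr>)"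
  using submodule.submodule_is_module[OF N module_axioms] by (rule rmoduleI)

lemma submodule_restrict_iff:
  assumes N: "sub N"
  shows "submodule X R (M\<lparr>carrier := N\<rparr>) \<longleftrightarrow> sub X \<and> X \<subseteq> N"
proof -
  interpret N: rmodule R "M\<lparr>carrier := N\<rparr>" by (rule submodule_restrict[OF N])
  show ?thesis
  proof
    assume X: "submodule X R (M\<lparr>carrier := N\<rparr>)"
    have XN: "X \<subseteq> N" using N.submoduleE(1)[OF X] by simp
    have "Module.module R (M\<lparr>carrier := N, carrier := X\<rparr>)"
      by (rule submodule.submodule_is_module[OF X N.module_axioms])
    hence "Module.module R (M\<lparr>carrier := X\<rparr>)" by simp
    thus "sub X \<and> X \<subseteq> N"
      using module_incl_imp_submodule[of X] XN submoduleE(1)[OF N] by auto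
  next
    assume X: "sub X \<and> X \<subseteq> N"
    have "Module.module R (M\<lparr>carrier := X\<rparr>)"
      using submodule.submodule_is_module[OF _ module_axioms] X by blast
    thus "submodule X R (M\<lparr>carrier := N\<rparr>)"
      using N.module_incl_imp_submodule[of X] X by simp
  qed
qed

lemma subquot_length_eq:
  assumes L: "sub L" and N: "sub N" and "L \<subseteq> N"
  shows "subquot_length R M N L = the_enat (len L N)"
proof -
  interpret N: rmodule R "M\<lparr>carrier := N\<rparr>" by (rule submodule_restrict[OF N])
  have "interval R (M\<lparr>carrier := N\<rparr>) L N = interval R M L N"
    using submodule_restrict_iff[OF N] by (auto simp: interval_def)
  moreover have "submodule L R (M\<lparr>carrier := N\<rparr>)" using submodule_restrict_iff[OF N] assms by auto
  ultimately show ?thesis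
    using N.module_length_quot[of L] by (simp add: subquot_length_def seg_length_def)
qed

section \<open>Finiteness over Noetherian local rings\<close>

definition fg :: "'b set \<Rightarrow> bool" where
  "fg N \<longleftrightarrow> (\<exists>S. finite S \<and> S \<subseteq> carrier M \<and> span S = N)"

lemma fg_submodule: "fg N \<Longrightarrow> sub N"
  using submodule_span(1) by (auto simp: fg_def)

text \<open>Induction on the generators, as in Hilbert's basis argument: generators of the ideal of
  coefficients of \<open>s\<close> are lifted to \<open>N\<close>, and the rest of \<open>N\<close>
  lies in the span of the remaining generators.\<close>

lemma fg_subset_span:
  assumes noeth: "noetherian_ring R" and S: "finite S" "S \<subseteq> carrier M"
  shows "sub N \<Longrightarrow> N \<subseteq> span S \<Longrightarrow> fg N"
  using S
proof (induction S arbitrary: N rule: finite_induct)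
  case empty
  hence "N = {\<zero>\<^bsub>M\<^esub>}" using submodule_zero[of N] by (auto simp: span_empty)
  thus ?case unfolding fg_def using span_empty by (intro exI[of _ "{}"]) auto
next
  case (insert s S)
  have s: "s \<in> carrier M" and S: "S \<subseteq> carrier M" using insert.prems by auto
  note N = insert.prems(1) and sS = submodule_span[OF S]
  have mem: "x \<in> carrier M" if "x \<in> N" for x using submodule_mem_carrier[OF N] that .
  have smem: "x \<in> carrier M" if "x \<in> span S" for x using submodule_mem_carrier[OF sS(1)] that .
  \<comment> \<open>The coefficients with which \<open>s\<close> occurs in elements of
    \<open>N\<close>, modulo the span of \<open>S\<close>.\<close>
  let ?I = "{a \<in> carrier R. \<forall>x\<in>{s}. a \<odot>\<^bsub>M\<^esub> x \<in> N <+>\<^bsub>M\<^esub> span S}"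
  have I: "ideal ?I R" by (rule ideal_transporter[OF submodule_sum[OF N sS(1)]]) (use s in auto)
  then obtain B where B: "B \<subseteq> carrier R" "finite B" "?I = Idl B"
    using noetherian_ring.finetely_gen[OF noeth I] by blast
  have "\<forall>b\<in>B. \<exists>y. y \<in> span S \<and> b \<odot>\<^bsub>M\<^esub> s \<oplus>\<^bsub>M\<^esub> y \<in> N"
  proof
    fix b assume "b \<in> B"
    hence b: "b \<in> carrier R" "b \<odot>\<^bsub>M\<^esub> s \<in> N <+>\<^bsub>M\<^esub> span S" using B R.genideal_self[OF B(1)] by auto
    then obtain n y where n: "n \<in> N" "y \<in> span S" "b \<odot>\<^bsub>M\<^esub> s = n \<oplus>\<^bsub>M\<^esub> y" by (auto simp: mem_sum_iff)
    have "b \<odot>\<^bsub>M\<^esub> s \<oplus>\<^bsub>M\<^esub> \<ominus>\<^bsub>M\<^esub> y = n" using n mem smem by (simp add: M.a_assoc M.r_neg)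
    thus "\<exists>y. y \<in> span S \<and> b \<odot>\<^bsub>M\<^esub> s \<oplus>\<^bsub>M\<^esub> y \<in> N" using n submodule_neg[OF sS(1)] by metis
  qed
  then obtain y where y: "\<And>b. b \<in> B \<Longrightarrow> y b \<in> span S" "\<And>b. b \<in> B \<Longrightarrow> b \<odot>\<^bsub>M\<^esub> s \<oplus>\<^bsub>M\<^esub> y b \<in> N"
    by metis
  \<comment> \<open>The chosen element of \<open>N\<close> whose coefficient at \<open>s\<close> is
    \<open>b\<close>.\<close>
  let ?g = "\<lambda>b. b \<odot>\<^bsub>M\<^esub> s \<oplus>\<^bsub>M\<^esub> y b"
  have "fg (N \<inter> span S)" using insert.IH[of "N \<inter> span S"] submodule_Int[OF N sS(1)] S by auto
  then obtain T where T: "finite T" "T \<subseteq> carrier M" "span T = N \<inter> span S" by (auto simp: fg_def)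
  let ?U = "?g ` B \<union> T"
  have U: "?U \<subseteq> carrier M" using T(2) y(2) mem by auto
  have Us: "sub (span ?U)" "?U \<subseteq> span ?U" using submodule_span[OF U] by auto
  have TN: "T \<subseteq> N" using T submodule_span(2)[OF T(2)] by auto
  have NU: "N \<inter> span S \<subseteq> span ?U" unfolding T(3)[symmetric] by (rule span_mono) auto
  have "span ?U = N"
  proof
    show "span ?U \<subseteq> N" by (rule span_minimal[OF N]) (use TN y(2) in auto)
    have UN: "sub (span ?U <+>\<^bsub>M\<^esub> span S)" by (rule submodule_sum[OF Us(1) sS(1)])
    have "b \<odot>\<^bsub>M\<^esub> s \<in> span ?U <+>\<^bsub>M\<^esub> span S" if b: "b \<in> B" for b
    proof -
      have "b \<odot>\<^bsub>M\<^esub> s = ?g b \<oplus>\<^bsub>M\<^esub> \<ominus>\<^bsub>M\<^esub> y b" using b B s smem[OF y(1)[OF b]]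
        by (simp add: M.a_assoc M.r_neg subset_iff)
      moreover have "?g b \<in> span ?U" using Us b by auto
      ultimately show ?thesis using submodule_neg[OF sS(1) y(1)[OF b]] unfolding mem_sum_iff by blast
    qed
    hence "Idl B \<subseteq> {a \<in> carrier R. \<forall>x\<in>{s}. a \<odot>\<^bsub>M\<^esub> x \<in> span ?U <+>\<^bsub>M\<^esub> span S}"
      by (intro R.genideal_minimal ideal_transporter[OF UN]) (use s B in auto)
    hence Is: "a \<odot>\<^bsub>M\<^esub> s \<in> span ?U <+>\<^bsub>M\<^esub> span S" if "a \<in> ?I" for a using that B(3) by auto
    show "N \<subseteq> span ?U"
    proof
      fix n assume n: "n \<in> N"
      then obtain a z where a: "a \<in> carrier R" "z \<in> span S" "n = a \<odot>\<^bsub>M\<^esub> s \<oplus>\<^bsub>M\<^esub> z"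
        using insert.prems(2) mem_span_insert[OF s S] by blast
      have "a \<odot>\<^bsub>M\<^esub> s = n \<oplus>\<^bsub>M\<^esub> \<ominus>\<^bsub>M\<^esub> z" using a s smem by (simp add: M.a_assoc M.r_neg)
      hence "a \<odot>\<^bsub>M\<^esub> s \<in> N <+>\<^bsub>M\<^esub> span S"
        using n submodule_neg[OF sS(1) a(2)] unfolding mem_sum_iff by metis
      hence "a \<odot>\<^bsub>M\<^esub> s \<in> span ?U <+>\<^bsub>M\<^esub> span S" using Is a by auto
      then obtain u w where u: "u \<in> span ?U" "w \<in> span S" "a \<odot>\<^bsub>M\<^esub> s = u \<oplus>\<^bsub>M\<^esub> w"
        by (auto simp: mem_sum_iff)
      have uN: "u \<in> N" using u \<open>span ?U \<subseteq> N\<close> by auto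
      \<comment> \<open>Removing the part \<open>u\<close> generated by the lifts leaves an element
        of \<open>N \<inter> span S\<close>, to which the induction hypothesis applied.\<close>
      have nn: "n = u \<oplus>\<^bsub>M\<^esub> (w \<oplus>\<^bsub>M\<^esub> z)" using a u mem[OF uN] smem by (simp add: M.a_assoc)
      have wz: "w \<oplus>\<^bsub>M\<^esub> z \<in> span S" using u a submodule_add[OF sS(1)] by auto
      have "w \<oplus>\<^bsub>M\<^esub> z \<in> N" using submodule_add_iff[OF N uN smem[OF wz]] nn n by simp
      thus "n \<in> span ?U" using wz NU nn u submodule_add[OF Us(1)] by blast
    qed
  qed
  thus ?case unfolding fg_def using B(2) T(1) U by (intro exI[of _ ?U]) auto
qed

lemma fg_subset:
  assumes "noetherian_ring R" "fg N" "sub L" "L \<subseteq> N"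
  shows "fg L"
  using fg_subset_span[OF assms(1)] assms by (auto simp: fg_def)

section \<open>Nakayama's lemma\<close>

lemma ideal_smult_span_insert:
  assumes I: "ideal I R" and s: "s \<in> carrier M" and S: "S \<subseteq> carrier M"
  shows "ideal_smult R M I (span (insert s S)) \<subseteq> (\<lambda>a. a \<odot>\<^bsub>M\<^esub> s) ` I <+>\<^bsub>M\<^esub> ideal_smult R M I (span S)"
proof (rule ideal_smult_minimal)
  interpret I: ideal I R by fact
  note sS = submodule_span[OF S]
  have Ic: "I \<subseteq> carrier R" using I.Icarr by auto
  have 1: "sub ((\<lambda>a. a \<odot>\<^bsub>M\<^esub> s) ` I)"
  proof (rule submoduleI)
    show "(\<lambda>a. a \<odot>\<^bsub>M\<^esub> s) ` I \<subseteq> carrier M" using s I.Icarr by auto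
    show "\<zero>\<^bsub>M\<^esub> \<in> (\<lambda>a. a \<odot>\<^bsub>M\<^esub> s) ` I" using smult_l_null[OF s] I.zero_closed by (metis imageI)
    show "\<ominus>\<^bsub>M\<^esub> x \<in> (\<lambda>a. a \<odot>\<^bsub>M\<^esub> s) ` I" if "x \<in> (\<lambda>a. a \<odot>\<^bsub>M\<^esub> s) ` I" for x
      using that s I.Icarr by (auto simp: smult_l_minus[symmetric])
    show "x \<oplus>\<^bsub>M\<^esub> y \<in> (\<lambda>a. a \<odot>\<^bsub>M\<^esub> s) ` I"
      if "x \<in> (\<lambda>a. a \<odot>\<^bsub>M\<^esub> s) ` I" "y \<in> (\<lambda>a. a \<odot>\<^bsub>M\<^esub> s) ` I" for x y
      using that s I.Icarr by (auto simp: smult_l_distr[symmetric])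
    show "b \<odot>\<^bsub>M\<^esub> x \<in> (\<lambda>a. a \<odot>\<^bsub>M\<^esub> s) ` I" if "b \<in> carrier R" "x \<in> (\<lambda>a. a \<odot>\<^bsub>M\<^esub> s) ` I" for b x
      using that s I.Icarr I.I_l_closed by (auto simp: smult_assoc1[symmetric])
  qed
  have 2: "sub (ideal_smult R M I (span S))"
    by (intro submodule_ideal_smult Ic submoduleE(1)[OF sS(1)])
  show "sub ((\<lambda>a. a \<odot>\<^bsub>M\<^esub> s) ` I <+>\<^bsub>M\<^esub> ideal_smult R M I (span S))" by (rule submodule_sum[OF 1 2])
  fix a x assume a: "a \<in> I" and "x \<in> span (insert s S)"
  then obtain b y where b: "b \<in> carrier R" "y \<in> span S" "x = b \<odot>\<^bsub>M\<^esub> s \<oplus>\<^bsub>M\<^esub> y"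
    using mem_span_insert[OF s S] by blast
  have "a \<odot>\<^bsub>M\<^esub> x = (a \<otimes> b) \<odot>\<^bsub>M\<^esub> s \<oplus>\<^bsub>M\<^esub> a \<odot>\<^bsub>M\<^esub> y"
    using a b s I.Icarr submodule_mem_carrier[OF sS(1)] by (simp add: smult_r_distr smult_assoc1)
  moreover have "a \<otimes> b \<in> I" using a b I.I_r_closed by auto
  moreover have "a \<odot>\<^bsub>M\<^esub> y \<in> ideal_smult R M I (span S)"
    using mem_ideal_smult[OF Ic submoduleE(1)[OF sS(1)] a b(2)] .
  ultimately show "a \<odot>\<^bsub>M\<^esub> x \<in> (\<lambda>a. a \<odot>\<^bsub>M\<^esub> s) ` I <+>\<^bsub>M\<^esub> ideal_smult R M I (span S)"
    unfolding mem_sum_iff by blast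
qed

text \<open>One generator at a time: modulo the others, \<open>s = a s + w\<close> with
  \<open>a\<close> in \<open>\<mm>\<close>, so \<open>s\<close> is a multiple of \<open>w\<close>
  and becomes redundant. The smaller generating set satisfies the same hypothesis.\<close>

lemma nakayama_span:
  assumes loc: "local_ring R \<mm>" and L: "sub L" and S: "finite S" "S \<subseteq> carrier M"
    and "S \<subseteq> ideal_smult R M \<mm> (span S) <+>\<^bsub>M\<^esub> L"
  shows "S \<subseteq> L"
  using S assms(5)
proof (induction S rule: finite_induct)
  case (insert s S)
  have s: "s \<in> carrier M" and S: "S \<subseteq> carrier M" using insert.prems by auto
  interpret max: maximalideal \<mm> R using loc by (simp add: local_ring_def)
  have mc: "\<mm> \<subseteq> carrier R" using max.Icarr by auto
  note sS = submodule_span[OF S]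
  let ?mS = "ideal_smult R M \<mm> (span S)"
  have mS: "sub ?mS" by (intro submodule_ideal_smult mc submoduleE(1)[OF sS(1)])
  let ?W = "?mS <+>\<^bsub>M\<^esub> L"
  have W: "sub ?W" by (rule submodule_sum[OF mS L])
  have *: "\<exists>a\<in>\<mm>. \<exists>w\<in>?W. x = a \<odot>\<^bsub>M\<^esub> s \<oplus>\<^bsub>M\<^esub> w" if "x \<in> insert s S" for x
  proof -
    have "x \<in> ideal_smult R M \<mm> (span (insert s S)) <+>\<^bsub>M\<^esub> L" using insert.prems that by auto
    then obtain z l where z: "z \<in> ideal_smult R M \<mm> (span (insert s S))" "l \<in> L" "x = z \<oplus>\<^bsub>M\<^esub> l"
      by (auto simp: mem_sum_iff)
    have "z \<in> (\<lambda>a. a \<odot>\<^bsub>M\<^esub> s) ` \<mm> <+>\<^bsub>M\<^esub> ?mS"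
      using ideal_smult_span_insert[OF max.is_ideal s S] z(1) by blast
    then obtain a y where a: "a \<in> \<mm>" "y \<in> ?mS" "z = a \<odot>\<^bsub>M\<^esub> s \<oplus>\<^bsub>M\<^esub> y"
      unfolding mem_sum_iff by blast
    have "x = a \<odot>\<^bsub>M\<^esub> s \<oplus>\<^bsub>M\<^esub> (y \<oplus>\<^bsub>M\<^esub> l)"
      using a z s mc submodule_mem_carrier[OF mS] submodule_mem_carrier[OF L] by (auto simp: M.a_assoc)
    moreover have "y \<oplus>\<^bsub>M\<^esub> l \<in> ?W" using a z unfolding mem_sum_iff by blast
    ultimately show ?thesis using a(1) by blast
  qed
  obtain a w where a: "a \<in> \<mm>" "w \<in> ?W" "s = a \<odot>\<^bsub>M\<^esub> s \<oplus>\<^bsub>M\<^esub> w" using *[of s] by auto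
  have ac: "a \<in> carrier R" and wc: "w \<in> carrier M" using a mc submodule_mem_carrier[OF W] by auto
  \<comment> \<open>With \<open>a\<close> in \<open>\<mm>\<close>, the element \<open>1 - a\<close>
    is outside \<open>\<mm>\<close> and hence a unit, and \<open>(1 - a) s = w\<close>.\<close>
  let ?u = "\<one> \<ominus>\<^bsub>R\<^esub> a"
  have "?u \<notin> \<mm>"
  proof
    assume "?u \<in> \<mm>"
    hence "?u \<oplus>\<^bsub>R\<^esub> a \<in> \<mm>" using a by auto
    moreover have "?u \<oplus>\<^bsub>R\<^esub> a = \<one>" using ac by (simp add: a_minus_def R.a_assoc R.l_neg)
    ultimately show False using max.one_imp_carrier max.I_notcarr by auto
  qed
  hence u: "?u \<in> Units R" using local_ring_unit[OF loc] ac by auto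
  have "?u \<odot>\<^bsub>M\<^esub> s = s \<oplus>\<^bsub>M\<^esub> \<ominus>\<^bsub>M\<^esub> (a \<odot>\<^bsub>M\<^esub> s)"
    using s ac by (simp add: a_minus_def smult_l_distr smult_l_minus)
  also have "\<dots> = (a \<odot>\<^bsub>M\<^esub> s \<oplus>\<^bsub>M\<^esub> w) \<oplus>\<^bsub>M\<^esub> \<ominus>\<^bsub>M\<^esub> (a \<odot>\<^bsub>M\<^esub> s)" using a(3) by simp
  also have "\<dots> = w" using s ac wc by (simp add: M.a_ac M.r_neg M.r_neg2)
  finally have us: "?u \<odot>\<^bsub>M\<^esub> s = w" .
  have "s = inv\<^bsub>R\<^esub> ?u \<odot>\<^bsub>M\<^esub> w"
    using us[symmetric] u s ac by (simp add: smult_assoc1[symmetric] R.Units_l_inv)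
  hence sW: "s \<in> ?W" using submodule_smult[OF W] a u by (metis R.Units_inv_closed)
  have SW: "S \<subseteq> ?W"
  proof
    fix x assume "x \<in> S"
    then obtain a w where "a \<in> \<mm>" "w \<in> ?W" "x = a \<odot>\<^bsub>M\<^esub> s \<oplus>\<^bsub>M\<^esub> w" using * by blast
    thus "x \<in> ?W" using submodule_add[OF W] submodule_smult[OF W _ sW] mc by blast
  qed
  have SL: "S \<subseteq> L" using insert.IH[OF S SW] .
  hence "span S \<subseteq> L" by (rule span_minimal[OF L])
  hence "?mS \<subseteq> L" using ideal_smult_le[OF sS(1) mc] by auto
  hence "?W \<subseteq> L" using sum_least[OF L] by auto
  thus ?case using SL sW by auto
qed auto

lemma nakayama:
  assumes loc: "local_ring R \<mm>" and N: "fg N" and L: "sub L"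
    and NL: "N \<subseteq> ideal_smult R M \<mm> N <+>\<^bsub>M\<^esub> L"
  shows "N \<subseteq> L"
proof -
  obtain S where S: "finite S" "S \<subseteq> carrier M" "span S = N" using N by (auto simp: fg_def)
  have "S \<subseteq> ideal_smult R M \<mm> (span S) <+>\<^bsub>M\<^esub> L" using NL S submodule_span(2)[OF S(2)] by auto
  hence "S \<subseteq> L" by (rule nakayama_span[OF loc L S(1,2)])
  thus ?thesis using span_minimal[OF L] S by auto
qed

section \<open>Finite length\<close>

text \<open>The quotient is a finite-dimensional vector space over the residue field: each new
  generator adds at most one to the length.\<close>

lemma len_finite_semisimple:
  assumes loc: "local_ring R \<mm>" and S: "finite S" "S \<subseteq> carrier M" and L: "sub L"
    and mL: "\<And>a s. a \<in> \<mm> \<Longrightarrow> s \<in> S \<Longrightarrow> a \<odot>\<^bsub>M\<^esub> s \<in> L"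
  shows "len L (span (S \<union> L)) \<noteq> \<infinity>"
  using S mL
proof (induction S rule: finite_induct)
  case empty
  thus ?case using span_of_submodule[OF L] by simp
next
  case (insert s S)
  have Lc: "L \<subseteq> carrier M" using submoduleE(1)[OF L] .
  have s: "s \<in> carrier M" and S: "S \<union> L \<subseteq> carrier M" using insert.prems Lc by auto
  let ?X = "span (S \<union> L)" and ?Y = "span (insert s (S \<union> L))"
  have X: "sub ?X" "S \<union> L \<subseteq> ?X" using submodule_span[OF S] by auto
  have Y: "sub ?Y" using submodule_span[of "insert s (S \<union> L)"] s S by auto
  have XY: "?X \<subseteq> ?Y" by (rule span_mono) auto
  have "len ?X ?Y \<le> enat 1"
    unfolding seg_length_def
  proof (rule height_leI)
    fix n p assume p: "chain_in (interval R M ?X ?Y) n p"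
    show "enat n \<le> enat 1"
    proof (rule ccontr)
      assume "\<not> ?thesis"
      hence n: "n \<ge> 2" by simp
      have p01: "p 0 \<subset> p 1" "p 1 \<subset> p 2" using p n by (auto simp: chain_in_def numeral_2_eq_2)
      have p0: "sub (p 0)" "?X \<subseteq> p 0" and p1: "sub (p 1)" "?X \<subseteq> p 1" "p 1 \<subseteq> ?Y" and p2: "p 2 \<subseteq> ?Y"
        using p n by (auto simp: chain_in_def interval_def)
      \<comment> \<open>Such an \<open>x\<close> has a coefficient at \<open>s\<close> outside
        \<open>\<mm>\<close>, a unit; hence \<open>s\<close> is in \<open>p 1\<close>, which is then
        everything, and no room is left for \<open>p 2\<close>.\<close>
      obtain x where x: "x \<in> p 1" "x \<notin> p 0" using p01 by auto
      then obtain a y where a: "a \<in> carrier R" "y \<in> ?X" "x = a \<odot>\<^bsub>M\<^esub> s \<oplus>\<^bsub>M\<^esub> y"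
        using p1 mem_span_insert[OF s S] by blast
      have yc: "y \<in> carrier M" using submodule_mem_carrier[OF X(1) a(2)] .
      have x': "x = y \<oplus>\<^bsub>M\<^esub> a \<odot>\<^bsub>M\<^esub> s" using a s yc by (simp add: M.a_comm)
      have as: "a \<odot>\<^bsub>M\<^esub> s \<in> p 1" "a \<odot>\<^bsub>M\<^esub> s \<notin> p 0"
        using submodule_add_iff[OF p1(1), of y "a \<odot>\<^bsub>M\<^esub> s"] submodule_add_iff[OF p0(1), of y "a \<odot>\<^bsub>M\<^esub> s"]
          x x' a s p0 p1 by auto
      have "a \<notin> \<mm>" using as insert.prems(2)[of a s] p0 X by auto
      hence u: "a \<in> Units R" using local_ring_unit[OF loc a(1)] by auto
      have "s = inv\<^bsub>R\<^esub> a \<odot>\<^bsub>M\<^esub> (a \<odot>\<^bsub>M\<^esub> s)" using u s a by (simp add: smult_assoc1[symmetric])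
      hence "s \<in> p 1" using submodule_smult[OF p1(1) _ as(1)] u by (metis R.Units_inv_closed)
      hence "?Y \<subseteq> p 1" using X p1 by (intro span_minimal[OF p1(1)]) auto
      thus False using p01 p2 by auto
    qed
  qed
  hence "len ?X ?Y \<noteq> \<infinity>" by (metis enat_ord_code(5) enat_ord_simps(5))
  moreover have "len L ?X \<noteq> \<infinity>" using insert by auto
  moreover have "len L ?Y = len L ?X + len ?X ?Y" using X XY by (intro len_add L Y) auto
  ultimately show ?case by (metis plus_eq_infty_iff_enat Un_insert_left)
qed

text \<open>Induction on the total exponent. If some \<open>e b >= 2\<close>, cut at
  \<open>bN + L\<close>: below the cut \<open>b\<close> needs exponent \<open>e b - 1\<close>, above
  it exponent 1, and both totals are smaller. When all exponents are at most 1, \<open>\<mm>\<close>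
  carries \<open>N\<close> into \<open>L\<close> and the semisimple case applies.\<close>

lemma len_finite:
  assumes noeth: "noetherian_ring R" and loc: "local_ring R \<mm>"
    and B: "finite B" "B \<subseteq> carrier R" "\<mm> = Idl B"
  shows "fg N \<Longrightarrow> sub L \<Longrightarrow> L \<subseteq> N \<Longrightarrow> (\<And>b x. b \<in> B \<Longrightarrow> x \<in> N \<Longrightarrow> (b [^]\<^bsub>R\<^esub> (e b :: nat)) \<odot>\<^bsub>M\<^esub> x \<in> L)
    \<Longrightarrow> len L N \<noteq> \<infinity>"
proof (induction "\<Sum>b\<in>B. e b" arbitrary: e N L rule: less_induct)
  case less
  note N = fg_submodule[OF less.prems(1)] and L = less.prems(2)
  have mem: "x \<in> carrier M" if "x \<in> N" for x using submodule_mem_carrier[OF N that] .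
  show ?case
  proof (cases "\<exists>b\<in>B. e b \<ge> 2")
    case True
    then obtain b where b: "b \<in> B" "e b \<ge> 2" by auto
    have bc: "b \<in> carrier R" using b B by auto
    let ?N = "(\<odot>\<^bsub>M\<^esub>) b ` N <+>\<^bsub>M\<^esub> L"
    have bN: "sub ((\<odot>\<^bsub>M\<^esub>) b ` N)" by (rule submodule_smult_image[OF N bc])
    have N': "sub ?N" by (rule submodule_sum[OF bN L])
    have LN: "L \<subseteq> ?N" by (rule sum_upper2[OF bN L])
    have NN: "?N \<subseteq> N" by (rule sum_least[OF N]) (use submodule_smult[OF N bc] less.prems(3) in auto)
    have sum: "(\<Sum>c\<in>B. (e(b := k)) c) < (\<Sum>c\<in>B. e c)" if "k < e b" for k
      by (rule sum_strict_mono_ex1) (use B b that in auto)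
    have "len L ?N \<noteq> \<infinity>"
    proof (rule less.hyps[OF sum])
      show "e b - 1 < e b" using b by simp
      show "fg ?N" by (rule fg_subset[OF noeth less.prems(1) N' NN])
      fix c x assume c: "c \<in> B" and x: "x \<in> ?N"
      show "(c [^]\<^bsub>R\<^esub> ((e(b := e b - 1)) c)) \<odot>\<^bsub>M\<^esub> x \<in> L"
      proof (cases "c = b")
        case True
        obtain y l where y: "y \<in> N" "l \<in> L" "x = b \<odot>\<^bsub>M\<^esub> y \<oplus>\<^bsub>M\<^esub> l"
          using x by (auto simp: mem_sum_iff)
        have lc: "l \<in> carrier M" using submodule_mem_carrier[OF L] y by auto
        let ?p = "b [^]\<^bsub>R\<^esub> (e b - 1)"
        have "?p \<otimes> b = b [^]\<^bsub>R\<^esub> e b" using b(2) R.nat_pow_Suc[of b "e b - 1"]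
          by (simp del: R.nat_pow_Suc)
        hence "?p \<odot>\<^bsub>M\<^esub> x = b [^]\<^bsub>R\<^esub> e b \<odot>\<^bsub>M\<^esub> y \<oplus>\<^bsub>M\<^esub> ?p \<odot>\<^bsub>M\<^esub> l"
          using y lc bc mem by (simp add: smult_r_distr smult_assoc1[symmetric])
        moreover have "b [^]\<^bsub>R\<^esub> e b \<odot>\<^bsub>M\<^esub> y \<in> L" using less.prems(4) b y by auto
        moreover have "?p \<odot>\<^bsub>M\<^esub> l \<in> L" using submodule_smult[OF L] y bc by auto
        ultimately show ?thesis using True submodule_add[OF L] by auto
      qed (use less.prems(4) c x NN in auto)
    qed (use L LN in auto)
    moreover have "len ?N N \<noteq> \<infinity>"
    proof (rule less.hyps[OF sum])
      show "1 < e b" using b by simp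
      fix c x assume c: "c \<in> B" and x: "x \<in> N"
      show "(c [^]\<^bsub>R\<^esub> ((e(b := 1)) c)) \<odot>\<^bsub>M\<^esub> x \<in> ?N"
      proof (cases "c = b")
        case True
        thus ?thesis using sum_upper1[OF bN L] x bc by auto
      qed (use less.prems(4) c x LN in auto)
    qed (use less.prems N' NN in auto)
    ultimately show ?thesis using len_add[OF L N' N LN NN] by (metis plus_eq_infty_iff_enat)
  next
    case False
    have 1: "b \<odot>\<^bsub>M\<^esub> x \<in> L" if b: "b \<in> B" and x: "x \<in> N" for b x
    proof -
      have bc: "b \<in> carrier R" using b B by auto
      have "e b = 0 \<or> e b = 1" using False b by force
      thus ?thesis
      proof
        assume "e b = 0"
        hence "x \<in> L" using less.prems(4)[OF b x] mem[OF x] by simp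
        thus ?thesis using submodule_smult[OF L bc] by auto
      next
        assume "e b = 1"
        thus ?thesis using less.prems(4)[OF b x] bc by simp
      qed
    qed
    have "Idl B \<subseteq> {a \<in> carrier R. \<forall>x\<in>N. a \<odot>\<^bsub>M\<^esub> x \<in> L}"
      by (rule R.genideal_minimal[OF ideal_transporter[OF L submoduleE(1)[OF N]]]) (use 1 B in auto)
    hence mL: "a \<odot>\<^bsub>M\<^esub> x \<in> L" if "a \<in> \<mm>" "x \<in> N" for a x using that B by auto
    obtain S where S: "finite S" "S \<subseteq> carrier M" "span S = N" using less.prems(1) by (auto simp: fg_def)
    have SN: "S \<subseteq> N" using S submodule_span(2)[OF S(2)] by auto
    have "span (S \<union> L) = N"
    proof
      show "span (S \<union> L) \<subseteq> N" by (rule span_minimal[OF N]) (use SN less.prems in auto)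
      show "N \<subseteq> span (S \<union> L)" using S(3) span_mono[of S "S \<union> L"] by auto
    qed
    thus ?thesis using len_finite_semisimple[OF loc S(1,2) L] mL SN by auto
  qed
qed

end

section \<open>Krull dimension and chains of primes\<close>

text \<open>Primes of a quotient correspond to primes above \<open>I\<close>. With this, dimensions
  of modules are computed by chains in the ring itself.\<close>

lemma (in cring) krull_dim_quot:
  assumes I: "ideal I R"
  shows "krull_dim (R Quot I) = height {P. primeideal P R \<and> I \<subseteq> P}"
  unfolding krull_dim_height
proof (rule antisym)
  interpret I: ideal I R by fact
  interpret Q: cring "R Quot I" by (rule I.quotient_is_cring[OF is_cring])
  have car: "carrier (R Quot I) = (\<lambda>x. I +> x) ` carrier R"
    by (auto simp: FactRing_def A_RCOSETS_def')
  have mult: "(I +> x) \<otimes>\<^bsub>R Quot I\<^esub> (I +> y) = I +> (x \<otimes> y)" if "x \<in> carrier R" "y \<in> carrier R" for x y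
    using I.rcoset_mult_add[OF that] by (simp add: FactRing_def)
  show "height {P. primeideal P (R Quot I)} \<le> height {P. primeideal P R \<and> I \<subseteq> P}"
  proof (rule height_mono_map[where \<Phi>="\<lambda>P. {x \<in> carrier R. I +> x \<in> P}"])
    fix P assume "P \<in> {P. primeideal P (R Quot I)}"
    then interpret P: primeideal P "R Quot I" by simp
    have id: "ideal {x \<in> carrier R. I +> x \<in> P} R"
      by (rule ring_hom_ring.ideal_vimage[OF I.rcos_ring_hom_ring P.is_ideal])
    have "primeideal {x \<in> carrier R. I +> x \<in> P} R"
    proof (rule primeidealI[OF id is_cring])
      show "carrier R \<noteq> {x \<in> carrier R. I +> x \<in> P}"
      proof
        assume "carrier R = {x \<in> carrier R. I +> x \<in> P}"
        hence "carrier (R Quot I) \<subseteq> P" unfolding car by auto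
        thus False using P.I_notcarr P.a_subset by auto
      qed
      fix a b assume ab: "a \<in> carrier R" "b \<in> carrier R" "a \<otimes> b \<in> {x \<in> carrier R. I +> x \<in> P}"
      hence "(I +> a) \<otimes>\<^bsub>R Quot I\<^esub> (I +> b) \<in> P" by (simp add: mult)
      hence "I +> a \<in> P \<or> I +> b \<in> P" using P.I_prime[of "I +> a" "I +> b"] ab unfolding car by blast
      thus "a \<in> {x \<in> carrier R. I +> x \<in> P} \<or> b \<in> {x \<in> carrier R. I +> x \<in> P}" using ab by auto
    qed
    moreover have "I \<subseteq> {x \<in> carrier R. I +> x \<in> P}"
    proof
      fix x assume x: "x \<in> I"
      have "I +> x = \<zero>\<^bsub>R Quot I\<^esub>" using a_rcos_zero[OF I x] by (simp add: FactRing_def)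
      thus "x \<in> {x \<in> carrier R. I +> x \<in> P}" using I.Icarr[OF x] P.zero_closed by simp
    qed
    ultimately show "{x \<in> carrier R. I +> x \<in> P} \<in> {P. primeideal P R \<and> I \<subseteq> P}" by simp
    fix P' assume P': "P' \<in> {P. primeideal P (R Quot I)}" and PP: "P \<subset> P'"
    then interpret P': primeideal P' "R Quot I" by simp
    obtain y where y: "y \<in> P'" "y \<notin> P" using PP by auto
    then obtain x where "x \<in> carrier R" "y = I +> x" using P'.Icarr[of y] unfolding car by auto
    thus "{x \<in> carrier R. I +> x \<in> P} \<subset> {x \<in> carrier R. I +> x \<in> P'}" using y PP by blast
  qed
  show "height {P. primeideal P R \<and> I \<subseteq> P} \<le> height {P. primeideal P (R Quot I)}"
  proof (rule height_mono_map[where \<Phi>="\<lambda>P. (\<lambda>x. I +> x) ` P"])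
    fix P assume "P \<in> {P. primeideal P R \<and> I \<subseteq> P}"
    hence Pp: "primeideal P R" and IP: "I \<subseteq> P" by auto
    interpret P: primeideal P R by fact
    have mem: "x \<in> P" if x: "x \<in> carrier R" and xP: "I +> x \<in> (\<lambda>x. I +> x) ` P'"
      and P': "ideal P' R" "I \<subseteq> P'" "P' \<subseteq> P" for x P'
    proof -
      obtain y where y: "y \<in> P'" "I +> x = I +> y" using xP by auto
      have yc: "y \<in> carrier R" using y P' P.Icarr by auto
      have "x \<ominus> y \<in> I" using quotient_eq_iff_same_a_r_cos[OF I x yc] y by simp
      hence "(x \<ominus> y) \<oplus> y \<in> P" using y IP P' by (intro P.a_closed) auto
      thus "x \<in> P" using x yc by (simp add: a_minus_def a_assoc l_neg)
    qed
    have "ideal ((\<lambda>x. I +> x) ` P) (R Quot I)" by (rule ring_ideal_imp_quot_ideal[OF I P.is_ideal])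
    hence "primeideal ((\<lambda>x. I +> x) ` P) (R Quot I)"
    proof (rule primeidealI[OF _ Q.is_cring])
      show "carrier (R Quot I) \<noteq> (\<lambda>x. I +> x) ` P"
      proof
        assume "carrier (R Quot I) = (\<lambda>x. I +> x) ` P"
        hence "I +> \<one> \<in> (\<lambda>x. I +> x) ` P" unfolding car by auto
        hence "\<one> \<in> P" using mem[of \<one> P] P.is_ideal IP by simp
        thus False using P.one_imp_carrier P.I_notcarr by simp
      qed
      fix a b assume ab: "a \<in> carrier (R Quot I)" "b \<in> carrier (R Quot I)"
        "a \<otimes>\<^bsub>R Quot I\<^esub> b \<in> (\<lambda>x. I +> x) ` P"
      obtain x y where xy: "x \<in> carrier R" "a = I +> x" "y \<in> carrier R" "b = I +> y"
        using ab(1,2) unfolding car by auto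
      have "I +> (x \<otimes> y) \<in> (\<lambda>x. I +> x) ` P" using ab(3) mult[OF xy(1,3)] xy by simp
      hence "x \<otimes> y \<in> P" using mem[OF m_closed[OF xy(1,3)] _ P.is_ideal IP subset_refl] by blast
      hence "x \<in> P \<or> y \<in> P" using P.I_prime xy by simp
      thus "a \<in> (\<lambda>x. I +> x) ` P \<or> b \<in> (\<lambda>x. I +> x) ` P" using xy by auto
    qed
    thus "(\<lambda>x. I +> x) ` P \<in> {P. primeideal P (R Quot I)}" by simp
    fix P' assume P'': "P' \<in> {P. primeideal P R \<and> I \<subseteq> P}" and PP: "P \<subset> P'"
    then interpret P': primeideal P' R by simp
    obtain y where y: "y \<in> P'" "y \<notin> P" using PP by auto
    have "I +> y \<notin> (\<lambda>x. I +> x) ` P" using mem[of y P] y P'.Icarr P.is_ideal IP by blast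
    thus "(\<lambda>x. I +> x) ` P \<subset> (\<lambda>x. I +> x) ` P'" using y PP by blast
  qed
qed

section \<open>Chains of primes obtained from nonzerodivisors\<close>

text \<open>Since \<open>a\<close> is a nonzerodivisor modulo \<open>I\<close>, the products
  \<open>s a^n\<close> with \<open>s\<close> outside \<open>P\<close> avoid \<open>I\<close>. A
  prime over \<open>I\<close> missing all of them is inside \<open>P\<close> (take
  \<open>n = 0\<close>) and does not contain \<open>a\<close> (take \<open>s = 1\<close>,
  \<open>n = 1\<close>).\<close>

lemma (in cring) prime_descent:
  assumes P: "primeideal P R" and I: "ideal I R" and IP: "I \<subseteq> P" and a: "a \<in> carrier R"
    and sat: "\<And>s. s \<in> carrier R \<Longrightarrow> s \<otimes> a \<in> I \<Longrightarrow> s \<in> I"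
  shows "\<exists>Q. primeideal Q R \<and> I \<subseteq> Q \<and> Q \<subseteq> P \<and> a \<notin> Q"
proof -
  interpret P: primeideal P R by fact
  have pw: "s \<in> I" if "s \<in> carrier R" "s \<otimes> a [^] (n::nat) \<in> I" for s n
    using that
  proof (induction n)
    case (Suc n)
    have "(s \<otimes> a [^] n) \<otimes> a \<in> I" using Suc.prems a by (simp add: m_assoc)
    thus ?case using sat[of "s \<otimes> a [^] n"] Suc a by simp
  qed simp
  let ?S = "{s \<otimes> a [^] (n::nat) | s n. s \<in> carrier R - P}"
  have one: "\<one> \<in> carrier R - P" using P.one_imp_carrier P.I_notcarr by auto
  have mem: "s \<otimes> a [^] (n::nat) \<in> ?S" if "s \<in> carrier R - P" for s n using that by blast
  have "I \<inter> ?S = {}" using pw IP by auto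
  then obtain Q where Q: "primeideal Q R" "I \<subseteq> Q" "Q \<inter> ?S = {}"
  proof (rule exists_prime_disjoint[OF I])
    show "?S \<subseteq> carrier R" using a by auto
    show "\<one> \<in> ?S" using mem[OF one, of 0] by simp
    fix s t assume "s \<in> ?S" "t \<in> ?S"
    then obtain s' t' and n m :: nat where *: "s = s' \<otimes> a [^] n" "t = t' \<otimes> a [^] m"
      "s' \<in> carrier R - P" "t' \<in> carrier R - P" by blast
    have "s \<otimes> t = (s' \<otimes> t') \<otimes> a [^] (n + m)" using * a by (simp add: nat_pow_mult[symmetric] m_ac)
    moreover have "s' \<otimes> t' \<in> carrier R - P" using *(3,4) P.I_prime by auto
    hence "(s' \<otimes> t') \<otimes> a [^] (n + m) \<in> ?S" by (rule mem)
    ultimately show "s \<otimes> t \<in> ?S" by (simp only:)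
  qed
  interpret Q: primeideal Q R by fact
  have "Q \<subseteq> P"
  proof
    fix x assume x: "x \<in> Q"
    show "x \<in> P"
    proof (rule ccontr)
      assume "x \<notin> P"
      hence "x \<otimes> a [^] (0::nat) \<in> ?S" using Q.Icarr[OF x] by (intro mem) auto
      thus False using x Q(3) Q.Icarr[OF x] by auto
    qed
  qed
  moreover have "a \<notin> Q" using mem[OF one, of 1] a Q(3) by auto
  ultimately show ?thesis using Q by blast
qed

text \<open>The common engine of the two estimates by dimension: regular sequences and superficial
  sequences both supply ideals \<open>I i\<close> with \<open>a i\<close> regular modulo
  \<open>I i\<close>. The chain grows downwards from \<open>P\<close>. The fourth hypothesis may use
  that the current lowest prime avoids the next element, which is exactly what the previous descent
  has achieved.\<close>

lemma (in cring) prime_chain: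
  assumes "\<And>i. i < k \<Longrightarrow> ideal (I i) R" "\<And>i. i < k \<Longrightarrow> a i \<in> carrier R"
    and "\<And>i s. i < k \<Longrightarrow> s \<in> carrier R \<Longrightarrow> s \<otimes> a i \<in> I i \<Longrightarrow> s \<in> I i"
    and "\<And>i P. i < k \<Longrightarrow> primeideal P R \<Longrightarrow> I (Suc i) \<subseteq> P \<Longrightarrow> (Suc i < k \<longrightarrow> a (Suc i) \<notin> P)
      \<Longrightarrow> I i \<subseteq> P \<and> a i \<in> P"
    and "primeideal P R" "I k \<subseteq> P"
  shows "\<exists>p. chain_in {Q. primeideal Q R \<and> I 0 \<subseteq> Q} k p \<and> (0 < k \<longrightarrow> a 0 \<notin> p 0)"
  using assms
proof (induction k arbitrary: I a)
  case 0
  thus ?case by (intro exI[of _ "\<lambda>_. P"]) (auto simp: chain_in_def)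
next
  case (Suc k)
  have "\<exists>p. chain_in {Q. primeideal Q R \<and> I (Suc 0) \<subseteq> Q} k p \<and> (0 < k \<longrightarrow> a (Suc 0) \<notin> p 0)"
    by (rule Suc.IH[where I="\<lambda>i. I (Suc i)" and a="\<lambda>i. a (Suc i)"]) (use Suc.prems in auto)
  then obtain p where p: "chain_in {Q. primeideal Q R \<and> I (Suc 0) \<subseteq> Q} k p" "0 < k \<longrightarrow> a (Suc 0) \<notin> p 0"
    by blast
  have p0: "primeideal (p 0) R" "I (Suc 0) \<subseteq> p 0" using p by (auto simp: chain_in_def)
  have s: "I 0 \<subseteq> p 0" "a 0 \<in> p 0" using Suc.prems(4)[of 0 "p 0"] p0 p(2) by auto
  obtain Q where Q: "primeideal Q R" "I 0 \<subseteq> Q" "Q \<subseteq> p 0" "a 0 \<notin> Q"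
    using prime_descent[OF p0(1) Suc.prems(1)[of 0] s(1) Suc.prems(2)[of 0]] Suc.prems(3)[of 0] by auto
  \<comment> \<open>The new prime is put below the chain obtained for the sequences shifted by
    one.\<close>
  let ?p = "\<lambda>i. case i of 0 \<Rightarrow> Q | Suc j \<Rightarrow> p j"
  have sub: "p 0 \<subseteq> p i" if "i \<le> k" for i
    using that
  proof (induction i)
    case (Suc i)
    have "p i \<subset> p (Suc i)" using p(1) Suc.prems by (auto simp: chain_in_def)
    thus ?case using Suc by auto
  qed simp
  have "chain_in {Q. primeideal Q R \<and> I 0 \<subseteq> Q} (Suc k) ?p"
    unfolding chain_in_def
  proof (intro conjI allI impI)
    fix i assume "i \<le> Suc k"
    thus "?p i \<in> {Q. primeideal Q R \<and> I 0 \<subseteq> Q}"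
    proof (cases i)
      case (Suc j)
      hence "p 0 \<subseteq> p j" "primeideal (p j) R" using \<open>i \<le> Suc k\<close> sub[of j] p(1) by (auto simp: chain_in_def)
      thus ?thesis using Suc s(1) by auto
    qed (use Q in auto)
  next
    fix i assume "i < Suc k"
    thus "?p i \<subset> ?p (Suc i)" using p(1) Q s by (cases i) (auto simp: chain_in_def)
  qed
  thus ?case using Q(4) by (intro exI[of _ ?p]) auto
qed

section \<open>Dimension of a module and lengths of regular sequences\<close>

context rmodule
begin

lemma submodule_zero_set: "sub {\<zero>\<^bsub>M\<^esub>}"
  by (rule submoduleI) auto

lemma ideal_annihilator: "ideal (annihilator R M) R"
  using ideal_transporter[OF submodule_zero_set, of "carrier M"] by (simp add: annihilator_def)

lemma module_dim_height:
  "module_dim R M = height {P. primeideal P R \<and> annihilator R M \<subseteq> P}"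
  unfolding module_dim_def by (rule R.krull_dim_quot[OF ideal_annihilator])

lemma nonzerodivisor_quot_iff:
  assumes V: "sub V" and a: "a \<in> carrier R"
  shows "nonzerodivisor_on (quot_module M V) a \<longleftrightarrow> (\<forall>x\<in>carrier M. a \<odot>\<^bsub>M\<^esub> x \<in> V \<longrightarrow> x \<in> V)"
  using V a coset_eq_self_iff[OF V]
  unfolding nonzerodivisor_on_def carrier_quot_module by auto

text \<open>The prime chain is built over the colon ideals \<open>(V i : M)\<close>: an element
  regular on \<open>M / V i\<close> is regular modulo that ideal, and the next colon ideal contains
  it. The ring is an arbitrary commutative one, so the estimate also covers gr(M) over
  gr(A).\<close>

lemma regular_sequence_length_le_dim:
  assumes reg: "regular_sequence R M xs"
  shows "enat (length xs) \<le> module_dim R M"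
proof -
  let ?V = "\<lambda>i. seq_submodule R M (take i xs)"
  let ?I = "\<lambda>i. {a \<in> carrier R. \<forall>x\<in>carrier M. a \<odot>\<^bsub>M\<^esub> x \<in> ?V i}"
  have xs: "set xs \<subseteq> carrier R" "?V (length xs) \<noteq> carrier M"
    using reg by (simp_all add: regular_sequence_def)
  have V: "sub (?V i)" for i by (rule submodule_seq_submodule[OF subset_trans[OF set_take_subset xs(1)]])
  have xsi: "xs ! i \<in> carrier R" if "i < length xs" for i using xs(1) nth_mem[OF that] by blast
  have nzd: "x \<in> ?V i" if "i < length xs" "x \<in> carrier M" "xs ! i \<odot>\<^bsub>M\<^esub> x \<in> ?V i" for i x
    using reg that nonzerodivisor_quot_iff[OF V xsi] by (auto simp: regular_sequence_def)
  have I: "ideal (?I i) R" for i by (rule ideal_transporter[OF V]) auto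
  \<comment> \<open>The last term differs from \<open>M\<close>, so its colon ideal is proper and
    some prime can start the chain at the top.\<close>
  have "?I (length xs) \<inter> {\<one>} = {}" using xs(2) submodule_mem_carrier[OF V[of "length xs"]] by auto
  then obtain P where P: "primeideal P R" "?I (length xs) \<subseteq> P" "P \<inter> {\<one>} = {}"
    by (rule R.exists_prime_disjoint[OF I]) auto
  have Vs: "?V (Suc i) = ?V i <+>\<^bsub>M\<^esub> (\<odot>\<^bsub>M\<^esub>) (xs ! i) ` carrier M" if "i < length xs" for i
    using seq_submodule_snoc[of "take i xs" "xs ! i"] xs(1) xsi[OF that] that set_take_subset[of i xs]
    by (simp add: take_Suc_conv_app_nth)
  have "\<exists>p. chain_in {Q. primeideal Q R \<and> ?I 0 \<subseteq> Q} (length xs) p \<and> (0 < length xs \<longrightarrow> xs ! 0 \<notin> p 0)"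
  proof (rule R.prime_chain[where a="\<lambda>i. xs ! i" and I="?I"])
    fix i s assume i: "i < length xs" and s: "s \<in> carrier R" "s \<otimes> xs ! i \<in> ?I i"
    have "xs ! i \<odot>\<^bsub>M\<^esub> (s \<odot>\<^bsub>M\<^esub> x) \<in> ?V i" if "x \<in> carrier M" for x
      using s that xsi[OF i] by (simp add: smult_assoc1[symmetric] R.m_comm)
    thus "s \<in> ?I i" using nzd[OF i] s by auto
  next
    fix i Q assume i: "i < length xs" and Q: "primeideal Q R" "?I (Suc i) \<subseteq> Q"
    have s: "sub ((\<odot>\<^bsub>M\<^esub>) (xs ! i) ` carrier M)"
      by (rule submodule_smult_image[OF carrier_is_submodule xsi[OF i]])
    have "?V i \<subseteq> ?V (Suc i)" "(\<odot>\<^bsub>M\<^esub>) (xs ! i) ` carrier M \<subseteq> ?V (Suc i)"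
      unfolding Vs[OF i] using sum_upper1[OF V s] sum_upper2[OF V s] by auto
    hence "?I i \<subseteq> ?I (Suc i)" "xs ! i \<in> ?I (Suc i)" using xsi[OF i] by auto
    thus "?I i \<subseteq> Q \<and> xs ! i \<in> Q" using Q by auto
  qed (use I xsi P in auto)
  then obtain p where p: "chain_in {Q. primeideal Q R \<and> ?I 0 \<subseteq> Q} (length xs) p" by blast
  have "?I 0 = annihilator R M" by (simp add: annihilator_def seq_submodule_Nil)
  thus ?thesis using height_geI[OF p] by (simp add: module_dim_height)
qed

lemma depth_le_dim: "depth R I M \<le> module_dim R M"
  unfolding depth_def by (rule Sup_least) (auto intro: regular_sequence_length_le_dim)

end

section \<open>Good filtrations over a local ring\<close>

locale filtered = rmodule R M for R :: "('a, 'k) ring_scheme" (structure)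
    and M :: "('a, 'b) module" (structure) +
  fixes \<mm> \<qq> :: "'a set" and F :: "nat \<Rightarrow> 'b set"
  assumes noeth: "noetherian_ring R" and loc: "local_ring R \<mm>" and prim: "primary_to R \<mm> \<qq>"
    and fin_gen: "fin_gen_module R M" and nonzero: "carrier M \<noteq> {\<zero>\<^bsub>M\<^esub>}"
    and good: "good_filtration R \<qq> M F"
begin

lemma q_ideal: "ideal \<qq> R" using prim by (simp add: primary_to_def primary_ideal_def)

lemma q_carrier: "\<qq> \<subseteq> carrier R" using ideal.Icarr[OF q_ideal] by auto

lemma m_power: "a \<in> \<mm> \<Longrightarrow> \<exists>n::nat. a [^]\<^bsub>R\<^esub> n \<in> \<qq>"
  using prim by (auto simp: primary_to_def ideal_radical_def)

lemma q_subset_m: "\<qq> \<subseteq> \<mm>"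
proof
  fix a assume a: "a \<in> \<qq>"
  hence "a [^]\<^bsub>R\<^esub> (1::nat) \<in> \<qq>" using q_carrier by auto
  hence "a \<in> ideal_radical R \<qq>" using a q_carrier unfolding ideal_radical_def by blast
  thus "a \<in> \<mm>" using prim by (simp add: primary_to_def)
qed

lemma m_ideal: "ideal \<mm> R" and m_maximal: "maximalideal \<mm> R"
  using loc by (auto simp: local_ring_def maximalideal_def)

lemma F_0: "F 0 = carrier M" and F_sub: "sub (F n)" and F_Suc: "F (Suc n) \<subseteq> F n"
  and F_ideal_smult: "ideal_smult R M \<qq> (F n) \<subseteq> F (Suc n)"
  using good by (auto simp: good_filtration_def)

lemma F_stable: "\<exists>k. \<forall>n\<ge>k. F (Suc n) = ideal_smult R M \<qq> (F n)"
  using good by (auto simp: good_filtration_def)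

lemma F_carrier: "F n \<subseteq> carrier M" using submoduleE(1)[OF F_sub] .

lemma F_antimono: "i \<le> j \<Longrightarrow> F j \<subseteq> F i"
  using lift_Suc_antimono_le[of F] F_Suc by blast

lemma F_smult: "a \<in> \<qq> \<Longrightarrow> x \<in> F n \<Longrightarrow> a \<odot>\<^bsub>M\<^esub> x \<in> F (Suc n)"
  using mem_ideal_smult[OF q_carrier F_carrier] F_ideal_smult by blast

lemma F_pow: "a \<in> \<qq> \<Longrightarrow> x \<in> carrier M \<Longrightarrow> a [^]\<^bsub>R\<^esub> n \<odot>\<^bsub>M\<^esub> x \<in> F n"
proof (induction n)
  case (Suc n)
  have "a [^]\<^bsub>R\<^esub> Suc n = a \<otimes> a [^]\<^bsub>R\<^esub> n" using Suc.prems q_carrier by (simp add: R.m_comm subset_iff)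
  hence "a [^]\<^bsub>R\<^esub> Suc n \<odot>\<^bsub>M\<^esub> x = a \<odot>\<^bsub>M\<^esub> (a [^]\<^bsub>R\<^esub> n \<odot>\<^bsub>M\<^esub> x)"
    using Suc.prems q_carrier by (simp add: smult_assoc1 subset_iff del: R.nat_pow_Suc)
  thus ?case using F_smult[OF Suc.prems(1) Suc.IH[OF Suc.prems]] by simp
qed (simp add: F_0)

lemma fg_carrier: "fg (carrier M)"
  using fin_gen by (auto simp: fg_def fin_gen_module_def)

lemma submodule_fg: "sub N \<Longrightarrow> fg N"
  by (rule fg_subset[OF noeth fg_carrier _ submoduleE(1)])

lemma nakayama_q:
  assumes "sub N" "sub L" "N \<subseteq> ideal_smult R M \<qq> N <+>\<^bsub>M\<^esub> L"
  shows "N \<subseteq> L"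
proof (rule nakayama[OF loc submodule_fg[OF assms(1)] assms(2)])
  have "ideal_smult R M \<qq> N \<subseteq> ideal_smult R M \<mm> N" by (rule ideal_smult_mono[OF q_subset_m subset_refl])
  thus "N \<subseteq> ideal_smult R M \<mm> N <+>\<^bsub>M\<^esub> L" using assms(3) sum_mono by blast
qed

text \<open>Each generator of \<open>\<mm>\<close> has a power in \<open>\<qq>\<close>, and the
  \<open>n\<close>-th power of an element of \<open>\<qq>\<close> carries \<open>M\<close> into
  \<open>F n\<close>. So a power of each generator kills \<open>M/L\<close>.\<close>

lemma len_carrier_finite:
  assumes L: "sub L" and FL: "F n \<subseteq> L"
  shows "len L (carrier M) \<noteq> \<infinity>"
proof -
  obtain B where B: "B \<subseteq> carrier R" "finite B" "\<mm> = Idl B"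
    using noetherian_ring.finetely_gen[OF noeth m_ideal] by blast
  have "\<forall>b\<in>B. \<exists>e::nat. b [^]\<^bsub>R\<^esub> e \<in> \<qq>"
    using m_power R.genideal_self[OF B(1)] B(3) by auto
  then obtain e :: "'a \<Rightarrow> nat" where e: "\<And>b. b \<in> B \<Longrightarrow> b [^]\<^bsub>R\<^esub> e b \<in> \<qq>" by metis
  show ?thesis
  proof (rule len_finite[OF noeth loc B(2,1,3) fg_carrier L submoduleE(1)[OF L]])
    fix b x assume b: "b \<in> B" and x: "x \<in> carrier M"
    have "(b [^]\<^bsub>R\<^esub> e b) [^]\<^bsub>R\<^esub> n \<odot>\<^bsub>M\<^esub> x \<in> F n" by (rule F_pow[OF e[OF b] x])
    moreover have "(b [^]\<^bsub>R\<^esub> e b) [^]\<^bsub>R\<^esub> n = b [^]\<^bsub>R\<^esub> (e b * n)"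
      using b B(1) by (intro R.nat_pow_pow) auto
    ultimately show "b [^]\<^bsub>R\<^esub> (e b * n) \<odot>\<^bsub>M\<^esub> x \<in> L" using FL by auto
  qed
qed

text \<open>Natural numbers permit cancellation and differences. The value is meaningful when the
  length is finite, which \<open>len_nlen\<close> derives from some
  \<open>F n \<subseteq> L\<close>.\<close>

definition nlen :: "'b set \<Rightarrow> 'b set \<Rightarrow> nat" where "nlen L N = the_enat (len L N)"

lemma len_nlen:
  assumes L: "sub L" and N: "sub N" and LN: "L \<subseteq> N" and FL: "F n \<subseteq> L"
  shows "len L N = enat (nlen L N)"
proof -
  have "len L (carrier M) = len L N + len N (carrier M)"
    by (rule len_add[OF L N carrier_is_submodule LN submoduleE(1)[OF N]])
  hence "len L N \<noteq> \<infinity>" using len_carrier_finite[OF L FL] by (metis plus_eq_infty_iff_enat)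
  then obtain k where "len L N = enat k" by blast
  thus ?thesis by (simp add: nlen_def)
qed

lemma nlen_add:
  assumes "sub L" "sub K" "sub N" "L \<subseteq> K" "K \<subseteq> N" "F n \<subseteq> L"
  shows "nlen L N = nlen L K + nlen K N"
proof -
  have "enat (nlen L N) = enat (nlen L K) + enat (nlen K N)"
    using len_add[OF assms(1-5)] len_nlen[of L N n] len_nlen[of L K n] len_nlen[of K N n] assms by auto
  thus ?thesis by simp
qed

lemma nlen_self [simp]: "nlen N N = 0" by (simp add: nlen_def zero_enat_def)

lemma nlen_eq_0D:
  assumes "sub L" "sub N" "L \<subseteq> N" "F n \<subseteq> L" "nlen L N = 0"
  shows "L = N"
  using len_eq_0D[OF assms(1-3)] len_nlen[OF assms(1-4)] assms(5) by (simp add: zero_enat_def)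

text \<open>Hilbert function of the filtration induced on \<open>M/L\<close>.\<close>

definition hilb :: "'b set \<Rightarrow> nat \<Rightarrow> nat" where
  "hilb L n = nlen (F (Suc n) <+>\<^bsub>M\<^esub> L) (F n <+>\<^bsub>M\<^esub> L)"

text \<open>The index is shifted so that \<open>F n + L\<close> is the obvious lower bound; it is
  the module of elements that \<open>a\<close> kills modulo \<open>F (Suc n) + L\<close>.\<close>

definition colon :: "'b set \<Rightarrow> 'a \<Rightarrow> nat \<Rightarrow> 'b set" where
  "colon L a n = {x \<in> carrier M. a \<odot>\<^bsub>M\<^esub> x \<in> F (Suc n) <+>\<^bsub>M\<^esub> L}"

lemma FL_sub: "sub L \<Longrightarrow> sub (F n <+>\<^bsub>M\<^esub> L)"
  by (rule submodule_sum[OF F_sub])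

lemma F_le_FL: "sub L \<Longrightarrow> F n \<subseteq> F n <+>\<^bsub>M\<^esub> L"
  by (rule sum_upper1[OF F_sub])

lemma L_le_FL: "sub L \<Longrightarrow> L \<subseteq> F n <+>\<^bsub>M\<^esub> L"
  by (rule sum_upper2[OF F_sub])

lemma FL_antimono: "i \<le> j \<Longrightarrow> F j <+>\<^bsub>M\<^esub> L \<subseteq> F i <+>\<^bsub>M\<^esub> L"
  by (rule sum_mono[OF F_antimono subset_refl])

lemma FL_0: "sub L \<Longrightarrow> F 0 <+>\<^bsub>M\<^esub> L = carrier M"
  using F_0 F_le_FL[of L 0] submoduleE(1)[OF FL_sub[of L 0]] by auto

lemma FL_zero: "F n <+>\<^bsub>M\<^esub> {\<zero>\<^bsub>M\<^esub>} = F n"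
  using F_le_FL[OF submodule_zero_set] sum_least[OF F_sub subset_refl, of "{\<zero>\<^bsub>M\<^esub>}" n]
    submodule_zero[OF F_sub] by (metis empty_subsetI insert_subset subset_antisym)

lemma sum_hilb:
  assumes L: "sub L"
  shows "(\<Sum>j\<le>n. hilb L j) = nlen (F (Suc n) <+>\<^bsub>M\<^esub> L) (carrier M)"
proof (induction n)
  case 0
  show ?case by (simp add: hilb_def FL_0[OF L])
next
  case (Suc n)
  have "nlen (F (Suc (Suc n)) <+>\<^bsub>M\<^esub> L) (carrier M) =
    nlen (F (Suc (Suc n)) <+>\<^bsub>M\<^esub> L) (F (Suc n) <+>\<^bsub>M\<^esub> L) + nlen (F (Suc n) <+>\<^bsub>M\<^esub> L) (carrier M)"
    by (rule nlen_add[OF FL_sub[OF L] FL_sub[OF L] carrier_is_submodule _ _ F_le_FL[OF L]])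
      (use FL_antimono submoduleE(1)[OF FL_sub[OF L]] in auto)
  thus ?case using Suc by (simp add: hilb_def)
qed

lemma submodule_colon:
  assumes L: "sub L" and a: "a \<in> \<qq>"
  shows "sub (colon L a n)"
  using partial_hom.submodule_preimage[OF smult_partial_hom[OF carrier_is_submodule] FL_sub[OF L]]
    a q_carrier unfolding colon_def by auto

lemma FL_le_colon:
  assumes L: "sub L" and a: "a \<in> \<qq>"
  shows "F n <+>\<^bsub>M\<^esub> L \<subseteq> colon L a n"
proof (rule sum_least[OF submodule_colon[OF L a]])
  have ac: "a \<in> carrier R" using a q_carrier by auto
  show "F n \<subseteq> colon L a n"
    using F_smult[OF a] F_le_FL[OF L, of "Suc n"] F_carrier[of n] unfolding colon_def by blast
  show "L \<subseteq> colon L a n"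
    using submodule_smult[OF L ac] L_le_FL[OF L, of "Suc n"] submoduleE(1)[OF L] unfolding colon_def by blast
qed

lemma sum_assoc:
  assumes "X \<subseteq> carrier M" "Y \<subseteq> carrier M" "Z \<subseteq> carrier M"
  shows "(X <+>\<^bsub>M\<^esub> Y) <+>\<^bsub>M\<^esub> Z = X <+>\<^bsub>M\<^esub> (Y <+>\<^bsub>M\<^esub> Z)"
proof -
  have "(x \<oplus>\<^bsub>M\<^esub> y) \<oplus>\<^bsub>M\<^esub> z = x \<oplus>\<^bsub>M\<^esub> (y \<oplus>\<^bsub>M\<^esub> z)" if "x \<in> X" "y \<in> Y" "z \<in> Z" for x y z
    using that assms by (auto intro!: M.a_assoc)
  thus ?thesis by (auto simp: set_add_def')
qed

text \<open>Multiplication by \<open>a\<close> maps \<open>M/(F n + L)\<close> to \<open>M/(F (n+1) + L)\<close>; compare kernel and cokernel.\<close>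

lemma hilb_colon:
  assumes L: "sub L" and a: "a \<in> \<qq>"
  shows "hilb L n + nlen (F n <+>\<^bsub>M\<^esub> L) (colon L a n) =
    (\<Sum>j\<le>n. hilb (L <+>\<^bsub>M\<^esub> (\<odot>\<^bsub>M\<^esub>) a ` carrier M) j)"
proof -
  have ac: "a \<in> carrier R" using a q_carrier by auto
  let ?T = "F (Suc n) <+>\<^bsub>M\<^esub> L" and ?G = "F n <+>\<^bsub>M\<^esub> L" and ?C = "colon L a n"
  let ?aM = "(\<odot>\<^bsub>M\<^esub>) a ` carrier M"
  note s = FL_sub[OF L] submodule_colon[OF L a] carrier_is_submodule
  have aM: "sub ?aM" by (rule submodule_smult_image[OF carrier_is_submodule ac])
  have L': "sub (L <+>\<^bsub>M\<^esub> ?aM)" by (rule submodule_sum[OF L aM])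
  let ?U = "F (Suc n) <+>\<^bsub>M\<^esub> (L <+>\<^bsub>M\<^esub> ?aM)"
  have comm: "?aM <+>\<^bsub>M\<^esub> ?T = ?T <+>\<^bsub>M\<^esub> ?aM"
    by (rule antisym)
      (use sum_least sum_upper1 sum_upper2 submodule_sum aM s(1) in metis)+
  have U: "?aM <+>\<^bsub>M\<^esub> ?T = ?U"
    unfolding comm by (rule sum_assoc[OF F_carrier submoduleE(1)[OF L] submoduleE(1)[OF aM]])
  have Us: "sub ?U" by (rule FL_sub[OF L'])
  have TU: "?T \<subseteq> ?U" unfolding U[symmetric] by (rule sum_upper2[OF aM s(1)])
  have FT: "F (Suc n) \<subseteq> ?T" by (rule F_le_FL[OF L])
  have TG: "?T \<subseteq> ?G" by (rule FL_antimono) simp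
  have GC: "?G \<subseteq> ?C" by (rule FL_le_colon[OF L a])
  have FG: "F n \<subseteq> ?G" by (rule F_le_FL[OF L])
  have Cc: "?C \<subseteq> carrier M" "?G \<subseteq> carrier M" "?U \<subseteq> carrier M"
    using submoduleE(1) s Us by blast+
  \<comment> \<open>Everything is compared with \<open>M/T\<close>. Its length splits along
    \<open>G\<close> and along \<open>U\<close>, and the part from \<open>T\<close> to
    \<open>U\<close> is the image of multiplication by \<open>a\<close>, of the same length as
    \<open>M/C\<close>.\<close>
  have "len ?C (carrier M) = len ?T ?U"
    using len_colon[OF s(1)[of "Suc n"] ac] unfolding U[symmetric] by (simp add: colon_def)
  hence 1: "nlen ?C (carrier M) = nlen ?T ?U" by (simp add: nlen_def)
  have 2: "nlen ?T (carrier M) = nlen ?T ?U + nlen ?U (carrier M)"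
    by (rule nlen_add[OF s(1) Us s(3) TU Cc(3) FT])
  have 3: "nlen ?T (carrier M) = nlen ?T ?G + nlen ?G (carrier M)"
    by (rule nlen_add[OF s(1) s(1) s(3) TG Cc(2) FT])
  have 4: "nlen ?G (carrier M) = nlen ?G ?C + nlen ?C (carrier M)"
    by (rule nlen_add[OF s(1) s(2) s(3) GC Cc(1) FG])
  show ?thesis unfolding sum_hilb[OF L'] using 1 2 3 4 by (simp add: hilb_def)
qed

end

section \<open>Iterated partial sums\<close>

text \<open>Division of a power series by \<open>1 - z\<close>, expressed on coefficients.\<close>

definition psum :: "(nat \<Rightarrow> real) \<Rightarrow> nat \<Rightarrow> real" where
  "psum f n = (\<Sum>i\<le>n. f i)"

lemma psum_mono: "f \<le> g \<Longrightarrow> psum f \<le> psum g"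
  by (auto simp: le_fun_def psum_def intro: sum_mono)

lemma psum_pow_mono: "f \<le> g \<Longrightarrow> (psum ^^ k) f \<le> (psum ^^ k) g"
  by (induction k) (auto intro: psum_mono)

lemma psum_ge: "(\<lambda>_. 0) \<le> f \<Longrightarrow> f \<le> psum f"
  unfolding le_fun_def psum_def by (auto intro: member_le_sum)

lemma psum_nonneg: "(\<lambda>_. 0) \<le> f \<Longrightarrow> (\<lambda>_. 0) \<le> psum f"
  unfolding le_fun_def psum_def by (auto intro: sum_nonneg)

lemma psum_pow_nonneg: "(\<lambda>_. 0) \<le> f \<Longrightarrow> (\<lambda>_. 0) \<le> (psum ^^ k) f"
  by (induction k) (auto intro: psum_nonneg)

lemma psum_pow_le: "(\<lambda>_. 0) \<le> f \<Longrightarrow> j \<le> k \<Longrightarrow> (psum ^^ j) f \<le> (psum ^^ k) f"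
proof (induction k)
  case (Suc k)
  show ?case
  proof (cases "j = Suc k")
    case False
    hence "(psum ^^ j) f \<le> (psum ^^ k) f" using Suc by auto
    also have "\<dots> \<le> (psum ^^ Suc k) f" using psum_ge[OF psum_pow_nonneg[OF Suc.prems(1)]] by simp
    finally show ?thesis .
  qed simp
qed simp

lemma inj_psum: "inj psum"
proof (rule injI, rule ext)
  fix f g n assume fg: "psum f = psum g"
  have "f n = psum f n - (case n of 0 \<Rightarrow> 0 | Suc m \<Rightarrow> psum f m)" for f n
    by (cases n) (auto simp: psum_def)
  thus "f n = g n" using fg by metis
qed

lemma inj_psum_pow: "(psum ^^ k) f = (psum ^^ k) g \<Longrightarrow> f = g"
proof (induction k)
  case (Suc k)
  thus ?case using injD[OF inj_psum] by simp
qed simp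

text \<open>Comparing entries \<open>n + 1\<close> of \<open>psum f\<close> and \<open>f\<close>
  leaves \<open>psum f n = 0\<close> for every \<open>n\<close>.\<close>

lemma psum_fixed: assumes "psum f = f" shows "f = (\<lambda>_. 0)"
proof -
  have z: "psum f n = 0" for n
  proof -
    have "psum f (Suc n) = psum f n + f (Suc n)" by (simp add: psum_def)
    thus ?thesis using assms by simp
  qed
  show ?thesis using assms by (auto simp: fun_eq_iff z)
qed

lemma Abs_fps_psum_pow: "Abs_fps f / (1 - fps_X) ^ k = Abs_fps ((psum ^^ k) f)"
proof (induction k)
  case (Suc k)
  have n: "fps_nth (1 - fps_X :: real fps) 0 \<noteq> 0" by simp
  have "Abs_fps f / (1 - fps_X) ^ Suc k = (Abs_fps f / (1 - fps_X) ^ k) / (1 - fps_X)"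
    by (simp add: fps_divide_unit n fps_inverse_mult mult_ac)
  also have "\<dots> = Abs_fps ((psum ^^ k) f) / (1 - fps_X)" using Suc by simp
  also have "\<dots> = Abs_fps ((psum ^^ Suc k) f)"
    by (simp add: fps_divide_fps_X_minus1_sum psum_def atLeast0AtMost fun_eq_iff fps_eq_iff)
  finally show ?case .
qed simp

text \<open>The whole estimate is the chain \<open>H 0 <= psum (H 1) <= ... <= psum^t (H t) <=
  psum^t q <= psum^r q\<close>. If its ends agree, all its terms agree, and injectivity of summation
  removes the outer sums.\<close>

lemma psum_chain:
  fixes H :: "nat \<Rightarrow> nat \<Rightarrow> real"
  assumes H: "\<And>i. i < t \<Longrightarrow> H i \<le> psum (H (Suc i))" and Ht: "psum (H t) \<le> psum q"
    and q: "(\<lambda>_. 0) \<le> q" and t: "1 \<le> t" "t \<le> r"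
  shows "H 0 \<le> (psum ^^ r) q"
    and "H 0 = (psum ^^ r) q \<Longrightarrow> i < t \<Longrightarrow> H i = psum (H (Suc i))"
    and "H 0 = (psum ^^ r) q \<Longrightarrow> q \<noteq> (\<lambda>_. 0) \<Longrightarrow> t = r"
proof -
  let ?E = "\<lambda>i. (psum ^^ i) (H i)"
  have step: "?E i \<le> ?E (Suc i)" if "i < t" for i
    using psum_pow_mono[OF H[OF that], of i] by (simp add: funpow_swap1)
  have mono: "?E i \<le> ?E j" if "i \<le> j" "j \<le> t" for i j
    using that
  proof (induction j)
    case (Suc j)
    show ?case
    proof (cases "i = Suc j")
      case False
      hence "?E i \<le> ?E j" using Suc by auto
      also have "\<dots> \<le> ?E (Suc j)" using step Suc by auto
      finally show ?thesis .
    qed simp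
  qed simp
  \<comment> \<open>The hypothesis compares \<open>psum (H t)\<close> with \<open>psum q\<close>, so
    one of the \<open>t\<close> summations is spent on it and \<open>s = t - 1\<close>
    remain.\<close>
  obtain s where s: "t = Suc s" using t by (cases t) auto
  have Et: "?E t \<le> (psum ^^ t) q"
    using psum_pow_mono[OF Ht, of s] by (simp add: s funpow_swap1)
  have tr: "(psum ^^ t) q \<le> (psum ^^ r) q" by (rule psum_pow_le[OF q t(2)])
  have H0: "H 0 \<le> ?E i" if "i \<le> t" for i using mono[of 0 i] that by simp
  show "H 0 \<le> (psum ^^ r) q" using H0[of t] Et tr by (meson order_trans order_refl)
  assume eq: "H 0 = (psum ^^ r) q"
  have E: "?E i = H 0" if "i \<le> t" for i
    using H0[OF that] mono[OF that order_refl] Et tr eq by (metis order_antisym order_trans)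
  {
    assume i: "i < t"
    have "(psum ^^ i) (H i) = (psum ^^ i) (psum (H (Suc i)))"
      using E[of i] E[of "Suc i"] i by (simp add: funpow_swap1)
    thus "H i = psum (H (Suc i))" by (rule inj_psum_pow)
  }
  assume q0: "q \<noteq> (\<lambda>_. 0)"
  show "t = r"
  proof (rule ccontr)
    assume "t \<noteq> r"
    \<comment> \<open>A spare summation would be squeezed between equal ends, making
      \<open>q\<close> a fixed point of summation.\<close>
    hence "Suc t \<le> r" using t by simp
    hence "(psum ^^ Suc t) q \<le> (psum ^^ r) q" by (rule psum_pow_le[OF q])
    moreover have "(psum ^^ r) q \<le> (psum ^^ t) q" using E[of t] Et eq by simp
    moreover have "(psum ^^ t) q \<le> (psum ^^ Suc t) q" by (rule psum_pow_le[OF q]) simp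
    ultimately have "(psum ^^ t) (psum q) = (psum ^^ t) q" by (simp add: funpow_swap1)
    hence "psum q = q" by (rule inj_psum_pow)
    thus False using psum_fixed q0 by auto
  qed
qed

section \<open>Superficial sequences\<close>

context rmodule
begin

lemma mem_quot_filtration:
  assumes V: "sub V" and F: "sub (F n)" and x: "x \<in> carrier M"
  shows "V +>\<^bsub>M\<^esub> x \<in> quot_filtration M F V n \<longleftrightarrow> x \<in> F n <+>\<^bsub>M\<^esub> V"
proof
  note FV = submodule_sum[OF F V]
  assume "V +>\<^bsub>M\<^esub> x \<in> quot_filtration M F V n"
  then obtain y where y: "y \<in> F n <+>\<^bsub>M\<^esub> V" "V +>\<^bsub>M\<^esub> x = V +>\<^bsub>M\<^esub> y" by (auto simp: quot_filtration_def)
  have yc: "y \<in> carrier M" using submodule_mem_carrier[OF FV y(1)] .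
  have "x \<ominus>\<^bsub>M\<^esub> y \<in> V" using coset_eq_iff[OF V x yc] y by blast
  hence "x \<ominus>\<^bsub>M\<^esub> y \<in> F n <+>\<^bsub>M\<^esub> V" using sum_upper2[OF F V] by blast
  hence "(x \<ominus>\<^bsub>M\<^esub> y) \<oplus>\<^bsub>M\<^esub> y \<in> F n <+>\<^bsub>M\<^esub> V" using submodule_add[OF FV] y by blast
  thus "x \<in> F n <+>\<^bsub>M\<^esub> V" using x yc by (simp add: a_minus_def M.a_assoc M.l_neg)
qed (auto simp: quot_filtration_def)

text \<open>Rewrites the condition on \<open>M/V\<close> as one inside \<open>M\<close>, with
  \<open>F n + V\<close> for the terms of the filtration; everything that follows takes place in
  \<open>M\<close>.\<close>

lemma superficial_element_quotD:
  assumes V: "sub V" and F: "\<And>n. sub (F n)" and a: "a \<in> carrier R"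
    and sup: "superficial_element \<qq> (quot_module M V) (quot_filtration M F V) a"
  shows "\<exists>c. \<forall>n\<ge>c. \<forall>x\<in>carrier M.
    (a \<odot>\<^bsub>M\<^esub> x \<in> F (Suc n) <+>\<^bsub>M\<^esub> V \<and> x \<in> F c <+>\<^bsub>M\<^esub> V) = (x \<in> F n <+>\<^bsub>M\<^esub> V)"
proof -
  let ?Q = "quot_module M V" and ?G = "quot_filtration M F V"
  obtain c where c: "\<And>n. n \<ge> c \<Longrightarrow> colon_submodule ?Q (?G (Suc n)) a \<inter> ?G c = ?G n"
    using sup by (auto simp: superficial_element_def)
  show ?thesis
  proof (intro exI[of _ c] allI impI ballI)
    fix n x assume n: "n \<ge> c" and x: "x \<in> carrier M"
    have "V +>\<^bsub>M\<^esub> x \<in> colon_submodule ?Q (?G (Suc n)) a \<inter> ?G c \<longleftrightarrow> V +>\<^bsub>M\<^esub> x \<in> ?G n"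
      using c[OF n] by simp
    moreover have "V +>\<^bsub>M\<^esub> x \<in> carrier ?Q" using x by (auto simp: carrier_quot_module)
    ultimately show "(a \<odot>\<^bsub>M\<^esub> x \<in> F (Suc n) <+>\<^bsub>M\<^esub> V \<and> x \<in> F c <+>\<^bsub>M\<^esub> V) = (x \<in> F n <+>\<^bsub>M\<^esub> V)"
      using mem_quot_filtration[OF V F x] mem_quot_filtration[OF V F, of "a \<odot>\<^bsub>M\<^esub> x"] x a V
      by (simp add: colon_submodule_def)
  qed
qed

lemma nilpotent_filtration_quot_iff:
  assumes V: "sub V" and F: "\<And>n. sub (F n)"
  shows "nilpotent_filtration (quot_module M V) (quot_filtration M F V) \<longleftrightarrow> (\<exists>k. \<forall>n\<ge>k. F n \<subseteq> V)"
proof -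
  have "quot_filtration M F V n = {V} \<longleftrightarrow> F n \<subseteq> V" for n
  proof
    assume q: "quot_filtration M F V n = {V}"
    show "F n \<subseteq> V"
    proof
      fix x assume x: "x \<in> F n"
      hence "x \<in> F n <+>\<^bsub>M\<^esub> V" using sum_upper1[OF F V] by blast
      hence "V +>\<^bsub>M\<^esub> x = V" using q by (auto simp: quot_filtration_def)
      thus "x \<in> V" using coset_eq_self_iff[OF V submodule_mem_carrier[OF F x]] by blast
    qed
  next
    assume "F n \<subseteq> V"
    hence "F n <+>\<^bsub>M\<^esub> V = V" by (rule sum_absorb[OF F V])
    moreover have "V +>\<^bsub>M\<^esub> x = V" if "x \<in> V" for x
      using coset_eq_self_iff[OF V submodule_mem_carrier[OF V that]] that by blast
    ultimately show "quot_filtration M F V n = {V}"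
      using submodule_zero[OF V] unfolding quot_filtration_def by auto
  qed
  thus ?thesis by (simp add: nilpotent_filtration_def)
qed

end

section \<open>Superficial sequences, their length, and the inequality\<close>

locale superficial = filtered R M \<mm> \<qq> F for R :: "('a, 'k) ring_scheme" (structure)
    and M :: "('a, 'b) module" (structure) and \<mm> \<qq> F +
  fixes xs :: "'a list" and r :: nat
  assumes dim: "module_dim R M = enat r" and r: "r \<ge> 1"
    and max_sup: "maximal_superficial_sequence R \<qq> M F xs"
begin

definition L :: "nat \<Rightarrow> 'b set" where "L i = seq_submodule R M (take i xs)"

abbreviation t where "t \<equiv> length xs"

lemma t_pos: "t \<ge> 1"
  using max_sup by (cases xs) (auto simp: maximal_superficial_sequence_def)

lemma sup_element:
  "i < t \<Longrightarrow> superficial_element \<qq> (quot_module M (L i)) (quot_filtration M F (L i)) (xs ! i)"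
  using max_sup by (simp add: maximal_superficial_sequence_def superficial_sequence_def L_def)

lemma xs_q: "i < t \<Longrightarrow> xs ! i \<in> \<qq>"
  using sup_element by (simp add: superficial_element_def)

lemma xs_carrier: "i < t \<Longrightarrow> xs ! i \<in> carrier R"
  using xs_q q_carrier by blast

lemma set_xs: "set xs \<subseteq> \<qq>" "set xs \<subseteq> carrier R"
  using xs_q xs_carrier by (auto simp: set_conv_nth)

lemma L_sub: "sub (L i)"
  unfolding L_def by (rule submodule_seq_submodule[OF subset_trans[OF set_take_subset set_xs(2)]])

lemma L_0: "L 0 = {\<zero>\<^bsub>M\<^esub>}" by (simp add: L_def seq_submodule_Nil)

lemma L_t: "L t = ideal_smult R M (Idl (set xs)) (carrier M)" by (simp add: L_def seq_submodule_def)

lemma xM_sub: "i < t \<Longrightarrow> sub ((\<odot>\<^bsub>M\<^esub>) (xs ! i) ` carrier M)"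
  by (rule submodule_smult_image[OF carrier_is_submodule xs_carrier])

lemma L_Suc: "i < t \<Longrightarrow> L (Suc i) = L i <+>\<^bsub>M\<^esub> (\<odot>\<^bsub>M\<^esub>) (xs ! i) ` carrier M"
  using seq_submodule_snoc[OF subset_trans[OF set_take_subset set_xs(2)] xs_carrier]
  by (simp add: L_def take_Suc_conv_app_nth)

lemma L_mono_Suc: "i < t \<Longrightarrow> L i \<subseteq> L (Suc i)"
  using L_Suc sum_upper1[OF L_sub xM_sub] by simp

lemma xM_le_L: "i < t \<Longrightarrow> (\<odot>\<^bsub>M\<^esub>) (xs ! i) ` carrier M \<subseteq> L (Suc i)"
  using L_Suc sum_upper2[OF L_sub xM_sub] by simp

lemma L_le_F1: "i \<le> t \<Longrightarrow> L i \<subseteq> F 1"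
proof (induction i)
  case 0
  show ?case using submodule_zero[OF F_sub] by (simp add: L_0)
next
  case (Suc i)
  have "(\<odot>\<^bsub>M\<^esub>) (xs ! i) ` carrier M \<subseteq> F 1"
    using F_smult[of "xs ! i" _ 0] xs_q Suc.prems by (auto simp: F_0)
  thus ?case using Suc L_Suc[of i] sum_least[OF F_sub, of "L i" 1] by auto
qed

lemma nilpotent_L: "\<exists>k. \<forall>n\<ge>k. F n \<subseteq> L t"
  using max_sup nilpotent_filtration_quot_iff[where F=F, OF L_sub[of t] F_sub]
  by (simp add: maximal_superficial_sequence_def L_def)

lemma not_nilpotent_L: "\<not> (\<exists>k. \<forall>n\<ge>k. F n \<subseteq> L (t - 1))"
  using max_sup nilpotent_filtration_quot_iff[where F=F, OF L_sub[of "t - 1"] F_sub]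
  by (simp add: maximal_superficial_sequence_def L_def butlast_conv_take)

text \<open>The closure of \<open>L i\<close> in the topology of the filtration. Conditions imposed
  modulo all \<open>F n\<close> first yield statements about \<open>D i\<close>; passing to
  \<open>L i\<close> takes Nakayama's lemma.\<close>

definition D :: "nat \<Rightarrow> 'b set" where "D i = (\<Inter>n. F n <+>\<^bsub>M\<^esub> L i)"

lemma D_sub: "sub (D i)"
  unfolding D_def by (rule submodule_Inter) (use FL_sub[OF L_sub] in auto)

lemma L_le_D: "L i \<subseteq> D i"
  using L_le_FL[OF L_sub] by (auto simp: D_def)

lemma D_mono_Suc: "i < t \<Longrightarrow> D i \<subseteq> D (Suc i)"
  unfolding D_def by (intro INF_mono') (rule sum_mono[OF subset_refl L_mono_Suc])

lemma pow_mem_prime: "primeideal P R \<Longrightarrow> a \<in> carrier R \<Longrightarrow> a [^] (n::nat) \<in> P \<Longrightarrow> a \<in> P"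
proof (induction n)
  case 0
  thus ?case using ideal.one_imp_carrier[of P R] primeideal.I_notcarr[of P R]
    by (auto simp: primeideal_def)
next
  case (Suc n)
  thus ?case using primeideal.I_prime[of P R "a [^] n" a] by auto
qed

text \<open>Build the chain of primes from the top: \<open>\<mm>\<close> is at the top, and the prime at level \<open>i < t\<close>
  contains the scalars carrying \<open>F c + L i\<close> into \<open>D i\<close> but not \<open>xs ! i\<close>.  This avoids Krull's
  height theorem and Krull's intersection theorem.\<close>

lemma t_le_r: "t \<le> r"
proof -
  have "\<forall>i. \<exists>c. i < t \<longrightarrow> (\<forall>n\<ge>c. \<forall>x\<in>carrier M.
    (xs ! i \<odot>\<^bsub>M\<^esub> x \<in> F (Suc n) <+>\<^bsub>M\<^esub> L i \<and> x \<in> F c <+>\<^bsub>M\<^esub> L i) = (x \<in> F n <+>\<^bsub>M\<^esub> L i))"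
    using superficial_element_quotD[OF L_sub F_sub xs_carrier sup_element] by metis
  then obtain c where c: "\<And>i n x. i < t \<Longrightarrow> n \<ge> c i \<Longrightarrow> x \<in> carrier M \<Longrightarrow>
    (xs ! i \<odot>\<^bsub>M\<^esub> x \<in> F (Suc n) <+>\<^bsub>M\<^esub> L i \<and> x \<in> F (c i) <+>\<^bsub>M\<^esub> L i) = (x \<in> F n <+>\<^bsub>M\<^esub> L i)" by metis
  let ?C = "\<lambda>i. F (c i) <+>\<^bsub>M\<^esub> L i"
  have C: "sub (?C i)" for i by (rule FL_sub[OF L_sub])
  have Cc: "x \<in> carrier M" if "x \<in> ?C i" for x i using submodule_mem_carrier[OF C that] .
  \<comment> \<open>For \<open>n >= c i\<close> this is superficiality; for smaller \<open>n\<close>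
    it is clear, because \<open>F (c i) + L i\<close> lies in \<open>F n + L i\<close>.\<close>
  have Dsat: "x \<in> D i" if i: "i < t" and x: "x \<in> ?C i" "xs ! i \<odot>\<^bsub>M\<^esub> x \<in> D i" for i x
  proof -
    have "x \<in> F n <+>\<^bsub>M\<^esub> L i" for n
    proof (cases "n \<ge> c i")
      case True
      thus ?thesis using c[OF i True Cc[OF x(1)]] x unfolding D_def by blast
    next
      case False
      thus ?thesis using FL_antimono[of n "c i" "L i"] x by auto
    qed
    thus ?thesis unfolding D_def by blast
  qed
  let ?T = "\<lambda>i. {s \<in> carrier R. \<forall>x\<in>?C i. s \<odot>\<^bsub>M\<^esub> x \<in> D i}"
  let ?I = "\<lambda>i. if i < t then ?T i else \<mm>"
  have T: "ideal (?T i) R" for i by (rule ideal_transporter[OF D_sub submoduleE(1)[OF C]])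
  have "\<exists>p. chain_in {Q. primeideal Q R \<and> ?I 0 \<subseteq> Q} t p \<and> (0 < t \<longrightarrow> xs ! 0 \<notin> p 0)"
  proof (rule R.prime_chain[where a="\<lambda>i. xs ! i" and P="\<mm>" and I="?I"])
    fix i s assume i: "i < t" and s: "s \<in> carrier R" "s \<otimes> xs ! i \<in> ?I i"
    have "s \<odot>\<^bsub>M\<^esub> x \<in> D i" if x: "x \<in> ?C i" for x
    proof (rule Dsat[OF i submodule_smult[OF C s(1) x]])
      have "(s \<otimes> xs ! i) \<odot>\<^bsub>M\<^esub> x \<in> D i" using s(2) i x by simp
      thus "xs ! i \<odot>\<^bsub>M\<^esub> (s \<odot>\<^bsub>M\<^esub> x) \<in> D i"
        using s(1) xs_carrier[OF i] Cc[OF x] by (simp add: smult_assoc1[symmetric] R.m_comm)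
    qed
    thus "s \<in> ?I i" using s(1) i by simp
  next
    fix i P assume i: "i < t" and P: "primeideal P R" "?I (Suc i) \<subseteq> P"
      and a: "Suc i < t \<longrightarrow> xs ! Suc i \<notin> P"
    show "?I i \<subseteq> P \<and> xs ! i \<in> P"
    proof (cases "Suc i < t")
      case True
      have TP: "?T (Suc i) \<subseteq> P" using P True by simp
      have "xs ! i \<odot>\<^bsub>M\<^esub> x \<in> D (Suc i)" if "x \<in> ?C (Suc i)" for x
        using Cc[OF that] xM_le_L[OF i] L_le_D[of "Suc i"] by blast
      hence 1: "xs ! i \<in> P" using TP xs_carrier[OF i] by blast
      have "s \<in> P" if s: "s \<in> ?T i" for s
      proof -
        \<comment> \<open>The exponent \<open>c i\<close> brings \<open>M\<close> into
          \<open>F (c i)\<close>, where \<open>s\<close> is known to act into \<open>D i\<close>, so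
          \<open>s\<close> times this power acts into \<open>D (Suc i)\<close>. As the base avoids
          the prime \<open>P\<close>, membership of the product in \<open>P\<close> gives
          \<open>s \<in> P\<close>.\<close>
        let ?b = "(xs ! Suc i) [^] c i"
        have sc: "s \<in> carrier R" and bc: "?b \<in> carrier R" using s xs_carrier[OF True] by auto
        have "(s \<otimes> ?b) \<odot>\<^bsub>M\<^esub> x \<in> D (Suc i)" if x: "x \<in> ?C (Suc i)" for x
        proof -
          have "?b \<odot>\<^bsub>M\<^esub> x \<in> ?C i"
            using F_pow[OF xs_q[OF True] Cc[OF x], of "c i"] F_le_FL[OF L_sub] by blast
          hence "s \<odot>\<^bsub>M\<^esub> (?b \<odot>\<^bsub>M\<^esub> x) \<in> D i" using s by simp
          thus ?thesis using D_mono_Suc[OF i] sc bc Cc[OF x] by (auto simp: smult_assoc1)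
        qed
        hence "s \<otimes> ?b \<in> P" using TP sc bc by blast
        hence "s \<in> P \<or> ?b \<in> P" using primeideal.I_prime[OF P(1) sc bc] by simp
        thus "s \<in> P" using pow_mem_prime[OF P(1) xs_carrier[OF True]] a True by blast
      qed
      thus ?thesis using 1 i by auto
    next
      case False
      hence it: "i = t - 1" and mP: "\<mm> \<subseteq> P" using i P by auto
      \<comment> \<open>A unit here would put \<open>F (c i) + L i\<close> into \<open>D i\<close>.
        Then \<open>F n \<subseteq> F (Suc n) + L i = \<qq> F n + L i\<close> for large
        \<open>n\<close>, and Nakayama's lemma makes the filtration nilpotent modulo
        \<open>L (t - 1)\<close>, against maximality of the sequence.\<close>
      have "?T i \<subseteq> \<mm>"
      proof
        fix s assume s: "s \<in> ?T i"
        show "s \<in> \<mm>"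
        proof (rule ccontr)
          assume "s \<notin> \<mm>"
          hence u: "s \<in> Units R" using local_ring_unit[OF loc] s by auto
          have CD: "x \<in> D i" if x: "x \<in> ?C i" for x
          proof -
            have "inv s \<odot>\<^bsub>M\<^esub> (s \<odot>\<^bsub>M\<^esub> x) \<in> D i"
              by (rule submodule_smult[OF D_sub]) (use s x u in auto)
            moreover have "inv s \<odot>\<^bsub>M\<^esub> (s \<odot>\<^bsub>M\<^esub> x) = x"
              using u s Cc[OF x] by (simp add: smult_assoc1[symmetric])
            ultimately show ?thesis by (simp only:)
          qed
          obtain k where k: "\<And>n. n \<ge> k \<Longrightarrow> F (Suc n) = ideal_smult R M \<qq> (F n)" using F_stable by blast
          have "F n \<subseteq> L i" if n: "n \<ge> max k (c i)" for n
          proof (rule nakayama_q[OF F_sub L_sub])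
            have "F n \<subseteq> ?C i" using F_antimono[of "c i" n] F_le_FL[OF L_sub, of "c i" i] n by auto
            hence "F n \<subseteq> F (Suc n) <+>\<^bsub>M\<^esub> L i" using CD unfolding D_def by blast
            thus "F n \<subseteq> ideal_smult R M \<qq> (F n) <+>\<^bsub>M\<^esub> L i" using k[of n] n by simp
          qed
          thus False using not_nilpotent_L unfolding it by blast
        qed
      qed
      thus ?thesis using mP xs_q[OF i] q_subset_m i by auto
    qed
  qed (use T m_ideal xs_carrier R.maximalideal_prime[OF m_maximal] in auto)
  then obtain p where p: "chain_in {Q. primeideal Q R \<and> ?I 0 \<subseteq> Q} t p" by blast
  have "annihilator R M \<subseteq> ?I 0"
    using t_pos submodule_zero[OF D_sub] Cc by (auto simp: annihilator_def)
  hence "{Q. primeideal Q R \<and> ?I 0 \<subseteq> Q} \<subseteq> {Q. primeideal Q R \<and> annihilator R M \<subseteq> Q}" by blast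
  hence "enat t \<le> height {Q. primeideal Q R \<and> annihilator R M \<subseteq> Q}"
    using height_mono height_geI[OF p] by (metis (no_types, lifting) order_trans)
  thus "t \<le> r" using dim by (simp add: module_dim_height)
qed

text \<open>The coefficients of the numerator, with \<open>L t\<close> in the role of JM.\<close>

definition bound :: "nat \<Rightarrow> real" where
  "bound n = (if n = 0 then nlen (F 1) (carrier M) else if n = 1 then nlen (L t) (F 1) else 0)"

lemma hilb_step: "i < t \<Longrightarrow> hilb (L i) n + nlen (F n <+>\<^bsub>M\<^esub> L i) (colon (L i) (xs ! i) n) =
    (\<Sum>j\<le>n. hilb (L (Suc i)) j)"
  using hilb_colon[OF L_sub xs_q] L_Suc by simp

lemma nlen_L_add: "nlen (L t) (carrier M) = nlen (L t) (F 1) + nlen (F 1) (carrier M)"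
proof -
  obtain n where "F n \<subseteq> L t" using nilpotent_L by blast
  thus ?thesis by (intro nlen_add[OF L_sub F_sub carrier_is_submodule L_le_F1 F_carrier]) auto
qed

text \<open>JM lies in \<open>\<qq> M\<close>, so equality with the nonzero module \<open>M\<close>
  is excluded by Nakayama's lemma.\<close>

lemma L_t_proper: "L t \<noteq> carrier M"
proof
  assume L: "L t = carrier M"
  have "carrier M \<subseteq> ideal_smult R M \<qq> (carrier M)"
  proof -
    have "Idl (set xs) \<subseteq> \<qq>" by (rule R.genideal_minimal[OF q_ideal set_xs(1)])
    thus ?thesis using L ideal_smult_mono unfolding L_t by blast
  qed
  also have "\<dots> \<subseteq> ideal_smult R M \<qq> (carrier M) <+>\<^bsub>M\<^esub> {\<zero>\<^bsub>M\<^esub>}"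
    by (intro sum_upper1 submodule_ideal_smult submodule_zero_set q_carrier) auto
  finally have "carrier M \<subseteq> {\<zero>\<^bsub>M\<^esub>}" by (rule nakayama_q[OF carrier_is_submodule submodule_zero_set])
  thus False using nonzero by auto
qed

text \<open>The two coefficients add up to lambda(M/JM), which is positive. This rules out the
  degenerate case in deriving \<open>t = r\<close>.\<close>

lemma bound_nonzero: "bound \<noteq> (\<lambda>_. 0)"
proof
  assume "bound = (\<lambda>_. 0)"
  hence "bound 0 = 0" "bound 1 = 0" by simp_all
  hence "nlen (L t) (carrier M) = 0" using nlen_L_add by (simp add: bound_def)
  moreover obtain n where "F n \<subseteq> L t" using nilpotent_L by blast
  ultimately have "L t = carrier M"
    using nlen_eq_0D[OF L_sub carrier_is_submodule submoduleE(1)[OF L_sub]] by blast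
  thus False using L_t_proper by simp
qed

text \<open>The first part drops the colon term from the exact formula. The second compares
  lambda(M/(F_{n+1} + JM)) with partial sums of the numerator.\<close>

lemma hilb_bounds:
  "i < t \<Longrightarrow> (\<lambda>n. real (hilb (L i) n)) \<le> psum (\<lambda>n. real (hilb (L (Suc i)) n))"
  "psum (\<lambda>n. real (hilb (L t) n)) \<le> psum bound" "(\<lambda>_. 0) \<le> bound"
proof -
  show "(\<lambda>n. real (hilb (L i) n)) \<le> psum (\<lambda>n. real (hilb (L (Suc i)) n))" if "i < t"
    unfolding le_fun_def psum_def of_nat_sum[symmetric] using hilb_step[OF that]
    by (metis le_add1 of_nat_mono)
  show "(\<lambda>_. 0) \<le> bound" by (simp add: le_fun_def bound_def)
  show "psum (\<lambda>n. real (hilb (L t) n)) \<le> psum bound"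
  proof (rule le_funI)
    fix n
    have l: "psum (\<lambda>n. real (hilb (L t) n)) n = real (nlen (F (Suc n) <+>\<^bsub>M\<^esub> L t) (carrier M))"
      unfolding psum_def of_nat_sum[symmetric] sum_hilb[OF L_sub] ..
    show "psum (\<lambda>n. real (hilb (L t) n)) n \<le> psum bound n"
    proof (cases n)
      case 0
      have "F 1 <+>\<^bsub>M\<^esub> L t = F 1"
        using F_le_FL[OF L_sub, of 1 t] sum_least[OF F_sub subset_refl L_le_F1[OF order_refl]] by blast
      thus ?thesis using l 0 by (simp add: psum_def bound_def)
    next
      case (Suc m)
      \<comment> \<open>From \<open>n = 1\<close> on, both nonzero coefficients are included and the
        sum is lambda(M/JM).\<close>
      have "psum bound n = (\<Sum>i\<in>{0,1}. bound i)"
        unfolding psum_def by (rule sum.mono_neutral_right) (auto simp: Suc bound_def)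
      also have "\<dots> = real (nlen (L t) (carrier M))" by (simp add: bound_def nlen_L_add)
      finally have b: "psum bound n = real (nlen (L t) (carrier M))" .
      obtain k where k: "F k \<subseteq> L t" using nilpotent_L by blast
      have "nlen (L t) (carrier M) = nlen (L t) (F (Suc n) <+>\<^bsub>M\<^esub> L t) +
          nlen (F (Suc n) <+>\<^bsub>M\<^esub> L t) (carrier M)"
        by (rule nlen_add[OF L_sub FL_sub[OF L_sub] carrier_is_submodule L_le_FL[OF L_sub]
          submoduleE(1)[OF FL_sub[OF L_sub]] k])
      thus ?thesis using l b by simp
    qed
  qed
qed

lemma hilb_le: "(\<lambda>n. real (hilb (L 0) n)) \<le> (psum ^^ r) bound"
  by (rule psum_chain(1)[where H="\<lambda>i n. real (hilb (L i) n)", OF hilb_bounds t_pos t_le_r])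

end

section \<open>The case of equality: consequences for M\<close>

locale superficial_eq = superficial +
  assumes eq: "(\<lambda>n. real (hilb (L 0) n)) = (psum ^^ r) bound"
begin

lemma t_eq_r: "t = r"
  by (rule psum_chain(3)[where H="\<lambda>i n. real (hilb (L i) n)",
    OF hilb_bounds t_pos t_le_r eq bound_nonzero])

text \<open>Equality of the Hilbert function with the summed one leaves length zero for the quotient
  in \<open>hilb_step\<close>. In contrast to superficiality, this holds for all \<open>n\<close>
  and with no restriction to some \<open>F c\<close>.\<close>

lemma colon_eq: assumes i: "i < t" shows "colon (L i) (xs ! i) n = F n <+>\<^bsub>M\<^esub> L i"
proof -
  have "(\<lambda>n. real (hilb (L i) n)) = psum (\<lambda>n. real (hilb (L (Suc i)) n))"
    by (rule psum_chain(2)[where H="\<lambda>i n. real (hilb (L i) n)",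
      OF hilb_bounds t_pos t_le_r eq i])
  hence "real (hilb (L i) n) = real (\<Sum>j\<le>n. hilb (L (Suc i)) j)"
    unfolding psum_def of_nat_sum[symmetric] by (rule fun_cong)
  hence "nlen (F n <+>\<^bsub>M\<^esub> L i) (colon (L i) (xs ! i) n) = 0" using hilb_step[OF i, of n] by linarith
  thus ?thesis
    using nlen_eq_0D[OF FL_sub[OF L_sub] submodule_colon[OF L_sub xs_q[OF i]]
      FL_le_colon[OF L_sub xs_q[OF i]] F_le_FL[OF L_sub]] by auto
qed

lemma colonD:
  assumes "i < t" "x \<in> carrier M" "xs ! i \<odot>\<^bsub>M\<^esub> x \<in> F (Suc n) <+>\<^bsub>M\<^esub> L i"
  shows "x \<in> F n <+>\<^bsub>M\<^esub> L i"
  using colon_eq[OF assms(1), of n] assms by (auto simp: colon_def)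

text \<open>Descending induction from \<open>F k \<subseteq> L t\<close>. An element of
  \<open>D i\<close> lies in \<open>D (Suc i) = L (Suc i)\<close>, so it is \<open>l + a x\<close>
  with \<open>a = xs ! i\<close> and \<open>l\<close> in \<open>L i\<close>; then \<open>a x\<close>
  is in \<open>D i\<close>, the colon equality for all \<open>n\<close> gives
  \<open>x \<in> D i\<close>, and so \<open>D i \<subseteq> \<qq> (D i) + L i\<close>.\<close>

lemma D_eq_L: "i \<le> t \<Longrightarrow> D i = L i"
proof (induction "t - i" arbitrary: i)
  case 0
  hence [simp]: "i = t" by simp
  obtain k where "F k \<subseteq> L t" using nilpotent_L by blast
  hence "F k <+>\<^bsub>M\<^esub> L t = L t" by (rule sum_absorb[OF F_sub L_sub])
  thus ?case using L_le_D[of t] unfolding D_def by auto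
next
  case (Suc m)
  hence i: "i < t" and IH: "D (Suc i) = L (Suc i)" by auto
  have ac: "xs ! i \<in> carrier R" by (rule xs_carrier[OF i])
  have "D i \<subseteq> ideal_smult R M \<qq> (D i) <+>\<^bsub>M\<^esub> L i"
  proof
    fix d assume d: "d \<in> D i"
    hence "d \<in> L (Suc i)" using D_mono_Suc[OF i] IH by auto
    then obtain l x where x: "l \<in> L i" "x \<in> carrier M" "d = l \<oplus>\<^bsub>M\<^esub> xs ! i \<odot>\<^bsub>M\<^esub> x"
      unfolding L_Suc[OF i] by (auto simp: mem_sum_iff)
    have "xs ! i \<odot>\<^bsub>M\<^esub> x \<in> D i"
      using submodule_add_iff[OF D_sub, of l i] x d L_le_D ac by blast
    hence "x \<in> D i" using colonD[OF i x(2)] unfolding D_def by blast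
    hence "xs ! i \<odot>\<^bsub>M\<^esub> x \<in> ideal_smult R M \<qq> (D i)"
      by (intro mem_ideal_smult q_carrier submoduleE(1)[OF D_sub] xs_q i)
    moreover have "d = xs ! i \<odot>\<^bsub>M\<^esub> x \<oplus>\<^bsub>M\<^esub> l"
      using x ac submodule_mem_carrier[OF L_sub x(1)] by (simp add: M.a_comm)
    ultimately show "d \<in> ideal_smult R M \<qq> (D i) <+>\<^bsub>M\<^esub> L i" using x(1) unfolding mem_sum_iff by blast
  qed
  hence "D i \<subseteq> L i" by (rule nakayama_q[OF D_sub L_sub])
  thus ?case using L_le_D by auto
qed

text \<open>If \<open>a x\<close> is in \<open>L i\<close>, the colon equalities place
  \<open>x\<close> in every \<open>F n + L i\<close>, that is in \<open>D i = L i\<close>.\<close>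

lemma regular_M: "regular_sequence R M xs"
  unfolding regular_sequence_def
proof (intro conjI allI impI)
  show "seq_submodule R M xs \<noteq> carrier M" using L_t_proper by (simp add: L_def)
  fix i assume i: "i < t"
  have "x \<in> L i" if "x \<in> carrier M" "xs ! i \<odot>\<^bsub>M\<^esub> x \<in> L i" for x
  proof -
    have "x \<in> F n <+>\<^bsub>M\<^esub> L i" for n
      by (rule colonD[OF i that(1)]) (use that(2) L_le_FL[OF L_sub] in blast)
    hence "x \<in> D i" unfolding D_def by blast
    thus ?thesis using D_eq_L[of i] i by simp
  qed
  thus "nonzerodivisor_on (quot_module M (seq_submodule R M (take i xs))) (xs ! i)"
    using nonzerodivisor_quot_iff[OF L_sub xs_carrier[OF i]] by (simp add: L_def)
qed (rule set_xs)

lemma cohen_macaulay_M: "cohen_macaulay R \<mm> M"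
  unfolding cohen_macaulay_def
proof (rule antisym[OF depth_le_dim])
  have "enat t \<le> depth R \<mm> M"
    unfolding depth_def by (rule Sup_upper) (use regular_M set_xs(1) q_subset_m in blast)
  thus "module_dim R M \<le> depth R \<mm> M" using dim t_eq_r by simp
qed

text \<open>The Valabrega--Valla condition \<open>L i \<inter> F (n+1) = (x\<^sub>1, \<dots>, x\<^sub>i) F n\<close>.\<close>

lemma L_Int_F: "i \<le> t \<Longrightarrow> x \<in> L i \<Longrightarrow> x \<in> F (Suc n) \<Longrightarrow>
  x \<in> ideal_smult R M (Idl (set (take i xs))) (F n)"
proof (induction i arbitrary: x)
  case 0
  thus ?case using submodule_zero[OF submodule_ideal_smult[OF _ F_carrier]]
    by (simp add: L_0 genideal_empty)
next
  case (Suc i)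
  let ?J = "\<lambda>i. ideal_smult R M (Idl (set (take i xs))) (F n)"
  have i: "i < t" using Suc by simp
  have ac: "xs ! i \<in> carrier R" by (rule xs_carrier[OF i])
  have tk: "set (take j xs) \<subseteq> carrier R" for j using set_take_subset set_xs(2) by (rule subset_trans)
  have idl: "Idl (set (take j xs)) \<subseteq> carrier R" for j
    using ideal.Icarr[OF R.genideal_ideal[OF tk]] by blast
  have JL: "sub (?J j)" for j by (rule submodule_ideal_smult[OF idl F_carrier])
  obtain y m where y: "y \<in> L i" "m \<in> carrier M" "x = y \<oplus>\<^bsub>M\<^esub> xs ! i \<odot>\<^bsub>M\<^esub> m"
    using Suc.prems(2) unfolding L_Suc[OF i] by (auto simp: mem_sum_iff)
  have yc: "y \<in> carrier M" and xc: "x \<in> carrier M"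
    using y submodule_mem_carrier[OF L_sub] submodule_mem_carrier[OF F_sub] Suc.prems by auto
  have "xs ! i \<odot>\<^bsub>M\<^esub> m = x \<oplus>\<^bsub>M\<^esub> \<ominus>\<^bsub>M\<^esub> y"
    using y yc ac by (simp add: M.a_comm[of y] M.a_assoc M.r_neg)
  hence "xs ! i \<odot>\<^bsub>M\<^esub> m \<in> F (Suc n) <+>\<^bsub>M\<^esub> L i"
    using Suc.prems(3) submodule_neg[OF L_sub y(1)] unfolding mem_sum_iff by blast
  hence "m \<in> F n <+>\<^bsub>M\<^esub> L i" by (rule colonD[OF i y(2)])
  then obtain m' u where m: "m' \<in> F n" "u \<in> L i" "m = m' \<oplus>\<^bsub>M\<^esub> u" by (auto simp: mem_sum_iff)
  have m'c: "m' \<in> carrier M" and uc: "u \<in> carrier M"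
    using m submodule_mem_carrier[OF L_sub] F_carrier by auto
  \<comment> \<open>Replacing \<open>m\<close> by its part \<open>m'\<close> in \<open>F n\<close>
    moves the error into \<open>L i\<close>. The remainder \<open>?z\<close> is then in
    \<open>L i\<close> and in \<open>F (Suc n)\<close>, as the induction hypothesis
    requires.\<close>
  let ?z = "y \<oplus>\<^bsub>M\<^esub> xs ! i \<odot>\<^bsub>M\<^esub> u" and ?w = "xs ! i \<odot>\<^bsub>M\<^esub> m'"
  have xzw: "x = ?w \<oplus>\<^bsub>M\<^esub> ?z" using y m yc m'c uc ac by (simp add: smult_r_distr M.a_ac)
  have zL: "?z \<in> L i" using y m submodule_add[OF L_sub] submodule_smult[OF L_sub ac] by blast
  have zc: "?z \<in> carrier M" using submodule_mem_carrier[OF L_sub zL] .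
  have wF: "?w \<in> F (Suc n)" by (rule F_smult[OF xs_q[OF i] m(1)])
  have "?z \<in> F (Suc n)" using submodule_add_iff[OF F_sub wF zc] Suc.prems(3) xzw by blast
  hence zJ: "?z \<in> ?J i" using Suc.IH[OF _ zL] i by simp
  have e: "?J (Suc i) = ?J i <+>\<^bsub>M\<^esub> (\<odot>\<^bsub>M\<^esub>) (xs ! i) ` F n"
    using ideal_smult_insert[OF ac tk F_sub] i by (simp add: take_Suc_conv_app_nth)
  have "x = ?z \<oplus>\<^bsub>M\<^esub> ?w" unfolding xzw using zc m'c ac by (simp add: M.a_comm)
  thus ?case unfolding e using zJ m(1) unfolding mem_sum_iff by blast
qed

end

section \<open>Associated graded rings and modules\<close>

lemma self_module_simps [simp]:
  "carrier (self_module R) = carrier R" "zero (self_module R) = zero R"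
  "add (self_module R) = add R" "smult (self_module R) = monoid.mult R"
  by (simp_all add: self_module_def)

lemma finsum_self_module: "finsum (self_module R) f S = finsum R f S"
  by (simp add: finsum_def finprod_def)

lemma coset_self_module: "I +>\<^bsub>self_module R\<^esub> x = I +>\<^bsub>R\<^esub> x"
  by (simp add: a_r_coset_def')

lemma (in cring) self_module_is_module: "rmodule R (self_module R)"
proof (rule rmoduleI, rule moduleI)
  show "abelian_group (self_module R)"
  proof (rule abelian_groupI)
    fix x assume "x \<in> carrier (self_module R)"
    thus "\<exists>y\<in>carrier (self_module R). y \<oplus>\<^bsub>self_module R\<^esub> x = \<zero>\<^bsub>self_module R\<^esub>"
      using l_neg by auto
  qed (auto simp: a_ac)
qed (auto simp: is_cring l_distr r_distr m_assoc)

lemma (in cring) submodule_self_module_iff: "submodule I R (self_module R) \<longleftrightarrow> ideal I R"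
proof
  interpret S: rmodule R "self_module R" by (rule self_module_is_module)
  {
    assume I: "submodule I R (self_module R)"
    have c: "x \<in> carrier R" if "x \<in> I" for x using S.submodule_mem_carrier[OF I that] by simp
    have l: "x \<otimes> a \<in> I" if "a \<in> I" "x \<in> carrier R" for a x
      using S.submodule_smult[OF I that(2,1)] by simp
    have "\<ominus> x \<in> I" if "x \<in> I" for x
      using l[OF that, of "\<ominus> \<one>"] c[OF that] by (simp add: l_minus)
    hence "subgroup I (add_monoid R)"
      using S.submodule_add[OF I] S.submodule_zero[OF I] c by (intro subgroup.intro) (auto simp flip: a_inv_def)
    thus "ideal I R" by (rule idealI[OF ring_axioms]) (use l c m_comm in auto)
  }
  assume I: "ideal I R"
  interpret I: ideal I R by fact
  have "\<ominus>\<^bsub>self_module R\<^esub> x = \<ominus> x" if "x \<in> I" for x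
    using that I.Icarr by (intro S.M.minus_equality) (auto simp: l_neg)
  thus "submodule I R (self_module R)"
    by (intro S.submoduleI) (use I.Icarr I.I_l_closed in auto)
qed

text \<open>Elements of the associated graded module are represented by finitely supported sequences
  \<open>x\<close> with \<open>x n \<in> F n\<close>; the product then becomes the Cauchy product \<open>conv\<close>.\<close>

definition cls :: "('a, 'b) module \<Rightarrow> (nat \<Rightarrow> 'b set) \<Rightarrow> (nat \<Rightarrow> 'b) \<Rightarrow> nat \<Rightarrow> 'b set" where
  "cls M F x n = F (Suc n) +>\<^bsub>M\<^esub> x n"

definition fin_seqs :: "('a, 'b) module \<Rightarrow> (nat \<Rightarrow> 'b set) \<Rightarrow> (nat \<Rightarrow> 'b) set" where
  "fin_seqs M F = {x. (\<forall>n. x n \<in> F n) \<and> (\<exists>N. \<forall>n>N. x n = \<zero>\<^bsub>M\<^esub>)}"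

definition conv :: "('a, 'b) module \<Rightarrow> (nat \<Rightarrow> 'a) \<Rightarrow> (nat \<Rightarrow> 'b) \<Rightarrow> nat \<Rightarrow> 'b" where
  "conv M a x n = (\<Oplus>\<^bsub>M\<^esub>i\<in>{..n}. a i \<odot>\<^bsub>M\<^esub> x (n - i))"

definition single :: "('a, 'b) module \<Rightarrow> nat \<Rightarrow> 'b \<Rightarrow> nat \<Rightarrow> 'b" where
  "single M j x n = (if n = j then x else \<zero>\<^bsub>M\<^esub>)"

text \<open>Formed from an arbitrary filtration \<open>Q\<close>, with the unit written as the class
  of a sequence; \<open>gr_ring_eq\<close> recovers the associated graded ring of an ideal.\<close>

definition assoc_ring :: "('a, 'k) ring_scheme \<Rightarrow> (nat \<Rightarrow> 'a set) \<Rightarrow> (nat \<Rightarrow> 'a set) ring" where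
  "assoc_ring R Q =
     \<lparr>carrier = gr_carrier (self_module R) Q,
      monoid.mult = gr_smult (self_module R) Q,
      monoid.one = cls (self_module R) Q (single (self_module R) 0 \<one>\<^bsub>R\<^esub>),
      zero = gr_zero (self_module R) Q,
      add = gr_add (self_module R) Q\<rparr>"

context rmodule
begin

lemma finsum_submodule:
  assumes N: "sub N" and f: "\<And>i. i \<in> I \<Longrightarrow> f i \<in> N"
  shows "finsum M f I \<in> N"
proof (cases "finite I")
  case True
  thus ?thesis using f
  proof (induction I rule: finite_induct)
    case (insert i I)
    thus ?case using submodule_add[OF N] submodule_mem_carrier[OF N] by (subst M.finsum_insert) auto
  qed (simp add: submodule_zero[OF N])
next
  case False
  thus ?thesis by (simp add: submodule_zero[OF N])
qed

lemma finsum_smult_rdistr: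
  assumes "finite I" "x \<in> carrier M" "\<And>i. i \<in> I \<Longrightarrow> f i \<in> carrier R"
  shows "(\<Oplus>\<^bsub>R\<^esub>i\<in>I. f i) \<odot>\<^bsub>M\<^esub> x = (\<Oplus>\<^bsub>M\<^esub>i\<in>I. f i \<odot>\<^bsub>M\<^esub> x)"
  using assms
proof (induction I rule: finite_induct)
  case (insert i I)
  thus ?case by (simp add: R.finsum_insert M.finsum_insert Pi_def smult_l_distr)
qed simp

lemma conv_add_left:
  assumes "\<And>i. a i \<in> carrier R" "\<And>i. b i \<in> carrier R" "\<And>i. x i \<in> carrier M"
  shows "conv M (\<lambda>i. a i \<oplus> b i) x n = conv M a x n \<oplus>\<^bsub>M\<^esub> conv M b x n"
  unfolding conv_def using assms by (simp add: smult_l_distr M.finsum_addf Pi_def)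

lemma conv_add_right:
  assumes "\<And>i. a i \<in> carrier R" "\<And>i. y i \<in> carrier M" "\<And>i. x i \<in> carrier M"
  shows "conv M a (\<lambda>i. x i \<oplus>\<^bsub>M\<^esub> y i) n = conv M a x n \<oplus>\<^bsub>M\<^esub> conv M a y n"
  unfolding conv_def using assms by (simp add: smult_r_distr M.finsum_addf Pi_def)

lemma conv_single_left:
  assumes a: "a \<in> carrier R" and x: "\<And>i. x i \<in> carrier M"
  shows "conv M (single (self_module R) j a) x n = (if j \<le> n then a \<odot>\<^bsub>M\<^esub> x (n - j) else \<zero>\<^bsub>M\<^esub>)"
proof (cases "j \<le> n")
  case True
  have "conv M (single (self_module R) j a) x n =
    (\<Oplus>\<^bsub>M\<^esub>i\<in>{..n}. if j = i then a \<odot>\<^bsub>M\<^esub> x (n - i) else \<zero>\<^bsub>M\<^esub>)"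
    unfolding conv_def by (rule M.finsum_cong') (use a x in \<open>auto simp: single_def\<close>)
  also have "\<dots> = a \<odot>\<^bsub>M\<^esub> x (n - j)"
    by (rule M.finsum_singleton) (use True a x in auto)
  finally show ?thesis using True by simp
next
  case False
  have "conv M (single (self_module R) j a) x n = (\<Oplus>\<^bsub>M\<^esub>i\<in>{..n}. \<zero>\<^bsub>M\<^esub>)"
    unfolding conv_def by (rule M.finsum_cong') (use False x in \<open>auto simp: single_def\<close>)
  thus ?thesis using False by (simp add: M.finsum_zero)
qed

lemma conv_assoc:
  assumes a: "\<And>i. a i \<in> carrier R" and b: "\<And>i. b i \<in> carrier R" and x: "\<And>i. x i \<in> carrier M"
  shows "conv M (conv (self_module R) a b) x n = conv M a (conv M b x) n"
proof -
  \<comment> \<open>Both sides run over the triangle of index pairs with total at most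
    \<open>k\<close>. Keeping \<open>k\<close> apart from the degree \<open>n\<close> lets the
    induction enlarge the triangle by one diagonal.\<close>
  have "k \<le> n \<Longrightarrow>
    (\<Oplus>\<^bsub>M\<^esub>j\<in>{..k}. (\<Oplus>\<^bsub>R\<^esub>i\<in>{..j}. a i \<otimes> b (j - i)) \<odot>\<^bsub>M\<^esub> x (n - j)) =
    (\<Oplus>\<^bsub>M\<^esub>j\<in>{..k}. a j \<odot>\<^bsub>M\<^esub> (\<Oplus>\<^bsub>M\<^esub>i\<in>{..k-j}. b i \<odot>\<^bsub>M\<^esub> x (n - j - i)))" for k
  proof (induction k)
    case 0
    show ?case using assms by (simp add: smult_assoc1 Pi_def)
  next
    case (Suc k)
    \<comment> \<open>This splits off the contribution of the new diagonal, total
      \<open>Suc k\<close>, from the \<open>j\<close>-th inner sum.\<close>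
    have e: "(\<Oplus>\<^bsub>M\<^esub>i\<in>{..Suc k - j}. b i \<odot>\<^bsub>M\<^esub> x (n - j - i)) =
      b (Suc k - j) \<odot>\<^bsub>M\<^esub> x (n - Suc k) \<oplus>\<^bsub>M\<^esub> (\<Oplus>\<^bsub>M\<^esub>i\<in>{..k - j}. b i \<odot>\<^bsub>M\<^esub> x (n - j - i))"
      if "j \<le> k" for j
      using that assms by (simp add: Suc_diff_le M.finsum_Suc Pi_def)
    have c1: "(\<Oplus>\<^bsub>M\<^esub>i\<in>I. b i \<odot>\<^bsub>M\<^esub> x (g i)) \<in> carrier M" for I g
      by (rule M.finsum_closed) (use assms in auto)
    have c2: "(\<Oplus>\<^bsub>R\<^esub>i\<in>I. a i \<otimes> b (g i)) \<in> carrier R" for I g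
      by (rule R.finsum_closed) (use assms in auto)
    let ?X = "\<Oplus>\<^bsub>M\<^esub>j\<in>{..k}. a j \<odot>\<^bsub>M\<^esub> (\<Oplus>\<^bsub>M\<^esub>i\<in>{..k-j}. b i \<odot>\<^bsub>M\<^esub> x (n - j - i))"
    let ?Y = "\<Oplus>\<^bsub>M\<^esub>j\<in>{..k}. (a j \<otimes> b (Suc k - j)) \<odot>\<^bsub>M\<^esub> x (n - Suc k)"
    let ?z = "(a (Suc k) \<otimes> b 0) \<odot>\<^bsub>M\<^esub> x (n - Suc k)"
    have X: "?X \<in> carrier M" by (rule M.finsum_closed) (use a c1 in auto)
    have Y: "?Y \<in> carrier M" by (rule M.finsum_closed) (use assms in auto)
    have z: "?z \<in> carrier M" using assms by auto
    have "(\<Oplus>\<^bsub>M\<^esub>j\<in>{..Suc k}. (\<Oplus>\<^bsub>R\<^esub>i\<in>{..j}. a i \<otimes> b (j - i)) \<odot>\<^bsub>M\<^esub> x (n - j)) =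
      (\<Oplus>\<^bsub>R\<^esub>i\<in>{..Suc k}. a i \<otimes> b (Suc k - i)) \<odot>\<^bsub>M\<^esub> x (n - Suc k) \<oplus>\<^bsub>M\<^esub> ?X"
      using Suc by (subst M.finsum_Suc) (use c2 x in \<open>auto simp: Pi_def\<close>)
    also have "(\<Oplus>\<^bsub>R\<^esub>i\<in>{..Suc k}. a i \<otimes> b (Suc k - i)) \<odot>\<^bsub>M\<^esub> x (n - Suc k) =
      (\<Oplus>\<^bsub>M\<^esub>i\<in>{..Suc k}. (a i \<otimes> b (Suc k - i)) \<odot>\<^bsub>M\<^esub> x (n - Suc k))"
      by (rule finsum_smult_rdistr) (use assms in auto)
    also have "\<dots> = ?z \<oplus>\<^bsub>M\<^esub> ?Y"
      by (subst M.finsum_Suc) (use assms in auto)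
    finally have l: "(\<Oplus>\<^bsub>M\<^esub>j\<in>{..Suc k}. (\<Oplus>\<^bsub>R\<^esub>i\<in>{..j}. a i \<otimes> b (j - i)) \<odot>\<^bsub>M\<^esub> x (n - j)) =
      ?z \<oplus>\<^bsub>M\<^esub> ?Y \<oplus>\<^bsub>M\<^esub> ?X" .
    have "(\<Oplus>\<^bsub>M\<^esub>j\<in>{..Suc k}. a j \<odot>\<^bsub>M\<^esub> (\<Oplus>\<^bsub>M\<^esub>i\<in>{..Suc k-j}. b i \<odot>\<^bsub>M\<^esub> x (n - j - i))) =
      ?z \<oplus>\<^bsub>M\<^esub> (\<Oplus>\<^bsub>M\<^esub>j\<in>{..k}. a j \<odot>\<^bsub>M\<^esub> (\<Oplus>\<^bsub>M\<^esub>i\<in>{..Suc k-j}. b i \<odot>\<^bsub>M\<^esub> x (n - j - i)))"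
      by (subst M.finsum_Suc) (use assms c1 in \<open>auto simp: smult_assoc1 Pi_def\<close>)
    also have "(\<Oplus>\<^bsub>M\<^esub>j\<in>{..k}. a j \<odot>\<^bsub>M\<^esub> (\<Oplus>\<^bsub>M\<^esub>i\<in>{..Suc k-j}. b i \<odot>\<^bsub>M\<^esub> x (n - j - i))) =
      (\<Oplus>\<^bsub>M\<^esub>j\<in>{..k}. (a j \<otimes> b (Suc k - j)) \<odot>\<^bsub>M\<^esub> x (n - Suc k) \<oplus>\<^bsub>M\<^esub>
        a j \<odot>\<^bsub>M\<^esub> (\<Oplus>\<^bsub>M\<^esub>i\<in>{..k-j}. b i \<odot>\<^bsub>M\<^esub> x (n - j - i)))"
    proof (rule M.finsum_cong')
      fix j assume "j \<in> {..k}"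
      hence j: "j \<le> k" by simp
      show "a j \<odot>\<^bsub>M\<^esub> (\<Oplus>\<^bsub>M\<^esub>i\<in>{..Suc k-j}. b i \<odot>\<^bsub>M\<^esub> x (n - j - i)) =
        (a j \<otimes> b (Suc k - j)) \<odot>\<^bsub>M\<^esub> x (n - Suc k) \<oplus>\<^bsub>M\<^esub>
        a j \<odot>\<^bsub>M\<^esub> (\<Oplus>\<^bsub>M\<^esub>i\<in>{..k-j}. b i \<odot>\<^bsub>M\<^esub> x (n - j - i))"
        unfolding e[OF j] using assms c1 by (simp add: smult_r_distr smult_assoc1 del: diff_diff_left)
    qed (use assms c1 in auto)
    also have "\<dots> = ?Y \<oplus>\<^bsub>M\<^esub> ?X"
      by (rule M.finsum_addf) (use assms c1 in auto)
    finally show ?case unfolding l using X Y z by (simp add: M.a_assoc)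
  qed
  from this[of n] show ?thesis
    unfolding conv_def by (simp add: finsum_self_module)
qed

end

lemma (in cring) conv_comm:
  assumes a: "\<And>i. a i \<in> carrier R" and b: "\<And>i. b i \<in> carrier R"
  shows "conv (self_module R) a b n = conv (self_module R) b a n"
proof -
  have "(\<Oplus>i\<in>{..n}. a i \<otimes> b (n - i)) = (\<Oplus>i\<in>(\<lambda>i. n - i) ` {..n}. a i \<otimes> b (n - i))"
  proof (rule finsum_cong')
    show "{..n} = (\<lambda>i. n - i) ` {..n}"
    proof (intro equalityI subsetI)
      fix i assume "i \<in> {..n}"
      hence "i = n - (n - i)" "n - i \<in> {..n}" by auto
      thus "i \<in> (\<lambda>i. n - i) ` {..n}" by blast
    qed auto
  qed (use assms in auto)
  also have "\<dots> = (\<Oplus>i\<in>{..n}. a (n - i) \<otimes> b (n - (n - i)))"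
    by (rule finsum_reindex) (use assms in \<open>auto simp: inj_on_def\<close>)
  also have "\<dots> = (\<Oplus>i\<in>{..n}. b i \<otimes> a (n - i))"
    by (rule finsum_cong') (use assms in \<open>auto simp: m_comm\<close>)
  finally show ?thesis by (simp add: conv_def finsum_self_module)
qed

section \<open>Associated graded objects of compatible filtrations\<close>

locale graded = rmodule R M for R :: "('a, 'k) ring_scheme" (structure)
    and M :: "('a, 'b) module" (structure) +
  fixes Q :: "nat \<Rightarrow> 'a set" and F :: "nat \<Rightarrow> 'b set"
  assumes Q_ideal: "ideal (Q n) R" and Q_0: "Q 0 = carrier R" and Q_Suc: "Q (Suc n) \<subseteq> Q n"
    and Q_mult: "a \<in> Q i \<Longrightarrow> b \<in> Q j \<Longrightarrow> a \<otimes>\<^bsub>R\<^esub> b \<in> Q (i + j)"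
    and F_sub: "submodule (F n) R M" and F_0: "F 0 = carrier M" and F_Suc: "F (Suc n) \<subseteq> F n"
    and QF: "a \<in> Q i \<Longrightarrow> x \<in> F j \<Longrightarrow> a \<odot>\<^bsub>M\<^esub> x \<in> F (i + j)"
begin

lemma Q_carrier: "a \<in> Q n \<Longrightarrow> a \<in> carrier R" using ideal.Icarr[OF Q_ideal] .

lemma F_carrier: "x \<in> F n \<Longrightarrow> x \<in> carrier M" using submodule_mem_carrier[OF F_sub] .

text \<open>The ring as a filtered module over itself: results about graded modules become results
  about the graded ring. The instance \<open>S\<close> below always refers to this.\<close>

lemma self_graded: "graded R (self_module R) Q Q"
proof (intro graded.intro graded_axioms.intro R.self_module_is_module)
  show "submodule (Q n) R (self_module R)" for n using Q_ideal R.submodule_self_module_iff by blast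
  show "a \<odot>\<^bsub>self_module R\<^esub> x \<in> Q (i + j)" if "a \<in> Q i" "x \<in> Q j" for a x i j
    using Q_mult[OF that] by simp
qed (use Q_ideal Q_0 Q_Suc Q_mult in simp_all)

abbreviation piece where "piece \<equiv> gr_piece M F"

lemma piece_submodule: "submodule (F (Suc n)) R (M\<lparr>carrier := F n\<rparr>)"
  using submodule_restrict_iff[OF F_sub] F_sub F_Suc by blast

lemma piece_module: "rmodule R (piece n)"
  unfolding gr_piece_def
  by (rule rmodule.quot_module_is_module[OF submodule_restrict[OF F_sub] piece_submodule])

lemma piece_simps:
  "carrier (piece n) = (\<lambda>x. F (Suc n) +>\<^bsub>M\<^esub> x) ` F n"
  "zero (piece n) = F (Suc n)"
  "x \<in> F n \<Longrightarrow> y \<in> F n \<Longrightarrow>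
    (F (Suc n) +>\<^bsub>M\<^esub> x) \<oplus>\<^bsub>piece n\<^esub> (F (Suc n) +>\<^bsub>M\<^esub> y) = F (Suc n) +>\<^bsub>M\<^esub> (x \<oplus>\<^bsub>M\<^esub> y)"
proof -
  interpret P: rmodule R "M\<lparr>carrier := F n\<rparr>" by (rule submodule_restrict[OF F_sub])
  show "carrier (piece n) = (\<lambda>x. F (Suc n) +>\<^bsub>M\<^esub> x) ` F n"
    using P.carrier_quot_module[of "F (Suc n)"] by (simp add: gr_piece_def)
  show "zero (piece n) = F (Suc n)" by (simp add: gr_piece_def)
  show "(F (Suc n) +>\<^bsub>M\<^esub> x) \<oplus>\<^bsub>piece n\<^esub> (F (Suc n) +>\<^bsub>M\<^esub> y) = F (Suc n) +>\<^bsub>M\<^esub> (x \<oplus>\<^bsub>M\<^esub> y)"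
    if "x \<in> F n" "y \<in> F n"
    using P.quot_module_simps(2)[OF piece_submodule, of x y] that by (simp add: gr_piece_def)
qed

lemma coset_zero: "F n +>\<^bsub>M\<^esub> \<zero>\<^bsub>M\<^esub> = F n"
  using coset_eq_self_iff[OF F_sub M.zero_closed] submodule_zero[OF F_sub] by blast

lemma finsum_piece:
  assumes "finite I" "\<And>i. i \<in> I \<Longrightarrow> x i \<in> F n"
  shows "(\<Oplus>\<^bsub>piece n\<^esub>i\<in>I. F (Suc n) +>\<^bsub>M\<^esub> x i) = F (Suc n) +>\<^bsub>M\<^esub> (\<Oplus>\<^bsub>M\<^esub>i\<in>I. x i)"
proof -
  interpret P: rmodule R "piece n" by (rule piece_module)
  show ?thesis using assms
  proof (induction I rule: finite_induct)
    case empty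
    show ?case by (simp add: piece_simps coset_zero)
  next
    case (insert i I)
    have fs: "(\<Oplus>\<^bsub>M\<^esub>i\<in>I. x i) \<in> F n" by (rule finsum_submodule[OF F_sub]) (use insert in auto)
    have "(\<Oplus>\<^bsub>piece n\<^esub>i\<in>insert i I. F (Suc n) +>\<^bsub>M\<^esub> x i) =
      (F (Suc n) +>\<^bsub>M\<^esub> x i) \<oplus>\<^bsub>piece n\<^esub> (\<Oplus>\<^bsub>piece n\<^esub>i\<in>I. F (Suc n) +>\<^bsub>M\<^esub> x i)"
      by (rule P.M.finsum_insert) (use insert in \<open>auto simp: piece_simps\<close>)
    also have "\<dots> = (F (Suc n) +>\<^bsub>M\<^esub> x i) \<oplus>\<^bsub>piece n\<^esub> (F (Suc n) +>\<^bsub>M\<^esub> (\<Oplus>\<^bsub>M\<^esub>i\<in>I. x i))"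
      using insert by simp
    also have "\<dots> = F (Suc n) +>\<^bsub>M\<^esub> (x i \<oplus>\<^bsub>M\<^esub> (\<Oplus>\<^bsub>M\<^esub>i\<in>I. x i))"
      by (rule piece_simps(3)) (use insert fs in auto)
    also have "x i \<oplus>\<^bsub>M\<^esub> (\<Oplus>\<^bsub>M\<^esub>i\<in>I. x i) = (\<Oplus>\<^bsub>M\<^esub>i\<in>insert i I. x i)"
      by (rule M.finsum_insert[symmetric]) (use insert F_carrier in auto)
    finally show ?case .
  qed
qed

lemma cls_in_gr: "x \<in> fin_seqs M F \<Longrightarrow> cls M F x \<in> gr_carrier M F"
proof -
  assume x: "x \<in> fin_seqs M F"
  then obtain N where N: "\<And>n. n > N \<Longrightarrow> x n = \<zero>\<^bsub>M\<^esub>" by (auto simp: fin_seqs_def)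
  have "{n. cls M F x n \<noteq> F (Suc n)} \<subseteq> {..N}"
    using N coset_zero by (auto simp: cls_def)
  hence "finite {n. cls M F x n \<noteq> F (Suc n)}" by (rule finite_subset) simp
  thus ?thesis using x by (auto simp: gr_carrier_def piece_simps cls_def fin_seqs_def)
qed

lemma gr_carrier_eq: "gr_carrier M F = cls M F ` fin_seqs M F"
proof (intro equalityI subsetI)
  fix f assume f: "f \<in> gr_carrier M F"
  hence ex: "\<forall>n. \<exists>x. x \<in> F n \<and> f n = F (Suc n) +>\<^bsub>M\<^esub> x" and fin: "finite {n. f n \<noteq> F (Suc n)}"
    by (auto simp: gr_carrier_def piece_simps)
  from ex obtain x where x: "\<And>n. x n \<in> F n" "\<And>n. f n = F (Suc n) +>\<^bsub>M\<^esub> x n" by metis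
  obtain N where N: "\<And>n. n > N \<Longrightarrow> f n = F (Suc n)"
    using fin unfolding finite_nat_set_iff_bounded_le by (metis (mono_tags) linorder_not_less mem_Collect_eq)
  \<comment> \<open>Zero cosets get the representative zero; an arbitrary choice of representatives
    need not be finitely supported.\<close>
  let ?y = "\<lambda>n. if f n = F (Suc n) then \<zero>\<^bsub>M\<^esub> else x n"
  have "\<forall>n>N. ?y n = \<zero>\<^bsub>M\<^esub>" using N by simp
  moreover have "\<forall>n. ?y n \<in> F n" using x submodule_zero[OF F_sub] by simp
  ultimately have "?y \<in> fin_seqs M F" unfolding fin_seqs_def by blast
  moreover have "f = cls M F ?y" by (rule ext) (use x coset_zero in \<open>auto simp: cls_def\<close>)
  ultimately show "f \<in> cls M F ` fin_seqs M F" by blast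
qed (auto intro: cls_in_gr)

lemma fin_seqs_mem: "x \<in> fin_seqs M F \<Longrightarrow> x n \<in> F n" "x \<in> fin_seqs M F \<Longrightarrow> x n \<in> carrier M"
  using F_carrier by (auto simp: fin_seqs_def)

lemma cls_eq_iff:
  assumes "x \<in> fin_seqs M F" "y \<in> fin_seqs M F"
  shows "cls M F x = cls M F y \<longleftrightarrow> (\<forall>n. x n \<ominus>\<^bsub>M\<^esub> y n \<in> F (Suc n))"
  using coset_eq_iff[OF F_sub fin_seqs_mem(2)[OF assms(1)] fin_seqs_mem(2)[OF assms(2)]]
  by (simp add: cls_def fun_eq_iff)

lemma gr_zero_eq: "gr_zero M F = cls M F (\<lambda>_. \<zero>\<^bsub>M\<^esub>)"
  by (simp add: gr_zero_def cls_def piece_simps coset_zero fun_eq_iff)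

lemma cls_eq_zero_iff:
  assumes "x \<in> fin_seqs M F"
  shows "cls M F x = gr_zero M F \<longleftrightarrow> (\<forall>n. x n \<in> F (Suc n))"
  using coset_eq_self_iff[OF F_sub fin_seqs_mem(2)[OF assms]]
  by (simp add: gr_zero_def cls_def piece_simps fun_eq_iff)

lemma fin_seqs_zero: "(\<lambda>_. \<zero>\<^bsub>M\<^esub>) \<in> fin_seqs M F"
  using submodule_zero[OF F_sub] by (simp add: fin_seqs_def)

lemma fin_seqs_single: "x \<in> F j \<Longrightarrow> single M j x \<in> fin_seqs M F"
  using submodule_zero[OF F_sub] by (auto simp: fin_seqs_def single_def)

lemma fin_seqs_add:
  assumes "x \<in> fin_seqs M F" "y \<in> fin_seqs M F"
  shows "(\<lambda>n. x n \<oplus>\<^bsub>M\<^esub> y n) \<in> fin_seqs M F"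
proof -
  obtain N N' where N: "\<And>n. n > N \<Longrightarrow> x n = \<zero>\<^bsub>M\<^esub>" "\<And>n. n > N' \<Longrightarrow> y n = \<zero>\<^bsub>M\<^esub>"
    using assms by (auto simp: fin_seqs_def)
  have "\<forall>n>max N N'. x n \<oplus>\<^bsub>M\<^esub> y n = \<zero>\<^bsub>M\<^esub>" using N by simp
  thus ?thesis using assms submodule_add[OF F_sub] unfolding fin_seqs_def by blast
qed

lemma fin_seqs_neg: "x \<in> fin_seqs M F \<Longrightarrow> (\<lambda>n. \<ominus>\<^bsub>M\<^esub> x n) \<in> fin_seqs M F"
proof -
  assume x: "x \<in> fin_seqs M F"
  have "\<ominus>\<^bsub>M\<^esub> \<zero>\<^bsub>M\<^esub> = \<zero>\<^bsub>M\<^esub>" using M.minus_equality[of "\<zero>\<^bsub>M\<^esub>" "\<zero>\<^bsub>M\<^esub>"] by simp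
  moreover obtain N where "\<forall>n>N. x n = \<zero>\<^bsub>M\<^esub>" using x by (auto simp: fin_seqs_def)
  ultimately have "\<forall>n>N. \<ominus>\<^bsub>M\<^esub> x n = \<zero>\<^bsub>M\<^esub>" by simp
  thus ?thesis using x submodule_neg[OF F_sub] unfolding fin_seqs_def by blast
qed

lemma fin_seqs_conv:
  assumes a: "a \<in> fin_seqs (self_module R) Q" and x: "x \<in> fin_seqs M F"
  shows "conv M a x \<in> fin_seqs M F"
proof -
  obtain N N' where N: "\<And>n. n > N \<Longrightarrow> a n = \<zero>" "\<And>n. n > N' \<Longrightarrow> x n = \<zero>\<^bsub>M\<^esub>"
    using assms by (auto simp: fin_seqs_def)
  have aQ: "a n \<in> Q n" for n using a by (auto simp: fin_seqs_def)
  have xF: "x n \<in> F n" for n using x by (auto simp: fin_seqs_def)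
  have "conv M a x n \<in> F n" for n unfolding conv_def
  proof (rule finsum_submodule[OF F_sub])
    fix i assume "i \<in> {..n}"
    thus "a i \<odot>\<^bsub>M\<^esub> x (n - i) \<in> F n" using QF[OF aQ[of i] xF[of "n - i"]] by simp
  qed
  moreover have "conv M a x n = \<zero>\<^bsub>M\<^esub>" if n: "n > N + N'" for n
  proof -
    have "a i \<odot>\<^bsub>M\<^esub> x (n - i) = \<zero>\<^bsub>M\<^esub>" for i
    proof (cases "i > N")
      case True
      thus ?thesis using N(1)[of i] F_carrier[OF xF] by simp
    next
      case False
      hence "n - i > N'" using n by linarith
      thus ?thesis using N(2)[of "n - i"] Q_carrier[OF aQ] by simp
    qed
    thus ?thesis by (simp add: conv_def M.finsum_zero)
  qed
  ultimately show ?thesis unfolding fin_seqs_def by blast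
qed

lemma gr_add_cls:
  assumes "x \<in> fin_seqs M F" "y \<in> fin_seqs M F"
  shows "gr_add M F (cls M F x) (cls M F y) = cls M F (\<lambda>n. x n \<oplus>\<^bsub>M\<^esub> y n)"
  using fin_seqs_mem(1)[OF assms(1)] fin_seqs_mem(1)[OF assms(2)]
  by (intro ext) (simp add: gr_add_def cls_def piece_simps)

lemma coset_smult_eq:
  assumes a: "a \<in> Q i" and x: "x \<in> F j" and n: "n = i + j"
  shows "coset_smult M (F (Suc n)) (Q (Suc i) +>\<^bsub>R\<^esub> a) (F (Suc j) +>\<^bsub>M\<^esub> x) = F (Suc n) +>\<^bsub>M\<^esub> (a \<odot>\<^bsub>M\<^esub> x)"
proof -
  have ac: "a \<in> carrier R" and xc: "x \<in> carrier M" using a x Q_carrier F_carrier by auto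
  interpret Qi: ideal "Q (Suc i)" R by (rule Q_ideal)
  have eq: "F (Suc n) +>\<^bsub>M\<^esub> (b \<odot>\<^bsub>M\<^esub> y) = F (Suc n) +>\<^bsub>M\<^esub> (a \<odot>\<^bsub>M\<^esub> x)"
    if b: "b \<in> Q (Suc i) +>\<^bsub>R\<^esub> a" and y: "y \<in> F (Suc j) +>\<^bsub>M\<^esub> x" for b y
  proof -
    obtain b' where b': "b' \<in> Q (Suc i)" "b = b' \<oplus> a" using b by (auto simp: a_r_coset_def')
    obtain y' where y': "y' \<in> F (Suc j)" "y = y' \<oplus>\<^bsub>M\<^esub> x" using y by (auto simp: a_r_coset_def')
    have c: "b' \<in> carrier R" "y' \<in> carrier M" using b' y' Q_carrier F_carrier by auto
    \<comment> \<open>This is the error \<open>b y - a x\<close>. Each summand gains one degree,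
      from \<open>b'\<close> or from \<open>y'\<close>, so the union of cosets in
      \<open>coset_smult\<close> is a single coset.\<close>
    let ?d = "b' \<odot>\<^bsub>M\<^esub> (y' \<oplus>\<^bsub>M\<^esub> x) \<oplus>\<^bsub>M\<^esub> a \<odot>\<^bsub>M\<^esub> y'"
    have "y' \<oplus>\<^bsub>M\<^esub> x \<in> F j" using y' x F_Suc submodule_add[OF F_sub] by blast
    hence "b' \<odot>\<^bsub>M\<^esub> (y' \<oplus>\<^bsub>M\<^esub> x) \<in> F (Suc n)" using QF[OF b'(1)] n by simp
    moreover have "a \<odot>\<^bsub>M\<^esub> y' \<in> F (Suc n)" using QF[OF a y'(1)] n by simp
    ultimately have d: "?d \<in> F (Suc n)" by (rule submodule_add[OF F_sub])
    have "b \<odot>\<^bsub>M\<^esub> y = ?d \<oplus>\<^bsub>M\<^esub> a \<odot>\<^bsub>M\<^esub> x"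
      using b' y' c ac xc by (simp add: smult_l_distr smult_r_distr M.a_ac)
    hence "b \<odot>\<^bsub>M\<^esub> y \<ominus>\<^bsub>M\<^esub> a \<odot>\<^bsub>M\<^esub> x = ?d"
      using c ac xc by (simp add: a_minus_def M.a_assoc M.r_neg)
    thus ?thesis using coset_eq_iff[OF F_sub, of "b \<odot>\<^bsub>M\<^esub> y" "a \<odot>\<^bsub>M\<^esub> x"] d b' y' c ac xc by simp
  qed
  have "a \<in> Q (Suc i) +>\<^bsub>R\<^esub> a" using ac Qi.zero_closed by (force simp: a_r_coset_def')
  moreover have "x \<in> F (Suc j) +>\<^bsub>M\<^esub> x" using xc submodule_zero[OF F_sub] by (force simp: a_r_coset_def')
  ultimately have ne: "Q (Suc i) +>\<^bsub>R\<^esub> a \<noteq> {}" "F (Suc j) +>\<^bsub>M\<^esub> x \<noteq> {}" by blast+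
  have "(\<Union>y\<in>F (Suc j) +>\<^bsub>M\<^esub> x. F (Suc n) +>\<^bsub>M\<^esub> (b \<odot>\<^bsub>M\<^esub> y)) = F (Suc n) +>\<^bsub>M\<^esub> (a \<odot>\<^bsub>M\<^esub> x)"
    if "b \<in> Q (Suc i) +>\<^bsub>R\<^esub> a" for b
    by (rule SUP_eq_const[OF ne(2)]) (rule eq[OF that])
  thus ?thesis unfolding coset_smult_def by (rule SUP_eq_const[OF ne(1)])
qed

lemma gr_smult_cls:
  assumes a: "a \<in> fin_seqs (self_module R) Q" and x: "x \<in> fin_seqs M F"
  shows "gr_smult M F (cls (self_module R) Q a) (cls M F x) = cls M F (conv M a x)"
proof
  fix n
  interpret P: rmodule R "piece n" by (rule piece_module)
  have aQ: "a n \<in> Q n" for n using a by (auto simp: fin_seqs_def)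
  have xF: "x n \<in> F n" for n using x by (auto simp: fin_seqs_def)
  have ax: "a i \<odot>\<^bsub>M\<^esub> x (n - i) \<in> F n" if "i \<le> n" for i
    using QF[OF aQ[of i] xF[of "n - i"]] that by simp
  have cs: "coset_smult M (F (Suc n)) (Q (Suc i) +>\<^bsub>R\<^esub> a i) (F (Suc (n - i)) +>\<^bsub>M\<^esub> x (n - i)) =
    F (Suc n) +>\<^bsub>M\<^esub> (a i \<odot>\<^bsub>M\<^esub> x (n - i))" if "i \<le> n" for i
    by (rule coset_smult_eq[OF aQ xF]) (use that in simp)
  have "gr_smult M F (cls (self_module R) Q a) (cls M F x) n =
    (\<Oplus>\<^bsub>piece n\<^esub>i\<in>{..n}. F (Suc n) +>\<^bsub>M\<^esub> (a i \<odot>\<^bsub>M\<^esub> x (n - i)))"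
    unfolding gr_smult_def cls_def coset_self_module
  proof (rule P.M.finsum_cong')
    show "coset_smult M (F (Suc n)) (Q (Suc i) +>\<^bsub>R\<^esub> a i) (F (Suc (n - i)) +>\<^bsub>M\<^esub> x (n - i)) =
      F (Suc n) +>\<^bsub>M\<^esub> (a i \<odot>\<^bsub>M\<^esub> x (n - i))" if "i \<in> {..n}" for i
      using that by (intro cs) simp
  qed (use ax in \<open>auto simp: piece_simps\<close>)
  also have "\<dots> = cls M F (conv M a x) n"
    unfolding cls_def conv_def by (rule finsum_piece) (use ax in auto)
  finally show "gr_smult M F (cls (self_module R) Q a) (cls M F x) n = cls M F (conv M a x) n" .
qed

text \<open>Only the additive fields of \<open>N\<close> are prescribed, so the result applies both
  to the graded module and to the graded ring.\<close>

lemma abelian_group_gr: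
  assumes "carrier N = gr_carrier M F" "zero N = gr_zero M F" "add N = gr_add M F"
  shows "abelian_group N"
proof (rule abelian_groupI)
  note simps = assms gr_carrier_eq gr_add_cls fin_seqs_add fin_seqs_zero gr_zero_eq
  show "x \<oplus>\<^bsub>N\<^esub> y \<in> carrier N" if "x \<in> carrier N" "y \<in> carrier N" for x y
    using that by (auto simp: simps)
  show "\<zero>\<^bsub>N\<^esub> \<in> carrier N" by (auto simp: simps)
  show "x \<oplus>\<^bsub>N\<^esub> y \<oplus>\<^bsub>N\<^esub> z = x \<oplus>\<^bsub>N\<^esub> (y \<oplus>\<^bsub>N\<^esub> z)"
    if "x \<in> carrier N" "y \<in> carrier N" "z \<in> carrier N" for x y z
    using that by (auto simp: simps fin_seqs_mem M.a_assoc)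
  show "x \<oplus>\<^bsub>N\<^esub> y = y \<oplus>\<^bsub>N\<^esub> x" if "x \<in> carrier N" "y \<in> carrier N" for x y
    using that by (auto simp: simps fin_seqs_mem M.a_comm)
  show "\<zero>\<^bsub>N\<^esub> \<oplus>\<^bsub>N\<^esub> x = x" if "x \<in> carrier N" for x
    using that by (auto simp: simps fin_seqs_mem)
  show "\<exists>y\<in>carrier N. y \<oplus>\<^bsub>N\<^esub> x = \<zero>\<^bsub>N\<^esub>" if "x \<in> carrier N" for x
  proof -
    obtain u where u: "u \<in> fin_seqs M F" "x = cls M F u" using \<open>x \<in> carrier N\<close> by (auto simp: simps)
    have "cls M F (\<lambda>n. \<ominus>\<^bsub>M\<^esub> u n) \<oplus>\<^bsub>N\<^esub> x = \<zero>\<^bsub>N\<^esub>"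
      using u fin_seqs_neg[OF u(1)] by (simp add: simps fin_seqs_mem M.l_neg)
    thus ?thesis using fin_seqs_neg[OF u(1)] by (auto simp: simps)
  qed
qed

abbreviation G where "G \<equiv> assoc_ring R Q"
abbreviation N where "N \<equiv> gr_module M F"

lemma N_simps:
  "carrier N = cls M F ` fin_seqs M F" "zero N = cls M F (\<lambda>_. \<zero>\<^bsub>M\<^esub>)"
  "x \<in> fin_seqs M F \<Longrightarrow> y \<in> fin_seqs M F \<Longrightarrow>
    cls M F x \<oplus>\<^bsub>N\<^esub> cls M F y = cls M F (\<lambda>n. x n \<oplus>\<^bsub>M\<^esub> y n)"
  "a \<in> fin_seqs (self_module R) Q \<Longrightarrow> x \<in> fin_seqs M F \<Longrightarrow>
    cls (self_module R) Q a \<odot>\<^bsub>N\<^esub> cls M F x = cls M F (conv M a x)"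
  by (simp_all add: gr_module_def gr_carrier_eq gr_zero_eq gr_add_cls gr_smult_cls)

lemma G_simps:
  "carrier G = cls (self_module R) Q ` fin_seqs (self_module R) Q"
  "zero G = cls (self_module R) Q (\<lambda>_. \<zero>)"
  "one G = cls (self_module R) Q (single (self_module R) 0 \<one>)"
  "a \<in> fin_seqs (self_module R) Q \<Longrightarrow> b \<in> fin_seqs (self_module R) Q \<Longrightarrow>
    cls (self_module R) Q a \<oplus>\<^bsub>G\<^esub> cls (self_module R) Q b = cls (self_module R) Q (\<lambda>n. a n \<oplus> b n)"
  "a \<in> fin_seqs (self_module R) Q \<Longrightarrow> b \<in> fin_seqs (self_module R) Q \<Longrightarrow>
    cls (self_module R) Q a \<otimes>\<^bsub>G\<^esub> cls (self_module R) Q b = cls (self_module R) Q (conv (self_module R) a b)"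
proof -
  interpret S: graded R "self_module R" Q Q by (rule self_graded)
  show "carrier G = cls (self_module R) Q ` fin_seqs (self_module R) Q"
    "zero G = cls (self_module R) Q (\<lambda>_. \<zero>)"
    "one G = cls (self_module R) Q (single (self_module R) 0 \<one>)"
    by (simp_all add: assoc_ring_def S.gr_carrier_eq S.gr_zero_eq)
  assume "a \<in> fin_seqs (self_module R) Q" "b \<in> fin_seqs (self_module R) Q"
  thus "cls (self_module R) Q a \<oplus>\<^bsub>G\<^esub> cls (self_module R) Q b = cls (self_module R) Q (\<lambda>n. a n \<oplus> b n)"
    "cls (self_module R) Q a \<otimes>\<^bsub>G\<^esub> cls (self_module R) Q b = cls (self_module R) Q (conv (self_module R) a b)"
    by (simp_all add: assoc_ring_def S.gr_add_cls S.gr_smult_cls)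
qed

lemma G_cring: "cring G"
proof -
  interpret S: graded R "self_module R" Q Q by (rule self_graded)
  have one: "single (self_module R) 0 \<one> \<in> fin_seqs (self_module R) Q"
    by (rule S.fin_seqs_single) (simp add: Q_0)
  have c: "a n \<in> carrier R" if "a \<in> fin_seqs (self_module R) Q" for a n
    using S.fin_seqs_mem(2)[OF that] by simp
  have l1: "conv (self_module R) (single (self_module R) 0 \<one>) a = a"
    if "a \<in> fin_seqs (self_module R) Q" for a
    using S.conv_single_left[of \<one> a 0] c[OF that] by (simp add: fun_eq_iff)
  note simps = G_simps one l1 S.fin_seqs_conv S.fin_seqs_add
  show ?thesis
  proof (rule cringI)
    show "abelian_group G" by (rule S.abelian_group_gr) (simp_all add: assoc_ring_def)
    show "comm_monoid G"
    proof (rule comm_monoidI)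
      show "x \<otimes>\<^bsub>G\<^esub> y \<in> carrier G" if "x \<in> carrier G" "y \<in> carrier G" for x y
        using that by (auto simp: simps)
      show "\<one>\<^bsub>G\<^esub> \<in> carrier G" by (auto simp: simps)
      show "\<one>\<^bsub>G\<^esub> \<otimes>\<^bsub>G\<^esub> x = x" if "x \<in> carrier G" for x
        using that by (auto simp: simps)
      show "x \<otimes>\<^bsub>G\<^esub> y = y \<otimes>\<^bsub>G\<^esub> x" if xy: "x \<in> carrier G" "y \<in> carrier G" for x y
      proof -
        obtain a b where ab: "a \<in> fin_seqs (self_module R) Q" "b \<in> fin_seqs (self_module R) Q"
          "x = cls (self_module R) Q a" "y = cls (self_module R) Q b"
          using xy by (auto simp: G_simps)
        have "conv (self_module R) a b = conv (self_module R) b a"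
          using R.conv_comm[OF c[OF ab(1)] c[OF ab(2)]] by (rule ext)
        thus ?thesis using ab by (simp add: simps)
      qed
      show "x \<otimes>\<^bsub>G\<^esub> y \<otimes>\<^bsub>G\<^esub> z = x \<otimes>\<^bsub>G\<^esub> (y \<otimes>\<^bsub>G\<^esub> z)"
        if xyz: "x \<in> carrier G" "y \<in> carrier G" "z \<in> carrier G" for x y z
      proof -
        obtain a b d where abd: "a \<in> fin_seqs (self_module R) Q" "b \<in> fin_seqs (self_module R) Q"
          "d \<in> fin_seqs (self_module R) Q"
          "x = cls (self_module R) Q a" "y = cls (self_module R) Q b" "z = cls (self_module R) Q d"
          using xyz by (auto simp: G_simps)
        have "conv (self_module R) (conv (self_module R) a b) d = conv (self_module R) a (conv (self_module R) b d)"
          using S.conv_assoc[of a b d] c abd by (intro ext) simp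
        thus ?thesis using abd by (simp add: simps)
      qed
    qed
    show "(x \<oplus>\<^bsub>G\<^esub> y) \<otimes>\<^bsub>G\<^esub> z = x \<otimes>\<^bsub>G\<^esub> z \<oplus>\<^bsub>G\<^esub> y \<otimes>\<^bsub>G\<^esub> z"
      if xyz: "x \<in> carrier G" "y \<in> carrier G" "z \<in> carrier G" for x y z
    proof -
      obtain a b d where abd: "a \<in> fin_seqs (self_module R) Q" "b \<in> fin_seqs (self_module R) Q"
        "d \<in> fin_seqs (self_module R) Q"
        "x = cls (self_module R) Q a" "y = cls (self_module R) Q b" "z = cls (self_module R) Q d"
        using xyz by (auto simp: G_simps)
      have "conv (self_module R) (\<lambda>n. a n \<oplus> b n) d n =
          conv (self_module R) a d n \<oplus> conv (self_module R) b d n" for n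
        using S.conv_add_left[of a b d n] c abd by simp
      hence "conv (self_module R) (\<lambda>n. a n \<oplus> b n) d =
          (\<lambda>n. conv (self_module R) a d n \<oplus> conv (self_module R) b d n)" by (rule ext)
      moreover have "(\<lambda>n. a n \<oplus> b n) \<in> fin_seqs (self_module R) Q"
        using S.fin_seqs_add[OF abd(1,2)] by simp
      ultimately show ?thesis using abd by (simp add: simps)
    qed
  qed
qed

lemma N_module: "rmodule G N"
proof (rule rmoduleI, rule moduleI[OF G_cring])
  interpret S: graded R "self_module R" Q Q by (rule self_graded)
  show "abelian_group N" by (rule abelian_group_gr) (simp_all add: gr_module_def)
  have c: "a n \<in> carrier R" if "a \<in> fin_seqs (self_module R) Q" for a n
    using S.fin_seqs_mem(2)[OF that] by simp
  have Sadd: "(\<lambda>n. a n \<oplus> b n) \<in> fin_seqs (self_module R) Q"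
    if "a \<in> fin_seqs (self_module R) Q" "b \<in> fin_seqs (self_module R) Q" for a b
    using S.fin_seqs_add[OF that] by simp
  show "g \<odot>\<^bsub>N\<^esub> f \<in> carrier N" if "g \<in> carrier G" "f \<in> carrier N" for g f
    using that by (auto simp: G_simps N_simps fin_seqs_conv)
  show "(g \<oplus>\<^bsub>G\<^esub> h) \<odot>\<^bsub>N\<^esub> f = g \<odot>\<^bsub>N\<^esub> f \<oplus>\<^bsub>N\<^esub> h \<odot>\<^bsub>N\<^esub> f"
    if ghf: "g \<in> carrier G" "h \<in> carrier G" "f \<in> carrier N" for g h f
  proof -
    obtain a b x where ab: "a \<in> fin_seqs (self_module R) Q" "b \<in> fin_seqs (self_module R) Q"
      "x \<in> fin_seqs M F" "g = cls (self_module R) Q a" "h = cls (self_module R) Q b" "f = cls M F x"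
      using ghf by (auto simp: G_simps N_simps)
    have "conv M (\<lambda>n. a n \<oplus> b n) x = (\<lambda>n. conv M a x n \<oplus>\<^bsub>M\<^esub> conv M b x n)"
      using conv_add_left[of a b x] c ab fin_seqs_mem(2)[OF ab(3)] by (intro ext) simp
    thus ?thesis using ab Sadd by (simp add: G_simps N_simps fin_seqs_conv)
  qed
  show "g \<odot>\<^bsub>N\<^esub> (f \<oplus>\<^bsub>N\<^esub> f') = g \<odot>\<^bsub>N\<^esub> f \<oplus>\<^bsub>N\<^esub> g \<odot>\<^bsub>N\<^esub> f'"
    if gff: "g \<in> carrier G" "f \<in> carrier N" "f' \<in> carrier N" for g f f'
  proof -
    obtain a x y where ab: "a \<in> fin_seqs (self_module R) Q" "x \<in> fin_seqs M F" "y \<in> fin_seqs M F"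
      "g = cls (self_module R) Q a" "f = cls M F x" "f' = cls M F y"
      using gff by (auto simp: G_simps N_simps)
    have "conv M a (\<lambda>n. x n \<oplus>\<^bsub>M\<^esub> y n) = (\<lambda>n. conv M a x n \<oplus>\<^bsub>M\<^esub> conv M a y n)"
      using conv_add_right[of a y x] c ab fin_seqs_mem(2)[OF ab(2)] fin_seqs_mem(2)[OF ab(3)]
      by (intro ext) simp
    thus ?thesis using ab fin_seqs_add by (simp add: G_simps N_simps fin_seqs_conv)
  qed
  show "(g \<otimes>\<^bsub>G\<^esub> h) \<odot>\<^bsub>N\<^esub> f = g \<odot>\<^bsub>N\<^esub> (h \<odot>\<^bsub>N\<^esub> f)"
    if ghf: "g \<in> carrier G" "h \<in> carrier G" "f \<in> carrier N" for g h f
  proof -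
    obtain a b x where ab: "a \<in> fin_seqs (self_module R) Q" "b \<in> fin_seqs (self_module R) Q"
      "x \<in> fin_seqs M F" "g = cls (self_module R) Q a" "h = cls (self_module R) Q b" "f = cls M F x"
      using ghf by (auto simp: G_simps N_simps)
    have "conv M (conv (self_module R) a b) x = conv M a (conv M b x)"
      using conv_assoc[of a b x] c ab fin_seqs_mem(2)[OF ab(3)] by (intro ext) simp
    thus ?thesis using ab S.fin_seqs_conv by (simp add: G_simps N_simps fin_seqs_conv)
  qed
  show "\<one>\<^bsub>G\<^esub> \<odot>\<^bsub>N\<^esub> f = f" if "f \<in> carrier N" for f
  proof -
    obtain x where x: "x \<in> fin_seqs M F" "f = cls M F x" using \<open>f \<in> carrier N\<close> by (auto simp: N_simps)
    have one: "single (self_module R) 0 \<one> \<in> fin_seqs (self_module R) Q"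
      by (rule S.fin_seqs_single) (simp add: Q_0)
    have "conv M (single (self_module R) 0 \<one>) x = x"
      using conv_single_left[of \<one> x 0] fin_seqs_mem(2)[OF x(1)] by (simp add: fun_eq_iff)
    thus ?thesis using x one by (simp add: G_simps N_simps)
  qed
qed

end

section \<open>The adic filtration\<close>

lemma (in cring)
  assumes I: "ideal I R"
  shows adic_ideal: "ideal (adic_filtration R I n) R"
    and adic_0: "adic_filtration R I 0 = carrier R"
    and adic_Suc: "adic_filtration R I (Suc n) = ideal_prod R (adic_filtration R I n) I"
proof -
  show S: "adic_filtration R I (Suc n) = ideal_prod R (adic_filtration R I n) I" for n
    by (simp add: adic_filtration_def ideals_set_def nat_pow_def)
  show Z: "adic_filtration R I 0 = carrier R"
    by (simp add: adic_filtration_def ideals_set_def nat_pow_def)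
  show "ideal (adic_filtration R I n) R"
    by (induction n) (auto simp: S Z oneideal I intro: ideal_prod_is_ideal)
qed

lemma (in cring) gr_ring_eq: "gr_ring R I = assoc_ring R (adic_filtration R I)" if I: "ideal I R"
proof -
  interpret S: rmodule R "self_module R" by (rule self_module_is_module)
  let ?Q = "adic_filtration R I"
  have "zero (gr_piece (self_module R) ?Q n) = ?Q (Suc n)" for n
    by (simp add: gr_piece_def quot_module_def)
  moreover have "?Q (Suc n) +>\<^bsub>self_module R\<^esub> \<zero> = ?Q (Suc n)" for n
    using S.coset_eq_self_iff[of "?Q (Suc n)" \<zero>] adic_ideal[OF I]
    by (simp add: submodule_self_module_iff additive_subgroup.zero_closed ideal.axioms(1))
  ultimately have "(\<lambda>n. if n = 0 then ?Q 1 +>\<^bsub>self_module R\<^esub> \<one> else \<zero>\<^bsub>gr_piece (self_module R) ?Q n\<^esub>) =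
    cls (self_module R) ?Q (single (self_module R) 0 \<one>)"
    by (auto simp: cls_def single_def fun_eq_iff)
  thus ?thesis by (simp add: gr_ring_def assoc_ring_def Let_def)
qed

context filtered
begin

abbreviation Q where "Q \<equiv> adic_filtration R \<qq>"

lemma Q_ideal: "ideal (Q n) R" by (rule R.adic_ideal[OF q_ideal])

lemma Q_carrier: "a \<in> Q n \<Longrightarrow> a \<in> carrier R" by (rule ideal.Icarr[OF Q_ideal])

lemma Q_SucD: "a \<in> Q (Suc i) \<Longrightarrow> a \<in> ideal_prod R (Q i) \<qq>"
  by (simp add: R.adic_Suc[OF q_ideal])

lemma adic_smult: "a \<in> Q i \<Longrightarrow> \<forall>x\<in>F j. a \<odot>\<^bsub>M\<^esub> x \<in> F (i + j)"
proof (induction i arbitrary: a)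
  case 0
  thus ?case using submodule_smult[OF F_sub] by (simp add: R.adic_0[OF q_ideal])
next
  case (Suc i)
  let ?T = "{a \<in> carrier R. \<forall>x\<in>F j. a \<odot>\<^bsub>M\<^esub> x \<in> F (Suc i + j)}"
  have T: "ideal ?T R" by (rule ideal_transporter[OF F_sub F_carrier])
  have "a \<in> ?T" using Q_SucD[OF Suc.prems]
  proof (induction a rule: ideal_prod.induct)
    case (prod b c)
    have bc: "b \<in> carrier R" "c \<in> carrier R" using Q_carrier[OF prod(1)] subsetD[OF q_carrier prod(2)] .
    have "(b \<otimes> c) \<odot>\<^bsub>M\<^esub> y \<in> F (Suc i + j)" if y: "y \<in> F j" for y
    proof -
      have yc: "y \<in> carrier M" by (rule subsetD[OF F_carrier y])
      have "b \<odot>\<^bsub>M\<^esub> y \<in> F (i + j)" using Suc.IH[OF prod(1)] y by simp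
      hence "c \<odot>\<^bsub>M\<^esub> (b \<odot>\<^bsub>M\<^esub> y) \<in> F (Suc (i + j))" by (rule F_smult[OF prod(2)])
      thus ?thesis using smult_assoc1[OF bc(2,1) yc] R.m_comm[OF bc] by simp
    qed
    thus ?case using bc by simp
  next
    case (sum a b)
    show ?case by (rule additive_subgroup.a_closed[OF ideal.axioms(1)[OF T] sum(3,4)])
  qed
  thus ?case by simp
qed

lemma adic_mult: "a \<in> Q i \<Longrightarrow> b \<in> Q j \<Longrightarrow> a \<otimes> b \<in> Q (i + j)"
proof (induction i arbitrary: a)
  case 0
  thus ?case using ideal.I_l_closed[OF Q_ideal] by (simp add: R.adic_0[OF q_ideal])
next
  case (Suc i)
  have bc: "b \<in> carrier R" by (rule Q_carrier[OF Suc.prems(2)])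
  interpret Qi: ideal "Q (Suc i + j)" R by (rule Q_ideal)
  have cc: "c \<in> carrier R" if "c \<in> ideal_prod R (Q i) \<qq>" for c
    using that R.ideal_prod_in_carrier[OF Q_ideal q_ideal] by blast
  show ?case using Q_SucD[OF Suc.prems(1)]
  proof (induction a rule: ideal_prod.induct)
    case (prod c d)
    have cd: "c \<in> carrier R" "d \<in> carrier R" using Q_carrier[OF prod(1)] subsetD[OF q_carrier prod(2)] .
    have "(c \<otimes> b) \<otimes> d \<in> Q (Suc i + j)"
      unfolding add_Suc R.adic_Suc[OF q_ideal]
      by (rule ideal_prod.prod[OF Suc.IH[OF prod(1) Suc.prems(2)] prod(2)])
    moreover have "(c \<otimes> b) \<otimes> d = (c \<otimes> d) \<otimes> b" using cd bc by (simp add: R.m_ac)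
    ultimately show ?case by (simp only:)
  next
    case (sum s1 s2)
    show ?case unfolding R.l_distr[OF cc[OF sum(1)] cc[OF sum(2)] bc] by (rule Qi.a_closed[OF sum(3,4)])
  qed
qed

lemma graded_F: "graded R M Q F"
proof (intro graded.intro graded_axioms.intro rmodule_axioms)
  show "Q (Suc i) \<subseteq> Q i" for i
    using R.ideal_prod_inter[OF Q_ideal q_ideal] R.adic_Suc[OF q_ideal] by auto
  show "a \<odot>\<^bsub>M\<^esub> x \<in> F (i + j)" if "a \<in> Q i" "x \<in> F j" for a x i j
    using adic_smult[OF that(1)] that(2) by blast
qed (rule Q_ideal adic_mult R.adic_0[OF q_ideal] F_sub F_0 F_Suc | assumption)+

end

section \<open>The initial forms of a superficial sequence in the extremal case\<close>

context graded
begin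

abbreviation sQ where "sQ \<equiv> fin_seqs (self_module R) Q"
abbreviation sF where "sF \<equiv> fin_seqs M F"

text \<open>The class of \<open>a\<close> in \<open>Q i / Q (Suc i)\<close> as a homogeneous element
  of degree \<open>i\<close>; for \<open>i = 1\<close> and \<open>a\<close> in \<open>\<qq>\<close>
  this gives the forms attached to the superficial sequence.\<close>

definition homG :: "nat \<Rightarrow> 'a \<Rightarrow> nat \<Rightarrow> 'a set" where
  "homG i a = cls (self_module R) Q (single (self_module R) i a)"

definition homN :: "nat \<Rightarrow> 'b \<Rightarrow> nat \<Rightarrow> 'b set" where
  "homN j x = cls M F (single M j x)"

lemma single_sQ: "a \<in> Q i \<Longrightarrow> single (self_module R) i a \<in> sQ"
proof -
  interpret S: graded R "self_module R" Q Q by (rule self_graded)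
  show "a \<in> Q i \<Longrightarrow> single (self_module R) i a \<in> sQ" by (rule S.fin_seqs_single)
qed

lemma homG_carrier: "a \<in> Q i \<Longrightarrow> homG i a \<in> carrier G"
  using single_sQ by (simp add: homG_def G_simps)

lemma homN_carrier: "x \<in> F j \<Longrightarrow> homN j x \<in> carrier N"
  using fin_seqs_single by (simp add: homN_def N_simps)

lemma homG_smult:
  assumes a: "a \<in> Q i" and x: "x \<in> sF"
  shows "homG i a \<odot>\<^bsub>N\<^esub> cls M F x = cls M F (\<lambda>n. if i \<le> n then a \<odot>\<^bsub>M\<^esub> x (n - i) else \<zero>\<^bsub>M\<^esub>)"
proof -
  have "conv M (single (self_module R) i a) x = (\<lambda>n. if i \<le> n then a \<odot>\<^bsub>M\<^esub> x (n - i) else \<zero>\<^bsub>M\<^esub>)"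
    using conv_single_left[of a x i] Q_carrier[OF a] fin_seqs_mem(2)[OF x] by (intro ext) simp
  thus ?thesis unfolding homG_def using N_simps(4)[OF single_sQ[OF a] x] by simp
qed

lemma fin_seqs_shift: "a \<in> Q i \<Longrightarrow> x \<in> sF \<Longrightarrow>
  (\<lambda>n. if i \<le> n then a \<odot>\<^bsub>M\<^esub> x (n - i) else \<zero>\<^bsub>M\<^esub>) \<in> sF"
proof -
  assume a: "a \<in> Q i" and x: "x \<in> sF"
  have "conv M (single (self_module R) i a) x = (\<lambda>n. if i \<le> n then a \<odot>\<^bsub>M\<^esub> x (n - i) else \<zero>\<^bsub>M\<^esub>)"
    using conv_single_left[of a x i] Q_carrier[OF a] fin_seqs_mem(2)[OF x] by (intro ext) simp
  thus ?thesis using fin_seqs_conv[OF single_sQ[OF a] x] by simp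
qed

lemma homG_homN:
  assumes a: "a \<in> Q i" and x: "x \<in> F j"
  shows "homG i a \<odot>\<^bsub>N\<^esub> homN j x = homN (i + j) (a \<odot>\<^bsub>M\<^esub> x)"
proof -
  have "(\<lambda>n. if i \<le> n then a \<odot>\<^bsub>M\<^esub> single M j x (n - i) else \<zero>\<^bsub>M\<^esub>) = single M (i + j) (a \<odot>\<^bsub>M\<^esub> x)"
    using Q_carrier[OF a] by (auto simp: single_def fun_eq_iff)
  thus ?thesis unfolding homN_def using homG_smult[OF a fin_seqs_single[OF x]] by simp
qed

end

context filtered
begin

lemma q_Q1: "a \<in> \<qq> \<Longrightarrow> a \<in> Q (Suc 0)"
proof -
  assume a: "a \<in> \<qq>"
  have "\<one> \<otimes> a \<in> ideal_prod R (Q 0) \<qq>"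
    by (rule ideal_prod.prod) (use a in \<open>auto simp: R.adic_0[OF q_ideal]\<close>)
  thus ?thesis using a q_carrier by (auto simp: R.adic_Suc[OF q_ideal])
qed

lemma Q1_le_q: "Q (Suc 0) \<subseteq> \<qq>"
  using R.ideal_prod_inter[OF Q_ideal q_ideal, of 0] by (simp add: R.adic_Suc[OF q_ideal])

end

context superficial_eq
begin

interpretation gr: graded R M Q F by (rule graded_F)
interpretation GN: rmodule gr.G gr.N by (rule gr.N_module)

definition "J i n = ideal_smult R M (Idl (set (take i xs))) (F n)"

text \<open>The preimage in \<open>F n\<close> of the degree \<open>n\<close> part of the submodule
  of gr(M) generated by the first \<open>i\<close> degree-one forms. These forms reach degree
  \<open>n\<close> from degree \<open>n - 1\<close> and contribute nothing in degree 0.\<close>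

definition "K i n = (case n of 0 \<Rightarrow> F 1 | Suc m \<Rightarrow> J i m <+>\<^bsub>M\<^esub> F (Suc (Suc m)))"

lemma take_carrier: "set (take i xs) \<subseteq> carrier R"
  using set_take_subset set_xs(2) by (rule subset_trans)

lemma Idl_carrier: "Idl (set (take i xs)) \<subseteq> carrier R"
  using ideal.Icarr[OF R.genideal_ideal[OF take_carrier]] by blast

lemma J_sub: "sub (J i n)"
  unfolding J_def by (rule submodule_ideal_smult[OF Idl_carrier F_carrier])

lemma K_sub: "sub (K i n)"
  unfolding K_def by (cases n) (auto intro: F_sub submodule_sum J_sub)

lemma F_le_K: "F (Suc n) \<subseteq> K i n"
  unfolding K_def by (cases n) (auto intro!: subsetD[OF sum_upper2[OF J_sub F_sub]])

lemma J_Suc: "i < t \<Longrightarrow> J (Suc i) n = J i n <+>\<^bsub>M\<^esub> (\<odot>\<^bsub>M\<^esub>) (xs ! i) ` F n"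
  using ideal_smult_insert[OF xs_carrier take_carrier F_sub]
  by (simp add: J_def take_Suc_conv_app_nth)

lemma J_le_L: "J i n \<subseteq> L i"
  unfolding J_def L_def seq_submodule_def by (rule ideal_smult_mono[OF subset_refl F_carrier])

lemma xF_sub: "i < t \<Longrightarrow> sub ((\<odot>\<^bsub>M\<^esub>) (xs ! i) ` F n)"
  by (rule submodule_smult_image[OF F_sub xs_carrier])

lemma J_mono_Suc: "i < t \<Longrightarrow> J i n \<subseteq> J (Suc i) n"
  unfolding J_Suc by (rule sum_upper1[OF J_sub xF_sub])

lemma K_mono_Suc: "i < t \<Longrightarrow> K i n \<subseteq> K (Suc i) n"
  unfolding K_def by (cases n) (auto intro!: subsetD[OF sum_mono[OF J_mono_Suc subset_refl]])

text \<open>A degreewise description of the submodule generated by the first \<open>i\<close> forms,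
  identified as such in \<open>seq_submodule_ys\<close>. It does not depend on representatives,
  because \<open>K i n\<close> contains \<open>F (Suc n)\<close>.\<close>

definition "W i = {cls M F x | x. x \<in> gr.sF \<and> (\<forall>n. x n \<in> K i n)}"

lemma cls_W_iff:
  assumes x: "x \<in> gr.sF"
  shows "cls M F x \<in> W i \<longleftrightarrow> (\<forall>n. x n \<in> K i n)"
proof
  assume "cls M F x \<in> W i"
  then obtain y where y: "y \<in> gr.sF" "\<And>n. y n \<in> K i n" "cls M F x = cls M F y" by (auto simp: W_def)
  have d: "x n \<ominus>\<^bsub>M\<^esub> y n \<in> F (Suc n)" for n using gr.cls_eq_iff[OF x y(1)] y(3) by blast
  show "\<forall>n. x n \<in> K i n"
  proof
    fix n
    have c: "x n \<in> carrier M" "y n \<in> carrier M" using gr.fin_seqs_mem(2) x y(1) by auto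
    have "(x n \<ominus>\<^bsub>M\<^esub> y n) \<oplus>\<^bsub>M\<^esub> y n \<in> K i n"
      using submodule_add[OF K_sub subsetD[OF F_le_K d] y(2)] .
    thus "x n \<in> K i n" using c by (simp add: a_minus_def M.a_assoc M.l_neg)
  qed
qed (use x in \<open>auto simp: W_def\<close>)

definition "ys = map (gr.homG (Suc 0)) xs"

lemma ys_nth: "i < t \<Longrightarrow> ys ! i = gr.homG (Suc 0) (xs ! i)"
  by (simp add: ys_def)

lemma set_ys: "set ys \<subseteq> carrier gr.G"
  using gr.homG_carrier q_Q1 set_xs(1) by (auto simp: ys_def)

lemma ys_smult:
  assumes i: "i < t" and x: "x \<in> gr.sF"
  shows "ys ! i \<odot>\<^bsub>gr.N\<^esub> cls M F x = cls M F (\<lambda>n. if Suc 0 \<le> n then xs ! i \<odot>\<^bsub>M\<^esub> x (n - Suc 0) else \<zero>\<^bsub>M\<^esub>)"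
    "(\<lambda>n. if Suc 0 \<le> n then xs ! i \<odot>\<^bsub>M\<^esub> x (n - Suc 0) else \<zero>\<^bsub>M\<^esub>) \<in> gr.sF"
  unfolding ys_nth[OF i]
  by (rule gr.homG_smult[OF q_Q1[OF xs_q[OF i]] x], rule gr.fin_seqs_shift[OF q_Q1[OF xs_q[OF i]] x])

lemma W_0: "W 0 = {zero gr.N}"
proof -
  have J0: "J 0 n = {\<zero>\<^bsub>M\<^esub>}" for n
  proof -
    have "ideal_smult R M {\<zero>} (F n) \<subseteq> {\<zero>\<^bsub>M\<^esub>}"
    proof (rule ideal_smult_minimal[OF submodule_zero_set])
      fix a x assume "a \<in> {\<zero>}" "x \<in> F n"
      thus "a \<odot>\<^bsub>M\<^esub> x \<in> {\<zero>\<^bsub>M\<^esub>}" using smult_l_null[OF subsetD[OF F_carrier]] by simp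
    qed
    thus ?thesis using submodule_zero[OF J_sub[of 0 n]] by (auto simp: J_def genideal_empty)
  qed
  have K0: "K 0 n = F (Suc n)" for n
    unfolding K_def J0
    by (cases n) (auto simp: sum_absorb[OF submodule_zero_set F_sub] submodule_zero[OF F_sub])
  have z: "zero gr.N = gr_zero M F" by (simp add: gr_module_def)
  show ?thesis
    using gr.cls_eq_zero_iff gr.fin_seqs_zero gr.gr_zero_eq submodule_zero[OF F_sub]
    unfolding z W_def K0 by auto
qed

lemma W_Suc:
  assumes i: "i < t"
  shows "W (Suc i) = W i <+>\<^bsub>gr.N\<^esub> (\<odot>\<^bsub>gr.N\<^esub>) (ys ! i) ` carrier gr.N"
proof (intro equalityI subsetI)
  note ac = xs_carrier[OF i]
  fix f assume "f \<in> W i <+>\<^bsub>gr.N\<^esub> (\<odot>\<^bsub>gr.N\<^esub>) (ys ! i) ` carrier gr.N"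
  then obtain x z where x: "x \<in> gr.sF" "\<And>n. x n \<in> K i n" and z: "z \<in> gr.sF"
    and f: "f = cls M F x \<oplus>\<^bsub>gr.N\<^esub> (ys ! i \<odot>\<^bsub>gr.N\<^esub> cls M F z)"
    by (auto simp: GN.mem_sum_iff W_def gr.N_simps)
  let ?z = "\<lambda>n. if Suc 0 \<le> n then xs ! i \<odot>\<^bsub>M\<^esub> z (n - Suc 0) else \<zero>\<^bsub>M\<^esub>"
  have f': "f = cls M F (\<lambda>n. x n \<oplus>\<^bsub>M\<^esub> ?z n)"
    unfolding f ys_smult(1)[OF i z] by (rule gr.N_simps(3)[OF x(1) ys_smult(2)[OF i z]])
  have s: "(\<lambda>n. x n \<oplus>\<^bsub>M\<^esub> ?z n) \<in> gr.sF" by (rule gr.fin_seqs_add[OF x(1) ys_smult(2)[OF i z]])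
  have zK: "?z n \<in> K (Suc i) n" for n
  proof (cases n)
    case 0
    thus ?thesis using submodule_zero[OF K_sub] by simp
  next
    case (Suc m)
    have "z m \<in> F m" using gr.fin_seqs_mem(1)[OF z] .
    hence "xs ! i \<odot>\<^bsub>M\<^esub> z m \<in> J (Suc i) m"
      unfolding J_Suc[OF i] using sum_upper2[OF J_sub xF_sub[OF i]] by blast
    thus ?thesis using Suc sum_upper1[OF J_sub F_sub] by (auto simp: K_def)
  qed
  have "x n \<oplus>\<^bsub>M\<^esub> ?z n \<in> K (Suc i) n" for n
    by (rule submodule_add[OF K_sub subsetD[OF K_mono_Suc[OF i] x(2)] zK])
  thus "f \<in> W (Suc i)" unfolding f' cls_W_iff[OF s] by blast
next
  note ac = xs_carrier[OF i]
  fix f assume "f \<in> W (Suc i)"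
  then obtain x where x: "x \<in> gr.sF" "\<And>n. x n \<in> K (Suc i) n" "f = cls M F x" by (auto simp: W_def)
  obtain B where B: "\<And>n. n > B \<Longrightarrow> x n = \<zero>\<^bsub>M\<^esub>" using x(1) by (auto simp: fin_seqs_def)
  \<comment> \<open>Choosing zero wherever \<open>x\<close> vanishes keeps both families finitely
    supported.\<close>
  have "\<exists>j w. j \<in> J i n \<and> w \<in> F n \<and> x (Suc n) \<ominus>\<^bsub>M\<^esub> (j \<oplus>\<^bsub>M\<^esub> xs ! i \<odot>\<^bsub>M\<^esub> w) \<in> F (Suc (Suc n)) \<and>
    (x (Suc n) = \<zero>\<^bsub>M\<^esub> \<longrightarrow> j = \<zero>\<^bsub>M\<^esub> \<and> w = \<zero>\<^bsub>M\<^esub>)" for n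
  proof (cases "x (Suc n) = \<zero>\<^bsub>M\<^esub>")
    case True
    have "\<zero>\<^bsub>M\<^esub> \<ominus>\<^bsub>M\<^esub> (\<zero>\<^bsub>M\<^esub> \<oplus>\<^bsub>M\<^esub> xs ! i \<odot>\<^bsub>M\<^esub> \<zero>\<^bsub>M\<^esub>) \<in> F (Suc (Suc n))"
      using submodule_diff[OF F_sub submodule_zero[OF F_sub] submodule_zero[OF F_sub]] ac by simp
    thus ?thesis using True submodule_zero[OF J_sub] submodule_zero[OF F_sub] by auto
  next
    case False
    have "x (Suc n) \<in> J (Suc i) n <+>\<^bsub>M\<^esub> F (Suc (Suc n))" using x(2)[of "Suc n"] by (simp add: K_def)
    then obtain j' h where j': "j' \<in> J (Suc i) n" "h \<in> F (Suc (Suc n))" "x (Suc n) = j' \<oplus>\<^bsub>M\<^esub> h"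
      by (auto simp: mem_sum_iff)
    obtain j w where jw: "j \<in> J i n" "w \<in> F n" "j' = j \<oplus>\<^bsub>M\<^esub> xs ! i \<odot>\<^bsub>M\<^esub> w"
      using j'(1) unfolding J_Suc[OF i] by (auto simp: mem_sum_iff)
    have c: "j' \<in> carrier M" "h \<in> carrier M"
      using submodule_mem_carrier[OF J_sub j'(1)] submodule_mem_carrier[OF F_sub j'(2)] .
    have "x (Suc n) \<ominus>\<^bsub>M\<^esub> j' = h" using c j'(3) by (simp add: a_minus_def M.a_ac M.r_neg2 M.r_neg)
    thus ?thesis using jw j'(2) False by blast
  qed
  hence "\<forall>n. \<exists>j w. j \<in> J i n \<and> w \<in> F n \<and> x (Suc n) \<ominus>\<^bsub>M\<^esub> (j \<oplus>\<^bsub>M\<^esub> xs ! i \<odot>\<^bsub>M\<^esub> w) \<in> F (Suc (Suc n)) \<and>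
    (x (Suc n) = \<zero>\<^bsub>M\<^esub> \<longrightarrow> j = \<zero>\<^bsub>M\<^esub> \<and> w = \<zero>\<^bsub>M\<^esub>)" ..
  then obtain j w where jw: "\<And>n. j n \<in> J i n" "\<And>n. w n \<in> F n"
    "\<And>n. x (Suc n) \<ominus>\<^bsub>M\<^esub> (j n \<oplus>\<^bsub>M\<^esub> xs ! i \<odot>\<^bsub>M\<^esub> w n) \<in> F (Suc (Suc n))"
    "\<And>n. x (Suc n) = \<zero>\<^bsub>M\<^esub> \<Longrightarrow> j n = \<zero>\<^bsub>M\<^esub> \<and> w n = \<zero>\<^bsub>M\<^esub>" by metis
  have fin: "\<forall>n>B. j n = \<zero>\<^bsub>M\<^esub> \<and> w n = \<zero>\<^bsub>M\<^esub>" using jw(4) B by simp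
  have jF: "j n \<in> F (Suc n)" for n
  proof -
    have "J i n \<subseteq> F (Suc n)"
      unfolding J_def
    proof (rule ideal_smult_Idl_subset[OF take_carrier F_sub F_sub])
      fix a y assume "a \<in> set (take i xs)" "y \<in> F n"
      thus "a \<odot>\<^bsub>M\<^esub> y \<in> F (Suc n)"
        using F_smult set_xs(1) set_take_subset[of i xs] by blast
    qed
    thus ?thesis using jw(1) by blast
  qed
  \<comment> \<open>The shift by one restores degrees: \<open>j m\<close> was chosen for the
    component of \<open>x\<close> in degree \<open>Suc m\<close>.\<close>
  let ?u = "\<lambda>n. case n of 0 \<Rightarrow> \<zero>\<^bsub>M\<^esub> | Suc m \<Rightarrow> j m"
  have "?u n \<in> F n" for n using jF submodule_zero[OF F_sub] by (cases n) auto
  moreover have "\<forall>n>Suc B. ?u n = \<zero>\<^bsub>M\<^esub>" using fin by (auto split: nat.split)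
  ultimately have u: "?u \<in> gr.sF" unfolding fin_seqs_def by blast
  have w: "w \<in> gr.sF" unfolding fin_seqs_def using jw(2) fin by blast
  have uW: "cls M F ?u \<in> W i"
  proof -
    have "?u n \<in> K i n" for n
      using subsetD[OF sum_upper1[OF J_sub F_sub] jw(1)] submodule_zero[OF F_sub]
      by (cases n) (auto simp: K_def)
    thus ?thesis using cls_W_iff[OF u] by blast
  qed
  let ?w = "\<lambda>n. if Suc 0 \<le> n then xs ! i \<odot>\<^bsub>M\<^esub> w (n - Suc 0) else \<zero>\<^bsub>M\<^esub>"
  have uw: "(\<lambda>n. ?u n \<oplus>\<^bsub>M\<^esub> ?w n) \<in> gr.sF" by (rule gr.fin_seqs_add[OF u ys_smult(2)[OF i w]])
  have "x n \<ominus>\<^bsub>M\<^esub> (?u n \<oplus>\<^bsub>M\<^esub> ?w n) \<in> F (Suc n)" for n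
  proof (cases n)
    case 0
    have "x 0 \<in> F (Suc 0)" using x(2)[of 0] by (simp add: K_def)
    hence "x 0 \<ominus>\<^bsub>M\<^esub> \<zero>\<^bsub>M\<^esub> \<in> F (Suc 0)" by (rule submodule_diff[OF F_sub _ submodule_zero[OF F_sub]])
    thus ?thesis using 0 by simp
  next
    case (Suc m)
    thus ?thesis using jw(3)[of m] by simp
  qed
  hence "cls M F x = cls M F (\<lambda>n. ?u n \<oplus>\<^bsub>M\<^esub> ?w n)" using gr.cls_eq_iff[OF x(1) uw] by blast
  also have "\<dots> = cls M F ?u \<oplus>\<^bsub>gr.N\<^esub> (ys ! i \<odot>\<^bsub>gr.N\<^esub> cls M F w)"
    unfolding ys_smult(1)[OF i w] by (rule gr.N_simps(3)[OF u ys_smult(2)[OF i w], symmetric])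
  finally have "f = cls M F ?u \<oplus>\<^bsub>gr.N\<^esub> (ys ! i \<odot>\<^bsub>gr.N\<^esub> cls M F w)" using x(3) by simp
  moreover have "cls M F w \<in> carrier gr.N" using w by (simp add: gr.N_simps)
  ultimately show "f \<in> W i <+>\<^bsub>gr.N\<^esub> (\<odot>\<^bsub>gr.N\<^esub>) (ys ! i) ` carrier gr.N"
    using uW unfolding GN.mem_sum_iff by blast
qed

lemma seq_submodule_ys: "i \<le> t \<Longrightarrow> seq_submodule gr.G gr.N (take i ys) = W i"
proof (induction i)
  case 0
  show ?case by (simp add: GN.seq_submodule_Nil W_0)
next
  case (Suc i)
  have i: "i < length ys" "i < t" using Suc.prems by (auto simp: ys_def)
  have "seq_submodule gr.G gr.N (take i ys @ [ys ! i]) =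
    seq_submodule gr.G gr.N (take i ys) <+>\<^bsub>gr.N\<^esub> (\<odot>\<^bsub>gr.N\<^esub>) (ys ! i) ` carrier gr.N"
    by (rule GN.seq_submodule_snoc[OF subset_trans[OF set_take_subset set_ys]])
      (use set_ys i nth_mem in blast)
  thus ?case using Suc W_Suc[OF i(2)] i by (simp add: take_Suc_conv_app_nth)
qed

text \<open>The Valabrega-Valla argument. The colon equality gives \<open>x n = u + v\<close> with
  \<open>u\<close> in \<open>F (Suc n)\<close> and \<open>v\<close> in
  \<open>L i \<inter> F n\<close>; then \<open>L_Int_F\<close> expresses \<open>v\<close> through
  the generators with coefficients from \<open>F (n - 1)\<close>. In degree 0,
  \<open>L i \<subseteq> F 1\<close> suffices.\<close>

lemma ys_regular_step:
  assumes i: "i < t" and x: "x \<in> gr.sF" and W: "ys ! i \<odot>\<^bsub>gr.N\<^esub> cls M F x \<in> W i"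
  shows "cls M F x \<in> W i"
proof -
  have k: "(if Suc 0 \<le> n then xs ! i \<odot>\<^bsub>M\<^esub> x (n - Suc 0) else \<zero>\<^bsub>M\<^esub>) \<in> K i n" for n
    using W unfolding ys_smult(1)[OF i x] cls_W_iff[OF ys_smult(2)[OF i x]] by blast
  have "x n \<in> K i n" for n
  proof -
    have xc: "x n \<in> carrier M" and xF: "x n \<in> F n" using gr.fin_seqs_mem[OF x] by auto
    have "xs ! i \<odot>\<^bsub>M\<^esub> x n \<in> J i n <+>\<^bsub>M\<^esub> F (Suc (Suc n))" using k[of "Suc n"] by (simp add: K_def)
    hence "xs ! i \<odot>\<^bsub>M\<^esub> x n \<in> F (Suc (Suc n)) <+>\<^bsub>M\<^esub> L i"
      using sum_least[OF FL_sub[OF L_sub], of "J i n" "Suc (Suc n)" i "F (Suc (Suc n))"]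
        J_le_L[of i n] L_le_FL[OF L_sub] F_le_FL[OF L_sub] by blast
    hence "x n \<in> F (Suc n) <+>\<^bsub>M\<^esub> L i" by (rule colonD[OF i xc])
    then obtain u v where uv: "u \<in> F (Suc n)" "v \<in> L i" "x n = u \<oplus>\<^bsub>M\<^esub> v" by (auto simp: mem_sum_iff)
    have vc: "v \<in> carrier M" using submodule_mem_carrier[OF L_sub uv(2)] .
    have uF: "u \<in> F n" using uv(1) F_Suc by blast
    have vF: "v \<in> F n"
      using submodule_add_iff[OF F_sub uF vc] uv(3) xF by simp
    have "v \<in> K i n"
    proof (cases n)
      case 0
      thus ?thesis using uv(2) L_le_F1[of i] i by (auto simp: K_def)
    next
      case (Suc m)
      have "v \<in> J i m" unfolding J_def by (rule L_Int_F) (use i uv(2) vF Suc in auto)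
      thus ?thesis using Suc sum_upper1[OF J_sub F_sub] by (auto simp: K_def)
    qed
    thus ?thesis unfolding uv(3) by (rule submodule_add[OF K_sub subsetD[OF F_le_K uv(1)]])
  qed
  thus ?thesis using cls_W_iff[OF x] by blast
qed

text \<open>If the forms generated gr(M), then \<open>F n \<subseteq> K t n\<close> in each degree.
  Starting with \<open>F 0 = F 1\<close>, this would propagate to \<open>F n = M\<close> for all
  \<open>n\<close>, although some \<open>F k\<close> lies in the proper submodule
  \<open>L t\<close>.\<close>

lemma W_t_proper: "W t \<noteq> carrier gr.N"
proof
  assume W: "W t = carrier gr.N"
  have FK: "F n \<subseteq> K t n" for n
  proof
    fix y assume y: "y \<in> F n"
    have s: "single M n y \<in> gr.sF" by (rule gr.fin_seqs_single[OF y])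
    hence "cls M F (single M n y) \<in> W t" unfolding W by (simp add: gr.N_simps)
    hence "single M n y n \<in> K t n" using cls_W_iff[OF s] by blast
    thus "y \<in> K t n" by (simp add: single_def)
  qed
  \<comment> \<open>Two consecutive terms are carried: since \<open>F n = F (Suc n)\<close>, the
    product \<open>J t n\<close> lies one degree deeper than expected, in
    \<open>F (Suc (Suc n))\<close>.\<close>
  have F_all: "F n = carrier M \<and> F (Suc n) = carrier M" for n
  proof (induction n)
    case 0
    show ?case using FK[of 0] F_0 F_carrier[of 1] by (auto simp: K_def)
  next
    case (Suc n)
    have "J t n \<subseteq> F (Suc (Suc n))"
      unfolding J_def
    proof (rule ideal_smult_Idl_subset[OF take_carrier F_sub F_sub])
      fix a y assume "a \<in> set (take t xs)" "y \<in> F n"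
      thus "a \<odot>\<^bsub>M\<^esub> y \<in> F (Suc (Suc n))" using F_smult[of a y "Suc n"] set_xs(1) Suc by auto
    qed
    hence "J t n <+>\<^bsub>M\<^esub> F (Suc (Suc n)) \<subseteq> F (Suc (Suc n))" by (intro sum_least F_sub) auto
    hence "carrier M \<subseteq> F (Suc (Suc n))" using FK[of "Suc n"] Suc by (auto simp: K_def)
    thus ?case using Suc F_carrier by blast
  qed
  obtain k where "F k \<subseteq> L t" using nilpotent_L by blast
  thus False using F_all L_t_proper submoduleE(1)[OF L_sub[of t]] by auto
qed

lemma ys_regular: "regular_sequence gr.G gr.N ys"
  unfolding regular_sequence_def
proof (intro conjI allI impI)
  have l: "length ys = t" by (simp add: ys_def)
  show "set ys \<subseteq> carrier gr.G" by (rule set_ys)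
  show "seq_submodule gr.G gr.N ys \<noteq> carrier gr.N"
    using seq_submodule_ys[of t] W_t_proper l by simp
  fix i assume "i < length ys"
  hence i: "i < t" using l by simp
  have yc: "ys ! i \<in> carrier gr.G" by (rule subsetD[OF set_ys nth_mem]) (use i l in simp)
  have "f \<in> W i" if "f \<in> carrier gr.N" "ys ! i \<odot>\<^bsub>gr.N\<^esub> f \<in> W i" for f
    using ys_regular_step[OF i] that by (auto simp: gr.N_simps)
  moreover have "GN.sub (seq_submodule gr.G gr.N (take i ys))"
    by (rule GN.submodule_seq_submodule[OF subset_trans[OF set_take_subset set_ys]])
  ultimately show "nonzerodivisor_on (quot_module gr.N (seq_submodule gr.G gr.N (take i ys))) (ys ! i)"
    using GN.nonzerodivisor_quot_iff[OF _ yc] seq_submodule_ys[of i] i by simp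
qed

lemma depth_gr_ge: "enat r \<le> depth (gr_ring R \<qq>) (gr_max_ideal R \<mm> \<qq>) (gr_module M F)"
proof -
  have G: "gr_ring R \<qq> = gr.G" by (rule R.gr_ring_eq[OF q_ideal])
  interpret S: graded R "self_module R" Q Q by (rule gr.self_graded)
  have "y \<in> gr_max_ideal R \<mm> \<qq>" if "y \<in> set ys" for y
  proof -
    from that obtain a where a: "y = gr.homG (Suc 0) a" by (auto simp: ys_def)
    \<comment> \<open>A form of degree 1 has the zero coset in degree 0, and that coset is contained
      in \<open>\<mm>\<close>.\<close>
    have "y 0 = Q (Suc 0)"
      using S.coset_zero[of "Suc 0"] by (simp add: a gr.homG_def cls_def single_def)
    thus ?thesis using Q1_le_q q_subset_m set_ys that by (auto simp: gr_max_ideal_def G)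
  qed
  hence "enat (length ys) \<le> depth (gr_ring R \<qq>) (gr_max_ideal R \<mm> \<qq>) (gr_module M F)"
    unfolding depth_def G using ys_regular by (intro Sup_upper) blast
  thus ?thesis using t_eq_r by (simp add: ys_def)
qed

end

section \<open>The dimension of the associated graded module\<close>

definition restrict_scalars :: "('a \<Rightarrow> 'c) \<Rightarrow> ('c, 'b) module \<Rightarrow> ('a, 'b) module" where
  "restrict_scalars \<phi> N =
     \<lparr>carrier = carrier N, monoid.mult = monoid.mult N, monoid.one = monoid.one N,
      zero = zero N, add = add N, smult = (\<lambda>a. smult N (\<phi> a))\<rparr>"

lemma restrict_scalars_simps [simp]:
  "carrier (restrict_scalars \<phi> N) = carrier N" "zero (restrict_scalars \<phi> N) = zero N"
  "add (restrict_scalars \<phi> N) = add N" "smult (restrict_scalars \<phi> N) a = smult N (\<phi> a)"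
  by (simp_all add: restrict_scalars_def)

lemma restrict_scalars_module:
  assumes R: "cring R" and N: "rmodule S N" and \<phi>: "\<phi> \<in> ring_hom R S"
  shows "rmodule R (restrict_scalars \<phi> N)"
proof (rule rmoduleI, rule moduleI[OF R])
  interpret N: rmodule S N by fact
  note h = ring_hom_memE[OF \<phi>]
  show "abelian_group (restrict_scalars \<phi> N)"
  proof (rule abelian_groupI)
    fix x assume "x \<in> carrier (restrict_scalars \<phi> N)"
    thus "\<exists>y\<in>carrier (restrict_scalars \<phi> N).
        y \<oplus>\<^bsub>restrict_scalars \<phi> N\<^esub> x = \<zero>\<^bsub>restrict_scalars \<phi> N\<^esub>"
      using N.M.l_neg by auto
  qed (auto simp: N.M.a_ac)
qed (use ring_hom_memE[OF \<phi>] N in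
    \<open>auto simp: rmodule_def module.smult_l_distr module.smult_r_distr module.smult_assoc1
      module.smult_closed module.smult_one\<close>)

lemma submodule_restrict_scalars:
  assumes "submodule X S N" and \<phi>: "\<phi> \<in> ring_hom R S"
  shows "submodule X R (restrict_scalars \<phi> N)"
  using assms ring_hom_memE(1)[OF \<phi>]
  by (auto simp: submodule_def submodule_axioms_def subgroup_def m_inv_def)

lemma (in rmodule) submoduleI':
  assumes "H \<subseteq> carrier M" "\<zero>\<^bsub>M\<^esub> \<in> H" "\<And>a b. a \<in> H \<Longrightarrow> b \<in> H \<Longrightarrow> a \<oplus>\<^bsub>M\<^esub> b \<in> H"
    and s: "\<And>a x. a \<in> carrier R \<Longrightarrow> x \<in> H \<Longrightarrow> a \<odot>\<^bsub>M\<^esub> x \<in> H"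
  shows "sub H"
proof (rule submoduleI)
  fix x assume x: "x \<in> H"
  have "(\<ominus>\<^bsub>R\<^esub> \<one>) \<odot>\<^bsub>M\<^esub> x = \<ominus>\<^bsub>M\<^esub> x" using x assms(1) by (simp add: smult_l_minus subset_iff)
  thus "\<ominus>\<^bsub>M\<^esub> x \<in> H" using s[of "\<ominus>\<^bsub>R\<^esub> \<one>" x] x by simp
qed (use assms in auto)

lemma (in rmodule) len_mono:
  assumes L: "sub L" and L': "sub L'" and N: "sub N" and "L \<subseteq> L'" "L' \<subseteq> N"
  shows "len L' N \<le> len L N" "len L L' \<le> len L N"
  using len_add[OF L L' N assms(4,5)] by (simp_all add: add_increasing add_increasing2)

section \<open>Truncations of graded modules and their lengths\<close>

context graded
begin

lemma homG_mult:
  assumes "a \<in> Q i" "b \<in> Q j"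
  shows "homG i a \<otimes>\<^bsub>G\<^esub> homG j b = homG (i + j) (a \<otimes> b)"
proof -
  interpret S: graded R "self_module R" Q Q by (rule self_graded)
  show ?thesis
    using S.homG_homN[OF assms] by (simp add: S.homN_def homG_def gr_module_def assoc_ring_def)
qed

lemma homN_add:
  assumes "x \<in> F j" "y \<in> F j"
  shows "homN j (x \<oplus>\<^bsub>M\<^esub> y) = homN j x \<oplus>\<^bsub>N\<^esub> homN j y"
proof -
  have "single M j (x \<oplus>\<^bsub>M\<^esub> y) = (\<lambda>n. single M j x n \<oplus>\<^bsub>M\<^esub> single M j y n)"
    by (auto simp: single_def)
  thus ?thesis unfolding homN_def using N_simps(3) fin_seqs_single assms by simp
qed

lemma homG_0_hom: "homG 0 \<in> ring_hom R G"
proof (rule ring_hom_memI)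
  interpret S: graded R "self_module R" Q Q by (rule self_graded)
  fix a b assume a: "a \<in> carrier R" and b: "b \<in> carrier R"
  hence ab: "a \<in> Q 0" "b \<in> Q 0" by (simp_all add: Q_0)
  show "homG 0 a \<in> carrier G" by (rule homG_carrier[OF ab(1)])
  show "homG 0 (a \<otimes> b) = homG 0 a \<otimes>\<^bsub>G\<^esub> homG 0 b" using homG_mult[OF ab] by simp
  show "homG 0 (a \<oplus> b) = homG 0 a \<oplus>\<^bsub>G\<^esub> homG 0 b"
    using S.homN_add[OF ab] by (simp add: S.homN_def homG_def gr_module_def assoc_ring_def)
qed (simp add: homG_def G_simps)

text \<open>Lengths are measured over \<open>R\<close>, acting through degree 0: truncations by
  degree are \<open>R\<close>-submodules, but in general not submodules over the graded
  ring.\<close>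

definition AN :: "('a, nat \<Rightarrow> 'b set) module" where "AN = restrict_scalars (homG 0) N"

lemma AN_simps [simp]:
  "carrier AN = carrier N" "zero AN = zero N" "add AN = add N" "smult AN a = smult N (homG 0 a)"
  by (simp_all add: AN_def)

lemma AN_module: "rmodule R AN"
  unfolding AN_def by (rule restrict_scalars_module[OF R.is_cring N_module homG_0_hom])

definition Nb :: "nat \<Rightarrow> (nat \<Rightarrow> 'b set) set" where
  "Nb n = {f \<in> carrier N. \<forall>m\<ge>n. f m = F (Suc m)}"

lemma cls_Nb_iff: "x \<in> sF \<Longrightarrow> cls M F x \<in> Nb n \<longleftrightarrow> (\<forall>m\<ge>n. x m \<in> F (Suc m))"
  using coset_eq_self_iff[OF F_sub fin_seqs_mem(2)] by (simp add: Nb_def N_simps(1) cls_def[of M F x])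

lemma Nb_E:
  assumes "f \<in> Nb n"
  obtains x where "x \<in> sF" "f = cls M F x" "\<And>m. m \<ge> n \<Longrightarrow> x m \<in> F (Suc m)"
proof -
  have "f \<in> carrier N" using assms by (simp add: Nb_def)
  then obtain x where x: "x \<in> sF" "f = cls M F x" by (auto simp: N_simps)
  thus ?thesis using that[OF x] cls_Nb_iff[OF x(1)] assms by blast
qed

lemma Nb_sub: "submodule (Nb n) R AN"
proof -
  interpret AN: rmodule R AN by (rule AN_module)
  show ?thesis
  proof (rule AN.submoduleI')
    show "Nb n \<subseteq> carrier AN" by (auto simp: Nb_def)
    show "\<zero>\<^bsub>AN\<^esub> \<in> Nb n"
      using cls_Nb_iff[OF fin_seqs_zero] submodule_zero[OF F_sub] by (simp add: N_simps)
    fix f g assume "f \<in> Nb n" "g \<in> Nb n"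
    then obtain x y where x: "x \<in> sF" "f = cls M F x" "\<And>m. m \<ge> n \<Longrightarrow> x m \<in> F (Suc m)"
      and y: "y \<in> sF" "g = cls M F y" "\<And>m. m \<ge> n \<Longrightarrow> y m \<in> F (Suc m)" by (metis Nb_E)
    have "f \<oplus>\<^bsub>AN\<^esub> g = cls M F (\<lambda>n. x n \<oplus>\<^bsub>M\<^esub> y n)" using x y by (simp add: N_simps)
    moreover have "cls M F (\<lambda>n. x n \<oplus>\<^bsub>M\<^esub> y n) \<in> Nb n"
      using cls_Nb_iff[OF fin_seqs_add[OF x(1) y(1)]] x y submodule_add[OF F_sub] by blast
    ultimately show "f \<oplus>\<^bsub>AN\<^esub> g \<in> Nb n" by (simp only:)
  next
    fix a f assume a: "a \<in> carrier R" and "f \<in> Nb n"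
    then obtain x where x: "x \<in> sF" "f = cls M F x" "\<And>m. m \<ge> n \<Longrightarrow> x m \<in> F (Suc m)" by (metis Nb_E)
    have aQ: "a \<in> Q 0" using a by (simp add: Q_0)
    have s: "(\<lambda>n. a \<odot>\<^bsub>M\<^esub> x n) \<in> sF" using fin_seqs_shift[OF aQ x(1)] by simp
    have "a \<odot>\<^bsub>AN\<^esub> f = cls M F (\<lambda>n. a \<odot>\<^bsub>M\<^esub> x n)" using homG_smult[OF aQ x(1)] x(2) by simp
    moreover have "cls M F (\<lambda>n. a \<odot>\<^bsub>M\<^esub> x n) \<in> Nb n"
      using cls_Nb_iff[OF s] x submodule_smult[OF F_sub a] by blast
    ultimately show "a \<odot>\<^bsub>AN\<^esub> f \<in> Nb n" by (simp only:)
  qed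
qed

lemma Nb_0: "Nb 0 = {zero N}"
proof -
  have "zero N = (\<lambda>m. F (Suc m))" by (simp add: N_simps cls_def[abs_def] coset_zero)
  moreover have "zero N \<in> carrier N" using fin_seqs_zero by (simp add: N_simps)
  ultimately show ?thesis by (auto simp: Nb_def)
qed

lemma Nb_mono: "i \<le> j \<Longrightarrow> Nb i \<subseteq> Nb j" by (auto simp: Nb_def)

lemma Nb_exhaust: "f \<in> carrier N \<Longrightarrow> \<exists>n. f \<in> Nb n"
proof -
  assume "f \<in> carrier N"
  then obtain x where x: "x \<in> sF" "f = cls M F x" by (auto simp: N_simps)
  then obtain B where "\<And>n. n > B \<Longrightarrow> x n = \<zero>\<^bsub>M\<^esub>" by (auto simp: fin_seqs_def)
  hence "\<forall>m\<ge>Suc B. x m \<in> F (Suc m)" using submodule_zero[OF F_sub] by auto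
  thus ?thesis using cls_Nb_iff[OF x(1)] x(2) by blast
qed

lemma homN_Nb_iff: "x \<in> F j \<Longrightarrow> homN j x \<in> Nb j \<longleftrightarrow> x \<in> F (Suc j)"
proof -
  assume x: "x \<in> F j"
  have "homN j x \<in> Nb j \<longleftrightarrow> (\<forall>m\<ge>j. single M j x m \<in> F (Suc m))"
    unfolding homN_def by (rule cls_Nb_iff[OF fin_seqs_single[OF x]])
  thus ?thesis using submodule_zero[OF F_sub] by (auto simp: single_def)
qed

lemma homN_Nb_Suc: "x \<in> F j \<Longrightarrow> homN j x \<in> Nb (Suc j)"
  unfolding homN_def using cls_Nb_iff[OF fin_seqs_single] submodule_zero[OF F_sub]
  by (auto simp: single_def)

lemma Nb_SucE:
  assumes "f \<in> Nb (Suc n)"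
  shows "\<exists>x\<in>F n. \<exists>f'\<in>Nb n. f = homN n x \<oplus>\<^bsub>N\<^esub> f'"
proof -
  obtain x where x: "x \<in> sF" "f = cls M F x" "\<And>m. m \<ge> Suc n \<Longrightarrow> x m \<in> F (Suc m)"
    using Nb_E[OF assms] by metis
  have xF: "x m \<in> F m" for m using fin_seqs_mem(1)[OF x(1)] .
  let ?y = "x(n := \<zero>\<^bsub>M\<^esub>)"
  obtain B where "\<And>n. n > B \<Longrightarrow> x n = \<zero>\<^bsub>M\<^esub>" using x(1) by (auto simp: fin_seqs_def)
  hence "\<forall>m>B. ?y m = \<zero>\<^bsub>M\<^esub>" by simp
  moreover have "\<forall>m. ?y m \<in> F m" using xF submodule_zero[OF F_sub] by simp
  ultimately have y: "?y \<in> sF" unfolding fin_seqs_def by blast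
  have "\<forall>m\<ge>n. ?y m \<in> F (Suc m)" using x(3) submodule_zero[OF F_sub] by (simp add: Suc_le_eq)
  hence "cls M F ?y \<in> Nb n" using cls_Nb_iff[OF y] by blast
  moreover have "(\<lambda>m. single M n (x n) m \<oplus>\<^bsub>M\<^esub> ?y m) = x"
    using F_carrier[OF xF] by (auto simp: single_def)
  hence "f = homN n (x n) \<oplus>\<^bsub>N\<^esub> cls M F ?y"
    unfolding homN_def using N_simps(3)[OF fin_seqs_single[OF xF] y] x(2) by simp
  ultimately show ?thesis using xF by blast
qed

lemma homN_hom: "partial_hom R M AN (F n) (homN n)"
proof (intro partial_hom.intro partial_hom_axioms.intro rmodule_axioms AN_module F_sub)
  show "homN n x \<in> carrier AN" if "x \<in> F n" for x using homN_carrier[OF that] by simp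
  show "homN n (x \<oplus>\<^bsub>M\<^esub> y) = homN n x \<oplus>\<^bsub>AN\<^esub> homN n y" if "x \<in> F n" "y \<in> F n" for x y
    using homN_add[OF that] by simp
  show "homN n (a \<odot>\<^bsub>M\<^esub> x) = a \<odot>\<^bsub>AN\<^esub> homN n x" if "a \<in> carrier R" "x \<in> F n" for a x
    using homG_homN[of a 0 x n] that by (simp add: Q_0)
qed

text \<open>Passing from \<open>Nb n\<close> to \<open>Nb (Suc n)\<close> adds the piece of degree
  \<open>n\<close>, the image of \<open>F n\<close> under \<open>homN n\<close>, in which exactly
  \<open>F (Suc n)\<close> falls into \<open>Nb n\<close>.\<close>

lemma len_Nb: "seg_length R AN {zero N} (Nb n) \<le> (\<Sum>j<n. len (F (Suc j)) (F j))"
proof (induction n)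
  case 0
  interpret AN: rmodule R AN by (rule AN_module)
  show ?case by (simp add: Nb_0)
next
  case (Suc n)
  interpret AN: rmodule R AN by (rule AN_module)
  interpret h: partial_hom R M AN "F n" "homN n" by (rule homN_hom)
  have "{x \<in> F n. homN n x \<in> Nb n} = F (Suc n)" using homN_Nb_iff F_Suc by blast
  moreover have "Nb (Suc n) = homN n ` F n <+>\<^bsub>AN\<^esub> Nb n"
  proof
    show "Nb (Suc n) \<subseteq> homN n ` F n <+>\<^bsub>AN\<^esub> Nb n"
    proof
      fix f assume "f \<in> Nb (Suc n)"
      thus "f \<in> homN n ` F n <+>\<^bsub>AN\<^esub> Nb n"
        using Nb_SucE[of f n] unfolding AN.mem_sum_iff by auto
    qed
    show "homN n ` F n <+>\<^bsub>AN\<^esub> Nb n \<subseteq> Nb (Suc n)"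
      by (rule AN.sum_least[OF Nb_sub]) (use homN_Nb_Suc Nb_mono[of n "Suc n"] in auto)
  qed
  ultimately have 1: "AN.len (Nb n) (Nb (Suc n)) = len (F (Suc n)) (F n)"
    using h.len_preimage_eq[OF Nb_sub, of n] by (simp only:)
  have z: "{zero N} = Nb 0" by (simp add: Nb_0)
  have "AN.len {zero N} (Nb (Suc n)) = AN.len {zero N} (Nb n) + AN.len (Nb n) (Nb (Suc n))"
    unfolding z by (rule AN.len_add[OF Nb_sub Nb_sub Nb_sub Nb_mono Nb_mono]) simp_all
  thus ?case using Suc 1 by (simp add: add_mono)
qed

end

text \<open>\<open>S.N\<close> is the graded ring \<open>G\<close> as a module over itself, \<open>S.AN\<close> the same with scalars
  restricted to \<open>R\<close>, and \<open>Gb n\<close>, \<open>Nb n\<close> are the parts of degree less than \<open>n\<close>.\<close>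

context graded
begin

interpretation S: graded R "self_module R" Q Q by (rule self_graded)
interpretation N: rmodule G N by (rule N_module)
interpretation AN: rmodule R AN by (rule AN_module)
interpretation SN: rmodule G "S.N" by (rule S.N_module)
interpretation AS: rmodule R "S.AN" by (rule S.AN_module)

abbreviation Gb where "Gb \<equiv> S.Nb"

lemma SN_simps [simp]: "carrier S.N = carrier G" "zero S.N = zero G" "add S.N = add G"
  "smult S.N = monoid.mult G"
  by (simp_all add: gr_module_def assoc_ring_def)

lemma ideal_sub: "ideal P G \<Longrightarrow> submodule P R S.AN"
proof -
  assume P: "ideal P G"
  have "submodule P G S.N"
    using ideal.axioms(1)[OF P] ideal.I_l_closed[OF P]
    by (auto simp: submodule_def submodule_axioms_def additive_subgroup_def subgroup_def m_inv_def)
  thus ?thesis unfolding S.AN_def by (rule submodule_restrict_scalars[OF _ S.homG_0_hom])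
qed

lemma smult_Nb:
  assumes g: "g \<in> Gb i" and f: "f \<in> Nb j"
  shows "g \<odot>\<^bsub>N\<^esub> f \<in> Nb (i + j)"
proof -
  obtain a where a: "a \<in> sQ" "g = cls (self_module R) Q a" "\<And>m. m \<ge> i \<Longrightarrow> a m \<in> Q (Suc m)"
    using S.Nb_E[OF g] by metis
  obtain x where x: "x \<in> sF" "f = cls M F x" "\<And>m. m \<ge> j \<Longrightarrow> x m \<in> F (Suc m)"
    using Nb_E[OF f] by metis
  \<comment> \<open>Once \<open>m >= i + j\<close>, each summand has a factor of index beyond its
    truncation, and that factor lies one step deeper in its filtration.\<close>
  have "conv M a x m \<in> F (Suc m)" if m: "m \<ge> i + j" for m
    unfolding conv_def
  proof (rule finsum_submodule[OF F_sub])
    fix k assume "k \<in> {..m}"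
    hence k: "k \<le> m" by simp
    show "a k \<odot>\<^bsub>M\<^esub> x (m - k) \<in> F (Suc m)"
    proof (cases "k \<ge> i")
      case True
      thus ?thesis using QF[OF a(3)[OF True] fin_seqs_mem(1)[OF x(1), of "m - k"]] k by simp
    next
      case False
      hence "m - k \<ge> j" using m by linarith
      thus ?thesis using QF[OF S.fin_seqs_mem(1)[OF a(1), of k] x(3)[of "m - k"]] k by simp
    qed
  qed
  hence "cls M F (conv M a x) \<in> Nb (i + j)" using cls_Nb_iff[OF fin_seqs_conv[OF a(1) x(1)]] by blast
  moreover have "g \<odot>\<^bsub>N\<^esub> f = cls M F (conv M a x)" unfolding a(2) x(2) by (rule N_simps(4)[OF a(1) x(1)])
  ultimately show ?thesis by (simp only:)
qed

lemma smult_hom: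
  assumes X: "submodule X R S.AN" and y: "y \<in> carrier N"
  shows "partial_hom R S.AN AN X (\<lambda>g. g \<odot>\<^bsub>N\<^esub> y)"
proof (intro partial_hom.intro partial_hom_axioms.intro AS.rmodule_axioms AN_module X)
  have c: "g \<in> carrier G" if "g \<in> X" for g using AS.submodule_mem_carrier[OF X that] by simp
  show "g \<odot>\<^bsub>N\<^esub> y \<in> carrier AN" if "g \<in> X" for g using c[OF that] y by simp
  show "(g \<oplus>\<^bsub>S.AN\<^esub> h) \<odot>\<^bsub>N\<^esub> y = g \<odot>\<^bsub>N\<^esub> y \<oplus>\<^bsub>AN\<^esub> h \<odot>\<^bsub>N\<^esub> y" if "g \<in> X" "h \<in> X" for g h
    using c that y by (simp add: N.smult_l_distr)
  show "(a \<odot>\<^bsub>S.AN\<^esub> g) \<odot>\<^bsub>N\<^esub> y = a \<odot>\<^bsub>AN\<^esub> (g \<odot>\<^bsub>N\<^esub> y)" if "a \<in> carrier R" "g \<in> X" for a g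
    using c[OF that(2)] y ring_hom_memE(1)[OF homG_0_hom that(1)] by (simp add: N.smult_assoc1)
qed

text \<open>Modulo the common annihilator of \<open>Y\<close>, the truncation \<open>Gb n\<close>
  embeds into one copy of \<open>Nb (n + e)\<close> for each \<open>y\<close> in \<open>Y\<close> by
  \<open>g \<mapsto> g y\<close>. Since \<open>P\<close> contains that annihilator, growth of
  \<open>G/P\<close> is controlled by growth of \<open>N\<close>.\<close>

lemma len_annihilator_le:
  assumes Y: "finite Y" "Y \<subseteq> Nb e" and P: "ideal P G"
    and ann: "\<And>g. g \<in> carrier G \<Longrightarrow> (\<forall>y\<in>Y. g \<odot>\<^bsub>N\<^esub> y = zero N) \<Longrightarrow> g \<in> P"
  shows "AS.len (P \<inter> Gb n) (Gb n) \<le> of_nat (card Y) * AN.len {zero N} (Nb (n + e))"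
proof -
  let ?K = "\<lambda>T. {g \<in> Gb n. \<forall>y\<in>T. g \<odot>\<^bsub>N\<^esub> y = zero N}"
  have z: "AN.sub {zero N}" using Nb_sub[of 0] by (simp add: Nb_0)
  have zN: "{zero N} \<subseteq> Nb (n + e)" using Nb_mono[of 0 "n + e"] by (simp add: Nb_0)
  have "AS.sub (?K T) \<and> AS.len (?K T) (Gb n) \<le> of_nat (card T) * AN.len {zero N} (Nb (n + e))"
    if "finite T" "T \<subseteq> Nb e" for T
    using that
  proof (induction T rule: finite_induct)
    case empty
    show ?case using S.Nb_sub[of n] by simp
  next
    case (insert y T)
    have y: "y \<in> Nb e" "y \<in> carrier N" using insert.prems by (auto simp: Nb_def)
    have K: "AS.sub (?K T)" and le: "AS.len (?K T) (Gb n) \<le> of_nat (card T) * AN.len {zero N} (Nb (n + e))"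
      using insert by auto
    interpret h: partial_hom R S.AN AN "?K T" "\<lambda>g. g \<odot>\<^bsub>N\<^esub> y" by (rule smult_hom[OF K y(2)])
    have e: "{g \<in> ?K T. g \<odot>\<^bsub>N\<^esub> y \<in> {zero N}} = ?K (insert y T)" by auto
    have sub: "AS.sub (?K (insert y T))" using h.submodule_preimage[OF z] unfolding e .
    have "(\<lambda>g. g \<odot>\<^bsub>N\<^esub> y) ` ?K T \<subseteq> Nb (n + e)" using smult_Nb y(1) by blast
    hence "AS.len (?K (insert y T)) (?K T) \<le> AN.len {zero N} (Nb (n + e))"
      using h.len_preimage_le[OF z Nb_sub zN] unfolding e by blast
    moreover have "AS.len (?K (insert y T)) (Gb n) = AS.len (?K (insert y T)) (?K T) + AS.len (?K T) (Gb n)"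
      by (rule AS.len_add[OF sub K S.Nb_sub]) auto
    ultimately have "AS.len (?K (insert y T)) (Gb n) \<le>
      AN.len {zero N} (Nb (n + e)) + of_nat (card T) * AN.len {zero N} (Nb (n + e))"
      using le by (simp add: add_mono)
    also have "\<dots> = of_nat (card (insert y T)) * AN.len {zero N} (Nb (n + e))"
      using insert.hyps by (simp add: distrib_right)
    finally show ?case using sub by blast
  qed
  from this[OF Y] have K: "AS.sub (?K Y)"
    "AS.len (?K Y) (Gb n) \<le> of_nat (card Y) * AN.len {zero N} (Nb (n + e))" by auto
  have "?K Y \<subseteq> P \<inter> Gb n" using ann by (auto simp: S.Nb_def)
  hence "AS.len (P \<inter> Gb n) (Gb n) \<le> AS.len (?K Y) (Gb n)"
    by (intro AS.len_mono(1) K(1) AS.submodule_Int ideal_sub P S.Nb_sub) auto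
  thus ?thesis using K(2) by (rule order_trans)
qed

text \<open>An element of \<open>P' - P\<close> is a nonzerodivisor on \<open>G/P\<close> and zero on \<open>G/P'\<close>, so the growth of
  \<open>G/P\<close> is at least one degree larger.\<close>

lemma len_prime_step:
  assumes P: "primeideal P G" and P': "primeideal P' G" and PP: "P \<subset> P'"
  shows "\<exists>d. \<forall>D\<ge>d. \<forall>n. AS.len (P \<inter> Gb n) (Gb n) + AS.len (P' \<inter> Gb (n + D)) (Gb (n + D)) \<le>
    AS.len (P \<inter> Gb (n + D)) (Gb (n + D))"
proof -
  interpret P: primeideal P G by fact
  interpret P': primeideal P' G by fact
  obtain x where x: "x \<in> P'" "x \<notin> P" using PP by auto
  have xc: "x \<in> carrier G" using P'.Icarr x by auto
  then obtain d where d: "x \<in> Gb d" using S.Nb_exhaust[of x] by auto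
  show ?thesis
  proof (intro exI[of _ d] allI impI)
    fix D n assume "d \<le> D"
    hence xD: "x \<in> Gb D" using d S.Nb_mono by blast
    let ?L = "P \<inter> Gb (n + D)" and ?K = "P' \<inter> Gb (n + D)"
    have L: "AS.sub ?L" and K: "AS.sub ?K"
      by (auto intro: AS.submodule_Int ideal_sub P.is_ideal P'.is_ideal S.Nb_sub)
    have gc: "g \<in> carrier G" if "g \<in> Gb m" for g m using that by (simp add: S.Nb_def)
    have hx: "partial_hom R S.AN S.AN (Gb n) (\<lambda>g. g \<odot>\<^bsub>S.N\<^esub> x)"
      using graded.smult_hom[OF self_graded S.Nb_sub, of x n] xc by simp
    interpret h: partial_hom R S.AN S.AN "Gb n" "\<lambda>g. g \<odot>\<^bsub>S.N\<^esub> x" by (rule hx)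
    \<comment> \<open>Primeness of \<open>P\<close> and \<open>x \<notin> P\<close> make
      multiplication by \<open>x\<close> injective modulo \<open>P\<close>; the degree bound
      \<open>D\<close> of \<open>x\<close> keeps products inside \<open>Gb (n + D)\<close>.\<close>
    have e: "{g \<in> Gb n. g \<odot>\<^bsub>S.N\<^esub> x \<in> ?L} = P \<inter> Gb n"
    proof -
      have "g \<otimes>\<^bsub>G\<^esub> x \<in> Gb (n + D)" if "g \<in> Gb n" for g using graded.smult_Nb[OF self_graded that xD] by simp
      moreover have "g \<otimes>\<^bsub>G\<^esub> x \<in> P \<longleftrightarrow> g \<in> P" if "g \<in> Gb n" for g
        using P.I_prime[OF gc[OF that] xc] P.I_r_closed[of g x] xc x(2) by blast
      ultimately show ?thesis by auto
    qed
    have i: "(\<lambda>g. g \<odot>\<^bsub>S.N\<^esub> x) ` Gb n \<subseteq> ?K"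
      using graded.smult_Nb[OF self_graded _ xD] P'.I_l_closed[OF x(1)] gc by auto
    have LK: "?L \<subseteq> ?K" using PP by auto
    have "AS.len (P \<inter> Gb n) (Gb n) \<le> AS.len ?L ?K"
      using h.len_preimage_le[OF L K LK i] unfolding e .
    moreover have "AS.len ?L (Gb (n + D)) = AS.len ?L ?K + AS.len ?K (Gb (n + D))"
      by (rule AS.len_add[OF L K S.Nb_sub LK]) auto
    ultimately show "AS.len (P \<inter> Gb n) (Gb n) + AS.len ?K (Gb (n + D)) \<le> AS.len ?L (Gb (n + D))"
      by (simp add: add_mono)
  qed
qed

text \<open>With blocks of \<open>D\<close> degrees, \<open>len_prime_step\<close> becomes a
  recursion of Pascal type in the number of blocks and the number of primes, whence the binomial
  coefficient. \<open>D\<close> must exceed the degree bounds of all the elements chosen along the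
  chain and that of 1.\<close>

lemma len_prime_chain:
  assumes "chain_in {P. primeideal P G} k p"
  shows "\<exists>D0. \<forall>D\<ge>D0. \<forall>m. enat (m choose k) \<le> AS.len (p 0 \<inter> Gb (Suc m * D)) (Gb (Suc m * D))"
  using assms
proof (induction k arbitrary: p)
  case 0
  hence P: "primeideal (p 0) G" by (simp add: chain_in_def)
  then interpret P: primeideal "p 0" G .
  \<comment> \<open>A truncation containing 1 is not inside the proper ideal \<open>p 0\<close>, so
    the length is at least 1.\<close>
  obtain d where d: "\<one>\<^bsub>G\<^esub> \<in> Gb d" using S.Nb_exhaust[of "\<one>\<^bsub>G\<^esub>"] by auto
  show ?case
  proof (intro exI[of _ d] allI impI)
    fix D m assume "d \<le> D"
    hence "d \<le> Suc m * D" by simp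
    hence "\<one>\<^bsub>G\<^esub> \<in> Gb (Suc m * D)" using d S.Nb_mono by blast
    moreover have "\<one>\<^bsub>G\<^esub> \<notin> p 0" using P.one_imp_carrier P.I_notcarr by blast
    ultimately have "p 0 \<inter> Gb (Suc m * D) \<noteq> Gb (Suc m * D)" by blast
    moreover have "AS.sub (p 0 \<inter> Gb (Suc m * D))"
      by (intro AS.submodule_Int ideal_sub P.is_ideal S.Nb_sub)
    ultimately have "AS.len (p 0 \<inter> Gb (Suc m * D)) (Gb (Suc m * D)) \<noteq> 0"
      using AS.len_eq_0D[OF _ S.Nb_sub] by blast
    hence "eSuc 0 \<le> AS.len (p 0 \<inter> Gb (Suc m * D)) (Gb (Suc m * D))"
      by (intro ileI1) (simp only: zero_less_iff_neq_zero not_False_eq_True)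
    moreover have "enat (m choose 0) = eSuc 0" by (simp add: eSuc_enat zero_enat_def)
    ultimately show "enat (m choose 0) \<le> AS.len (p 0 \<inter> Gb (Suc m * D)) (Gb (Suc m * D))"
      by (simp only:)
  qed
next
  case (Suc k)
  let ?q = "\<lambda>i. p (Suc i)"
  have c: "chain_in {P. primeideal P G} k ?q" using Suc.prems by (auto simp: chain_in_def)
  have p: "primeideal (p 0) G" "primeideal (p 1) G" "p 0 \<subset> p 1" using Suc.prems by (auto simp: chain_in_def)
  obtain D1 where D1: "\<And>D m. D \<ge> D1 \<Longrightarrow>
      enat (m choose k) \<le> AS.len (p 1 \<inter> Gb (Suc m * D)) (Gb (Suc m * D))"
    using Suc.IH[OF c] by auto
  obtain d where d: "\<And>D n. D \<ge> d \<Longrightarrow>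
      AS.len (p 0 \<inter> Gb n) (Gb n) + AS.len (p 1 \<inter> Gb (n + D)) (Gb (n + D)) \<le>
      AS.len (p 0 \<inter> Gb (n + D)) (Gb (n + D))"
    using len_prime_step[OF p] by blast
  show ?case
  proof (intro exI[of _ "max d D1"] allI impI)
    fix D m assume D: "max d D1 \<le> D"
    show "enat (m choose Suc k) \<le> AS.len (p 0 \<inter> Gb (Suc m * D)) (Gb (Suc m * D))"
    proof (induction m)
      case (Suc m)
      have "enat (Suc m choose Suc k) = enat (m choose Suc k) + enat (m choose k)" by simp
      \<comment> \<open>The hypothesis for \<open>p 1\<close> is available at \<open>Suc m\<close>,
        which gives slightly more than Pascal's rule asks for.\<close>
      also have "enat (m choose k) \<le> enat (Suc m choose k)" by (cases k) simp_all
      also have "enat (m choose Suc k) + enat (Suc m choose k) \<le>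
        AS.len (p 0 \<inter> Gb (Suc m * D)) (Gb (Suc m * D)) +
        AS.len (p 1 \<inter> Gb (Suc (Suc m) * D)) (Gb (Suc (Suc m) * D))"
        using Suc D1[of D "Suc m"] D by (intro add_mono) auto
      also have "\<dots> \<le> AS.len (p 0 \<inter> Gb (Suc (Suc m) * D)) (Gb (Suc (Suc m) * D))"
        using d[of D "Suc m * D"] D by (simp add: add.commute)
      finally show ?case by (simp add: add_left_mono)
    qed (simp add: zero_enat_def[symmetric])
  qed
qed

text \<open>Beyond degree \<open>k\<close> the filtration is multiplied by \<open>Q (Suc 0)\<close>,
  so gr(M) is generated by the classes of generators of \<open>F 0, ..., F k\<close>. An element
  killing these kills everything.\<close>

lemma finite_annihilator:
  assumes fgF: "\<And>n. fg (F n)" and st: "\<And>n. n \<ge> k \<Longrightarrow> F (Suc n) = ideal_smult R M (Q (Suc 0)) (F n)"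
  shows "\<exists>Y. finite Y \<and> Y \<subseteq> carrier N \<and>
    (\<forall>g\<in>carrier G. (\<forall>y\<in>Y. g \<odot>\<^bsub>N\<^esub> y = zero N) \<longrightarrow> g \<in> annihilator G N)"
proof -
  have "\<forall>n. \<exists>T. finite T \<and> T \<subseteq> carrier M \<and> span T = F n" using fgF by (simp add: fg_def)
  then obtain T where T: "\<And>n. finite (T n)" "\<And>n. T n \<subseteq> carrier M" "\<And>n. span (T n) = F n" by metis
  have TF: "T n \<subseteq> F n" for n using submodule_span(2)[OF T(2)[of n]] T(3)[of n] by simp
  let ?Y = "\<Union>j\<le>k. homN j ` T j"
  have z: "AN.sub {zero N}" using Nb_sub[of 0] by (simp add: Nb_0)
  show ?thesis
  proof (intro exI[of _ ?Y] conjI ballI impI)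
    show "finite ?Y" using T(1) by auto
    show "?Y \<subseteq> carrier N" using homN_carrier TF by blast
    fix g assume g: "g \<in> carrier G" and gY: "\<forall>y\<in>?Y. g \<odot>\<^bsub>N\<^esub> y = zero N"
    \<comment> \<open>The elements of \<open>F j\<close> whose class is killed by \<open>g\<close>
      form an \<open>R\<close>-submodule, so generators suffice for \<open>j <= k\<close> and
      products for larger \<open>j\<close>.\<close>
    have sub: "sub {x \<in> F j. g \<odot>\<^bsub>N\<^esub> homN j x \<in> {zero N}}" for j
    proof (rule partial_hom.submodule_preimage[OF _ z])
      show "partial_hom R M AN (F j) (\<lambda>x. g \<odot>\<^bsub>N\<^esub> homN j x)"
      proof (intro partial_hom.intro partial_hom_axioms.intro rmodule_axioms AN_module F_sub)
        show "g \<odot>\<^bsub>N\<^esub> homN j x \<in> carrier AN" if "x \<in> F j" for x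
          using g homN_carrier[OF that] by simp
        show "g \<odot>\<^bsub>N\<^esub> homN j (x \<oplus>\<^bsub>M\<^esub> y) = g \<odot>\<^bsub>N\<^esub> homN j x \<oplus>\<^bsub>AN\<^esub> g \<odot>\<^bsub>N\<^esub> homN j y"
          if "x \<in> F j" "y \<in> F j" for x y
          using g homN_carrier that by (simp add: homN_add N.smult_r_distr)
        show "g \<odot>\<^bsub>N\<^esub> homN j (a \<odot>\<^bsub>M\<^esub> x) = a \<odot>\<^bsub>AN\<^esub> (g \<odot>\<^bsub>N\<^esub> homN j x)"
          if a: "a \<in> carrier R" and x: "x \<in> F j" for a x
        proof -
          have h: "homG 0 a \<in> carrier G" by (rule ring_hom_memE(1)[OF homG_0_hom a])
          have "homN j (a \<odot>\<^bsub>M\<^esub> x) = homG 0 a \<odot>\<^bsub>N\<^esub> homN j x"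
            using homG_homN[of a 0 x j] a x by (simp add: Q_0)
          thus ?thesis using h g homN_carrier[OF x] N.R.m_comm[OF h g]
            by (simp add: N.smult_assoc1[symmetric])
        qed
      qed
    qed
    have all: "F j \<subseteq> {x \<in> F j. g \<odot>\<^bsub>N\<^esub> homN j x \<in> {zero N}}" for j
    proof (induction j rule: less_induct)
      case (less j)
      show ?case
      proof (cases "j \<le> k")
        case True
        have "span (T j) \<subseteq> {x \<in> F j. g \<odot>\<^bsub>N\<^esub> homN j x \<in> {zero N}}"
          by (rule span_minimal[OF sub]) (use TF gY True in auto)
        thus ?thesis using T(3) by simp
      next
        case False
        then obtain i where i: "j = Suc i" "i \<ge> k" by (cases j) auto
        have "ideal_smult R M (Q (Suc 0)) (F i) \<subseteq> {x \<in> F j. g \<odot>\<^bsub>N\<^esub> homN j x \<in> {zero N}}"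
        proof (rule ideal_smult_minimal[OF sub])
          fix a x assume a: "a \<in> Q (Suc 0)" and x: "x \<in> F i"
          have h: "homG (Suc 0) a \<in> carrier G" by (rule homG_carrier[OF a])
          have "g \<odot>\<^bsub>N\<^esub> homN i x = zero N" using less.IH[of i] i x by auto
          hence "homG (Suc 0) a \<odot>\<^bsub>N\<^esub> (g \<odot>\<^bsub>N\<^esub> homN i x) = zero N" using N.smult_r_null[OF h] by simp
          hence "g \<odot>\<^bsub>N\<^esub> (homG (Suc 0) a \<odot>\<^bsub>N\<^esub> homN i x) = zero N"
            using h g homN_carrier[OF x] N.R.m_comm[OF h g] by (simp add: N.smult_assoc1[symmetric])
          moreover have "homG (Suc 0) a \<odot>\<^bsub>N\<^esub> homN i x = homN j (a \<odot>\<^bsub>M\<^esub> x)"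
            using homG_homN[OF a x] i by simp
          ultimately show "a \<odot>\<^bsub>M\<^esub> x \<in> {x \<in> F j. g \<odot>\<^bsub>N\<^esub> homN j x \<in> {zero N}}"
            using QF[OF a x] i by simp
        qed
        thus ?thesis using st[OF i(2)] i(1) by simp
      qed
    qed
    have Nb: "\<forall>f\<in>Nb n. g \<odot>\<^bsub>N\<^esub> f = zero N" for n
    proof (induction n)
      case 0
      show ?case using N.smult_r_null[OF g] by (simp add: Nb_0)
    next
      case (Suc n)
      show ?case
      proof
        fix f assume "f \<in> Nb (Suc n)"
        then obtain x f' where x: "x \<in> F n" "f' \<in> Nb n" "f = homN n x \<oplus>\<^bsub>N\<^esub> f'" using Nb_SucE by blast
        have "f' \<in> carrier N" using x(2) by (simp add: Nb_def)
        hence "g \<odot>\<^bsub>N\<^esub> f = g \<odot>\<^bsub>N\<^esub> homN n x \<oplus>\<^bsub>N\<^esub> g \<odot>\<^bsub>N\<^esub> f'"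
          using x g homN_carrier by (simp add: N.smult_r_distr)
        moreover have "g \<odot>\<^bsub>N\<^esub> homN n x = zero N" using all[of n] x(1) by auto
        ultimately show "g \<odot>\<^bsub>N\<^esub> f = zero N" using Suc x(2) by simp
      qed
    qed
    show "g \<in> annihilator G N"
      unfolding annihilator_def using g Nb Nb_exhaust by blast
  qed
qed

text \<open>A chain of \<open>r + 2\<close> primes over the annihilator would force growth at least
  \<open>m choose (r + 1)\<close> along multiples of \<open>D\<close>, while the assumed growth is
  of order \<open>m^r\<close>.\<close>

lemma dim_gr_le:
  assumes fgF: "\<And>n. fg (F n)" and st: "\<And>n. n \<ge> k \<Longrightarrow> F (Suc n) = ideal_smult R M (Q (Suc 0)) (F n)"
    and len: "\<And>n. len (F (Suc n)) (F n) = enat (H n)"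
    and growth: "\<And>n. real (\<Sum>j<n. H j) \<le> C * real n ^ r"
  shows "module_dim G N \<le> enat r"
proof -
  obtain Y where Y': "finite Y \<and> Y \<subseteq> carrier N \<and>
      (\<forall>g\<in>carrier G. (\<forall>y\<in>Y. g \<odot>\<^bsub>N\<^esub> y = zero N) \<longrightarrow> g \<in> annihilator G N)"
    by (rule exE[OF finite_annihilator[OF fgF st]])
  hence Y: "finite Y" "Y \<subseteq> carrier N"
    and ann: "\<And>g. g \<in> carrier G \<Longrightarrow> (\<forall>y\<in>Y. g \<odot>\<^bsub>N\<^esub> y = zero N) \<Longrightarrow> g \<in> annihilator G N"
    by simp_all
  have "\<forall>y. \<exists>n. y \<in> Y \<longrightarrow> y \<in> Nb n" using Nb_exhaust Y(2) by blast
  then obtain \<nu> where \<nu>: "\<And>y. y \<in> Y \<Longrightarrow> y \<in> Nb (\<nu> y)" by metis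
  \<comment> \<open>The sum serves only as a common upper bound of the degree bounds.\<close>
  let ?e = "\<Sum>y\<in>Y. \<nu> y"
  have "\<nu> y \<le> ?e" if "y \<in> Y" for y using Y(1) that by (intro member_le_sum) auto
  hence Ye: "Y \<subseteq> Nb ?e" using \<nu> Nb_mono by blast
  show ?thesis
    unfolding N.module_dim_height
  proof (rule height_leI)
    fix k p assume p: "chain_in {P. primeideal P G \<and> annihilator G N \<subseteq> P} k p"
    show "enat k \<le> enat r"
    proof (rule ccontr)
      assume "\<not> ?thesis"
      hence "Suc r \<le> k" by simp
      hence "chain_in {P. primeideal P G \<and> annihilator G N \<subseteq> P} (Suc r) p" by (rule chain_in_le[OF p])
      hence c: "chain_in {P. primeideal P G} (Suc r) p" and P0: "primeideal (p 0) G" "annihilator G N \<subseteq> p 0"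
        by (auto simp: chain_in_def)
      obtain D where D: "\<And>m. enat (m choose Suc r) \<le> AS.len (p 0 \<inter> Gb (Suc m * D)) (Gb (Suc m * D))"
        using len_prime_chain[OF c] by blast
      have ub: "real (m choose Suc r) \<le> card Y * (C * real (Suc m * D + ?e) ^ r)" for m
      proof -
        let ?n = "Suc m * D"
        have "enat (m choose Suc r) \<le> AS.len (p 0 \<inter> Gb ?n) (Gb ?n)" by (rule D)
        also have "\<dots> \<le> of_nat (card Y) * AN.len {zero N} (Nb (?n + ?e))"
          by (rule len_annihilator_le[OF Y(1) Ye]) (use P0 ann in \<open>auto simp: primeideal_def\<close>)
        also have "\<dots> \<le> of_nat (card Y) * (\<Sum>j<?n + ?e. len (F (Suc j)) (F j))"
          by (rule mult_left_mono[OF len_Nb]) simp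
        also have "(\<Sum>j<?n + ?e. len (F (Suc j)) (F j)) = enat (\<Sum>j<?n + ?e. H j)"
          unfolding len by (simp add: of_nat_eq_enat[symmetric])
        finally have "m choose Suc r \<le> card Y * (\<Sum>j<?n + ?e. H j)" by (simp add: of_nat_eq_enat)
        hence "real (m choose Suc r) \<le> card Y * real (\<Sum>j<?n + ?e. H j)"
          by (metis of_nat_le_iff of_nat_mult)
        also have "\<dots> \<le> card Y * (C * real (?n + ?e) ^ r)" by (intro mult_left_mono growth) simp
        finally show ?thesis .
      qed
      define e where "e = ?e"
      \<comment> \<open>The power of \<open>Suc r\<close> comes from the estimate
        \<open>(m/(r+1))^(r+1) <= m choose (r+1)\<close>, and \<open>2 * D + e\<close> from
        \<open>Suc m * D + e <= m * (2 * D + e)\<close> for \<open>m >= 1\<close>. The absolute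
        value allows any sign of \<open>C\<close>.\<close>
      define c where "c = real (Suc r) ^ Suc r * (card Y * (\<bar>C\<bar> * real (2 * D + e) ^ r))"
      obtain m0 where m0: "c < real m0" using reals_Archimedean2 by blast
      \<comment> \<open>Above \<open>m0\<close> to exceed \<open>c\<close>, and at least
        \<open>Suc r\<close> for the estimate of the binomial coefficient.\<close>
      define m where "m = max m0 (Suc r)"
      have m: "c < real m" "Suc r \<le> m" "1 \<le> m" using m0 by (auto simp: m_def)
      have "(real m / real (Suc r)) ^ Suc r \<le> real (m choose Suc r)"
        using binomial_ge_n_over_k_pow_k[OF m(2), where ?'a=real] .
      also have "\<dots> \<le> card Y * (C * real (Suc m * D + e) ^ r)" unfolding e_def by (rule ub)
      also have "\<dots> \<le> card Y * (\<bar>C\<bar> * (real m * real (2 * D + e)) ^ r)"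
      proof (intro mult_left_mono mult_mono power_mono)
        have "1 * D \<le> m * D" "1 * e \<le> m * e" by (rule mult_le_mono1[OF m(3)])+
        moreover have "m * (2 * D + e) = m * D + m * D + m * e" by (simp add: algebra_simps)
        moreover have "Suc m * D + e = D + m * D + e" by simp
        ultimately have "Suc m * D + e \<le> m * (2 * D + e)" by linarith
        thus "real (Suc m * D + e) \<le> real m * real (2 * D + e)"
          by (metis of_nat_le_iff of_nat_mult)
      qed simp_all
      finally have "(real m / real (Suc r)) ^ Suc r \<le> card Y * (\<bar>C\<bar> * (real m * real (2 * D + e)) ^ r)" .
      hence "real m ^ Suc r / real (Suc r) ^ Suc r \<le>
          card Y * (\<bar>C\<bar> * real (2 * D + e) ^ r) * real m ^ r"
        by (simp only: power_divide power_mult_distrib mult.assoc mult.commute mult.left_commute)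
      hence "real m ^ Suc r \<le> card Y * (\<bar>C\<bar> * real (2 * D + e) ^ r) * real m ^ r * real (Suc r) ^ Suc r"
        by (subst (asm) pos_divide_le_eq) simp_all
      also have "\<dots> = c * real m ^ r"
        unfolding c_def by (simp only: mult.assoc mult.commute mult.left_commute)
      finally have "real m * real m ^ r \<le> c * real m ^ r" by simp
      hence "real m \<le> c" using m(3) by simp
      thus False using m(1) by simp
    qed
  qed
qed

end

section \<open>Growth of gr(M) and conclusion\<close>

text \<open>The first summation gives a bounded function; each further one adds \<open>Suc n\<close>
  terms and so raises the degree by one.\<close>

lemma psum_growth:
  assumes q: "\<And>n. psum q n \<le> C" "0 \<le> C"
  shows "(psum ^^ Suc k) q n \<le> C * real (Suc n) ^ k"
proof (induction k arbitrary: n)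
  case 0
  show ?case using q by simp
next
  case (Suc k)
  have "(psum ^^ Suc (Suc k)) q n = (\<Sum>i\<le>n. (psum ^^ Suc k) q i)" by (simp add: psum_def)
  also have "\<dots> \<le> (\<Sum>i\<le>n. C * real (Suc n) ^ k)"
  proof (rule sum_mono)
    fix i assume "i \<in> {..n}"
    hence "C * real (Suc i) ^ k \<le> C * real (Suc n) ^ k" using q(2) by (intro mult_left_mono power_mono) auto
    thus "(psum ^^ Suc k) q i \<le> C * real (Suc n) ^ k" using Suc[of i] by linarith
  qed
  also have "\<dots> = C * real (Suc n) ^ Suc k" by (simp add: algebra_simps)
  finally show ?case .
qed

context superficial
begin

lemma psum_bound_le: "psum bound n \<le> real (nlen (L t) (carrier M))"
proof -
  have "psum bound n \<le> (\<Sum>i\<in>{0,1}. bound i)"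
  proof -
    have "psum bound n = (\<Sum>i\<in>{..n} \<inter> {0,1}. bound i)"
      unfolding psum_def by (rule sum.mono_neutral_right) (auto simp: bound_def)
    also have "\<dots> \<le> (\<Sum>i\<in>{0,1}. bound i)"
      by (rule sum_mono2) (auto simp: bound_def)
    finally show ?thesis .
  qed
  also have "\<dots> = real (nlen (L t) (carrier M))" by (simp add: bound_def nlen_L_add)
  finally show ?thesis .
qed

lemma hilb_L0: "hilb (L 0) n = nlen (F (Suc n)) (F n)"
  by (simp add: hilb_def L_0 FL_zero)

text \<open>The proved inequality is fed back: summed over \<open>j < n\<close>, it bounds
  lambda(M/F_n) by lambda(M/JM) times \<open>n^r\<close>. Here \<open>n = Suc m\<close> turns the
  sum into \<open>psum\<close> at \<open>m\<close>, matching the factor \<open>Suc m\<close> in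
  \<open>psum_growth\<close>.\<close>

lemma dim_gr: "module_dim (gr_ring R \<qq>) (gr_module M F) \<le> enat r"
proof -
  interpret gr: graded R M Q F by (rule graded_F)
  let ?C = "real (nlen (L t) (carrier M))"
  obtain k where k: "\<And>n. n \<ge> k \<Longrightarrow> F (Suc n) = ideal_smult R M \<qq> (F n)" using F_stable by blast
  have Q1: "Q (Suc 0) = \<qq>" using Q1_le_q q_Q1 by blast
  have "module_dim gr.G gr.N \<le> enat r"
  proof (rule gr.dim_gr_le[where k=k and H="hilb (L 0)" and C="?C"])
    show "fg (F n)" for n by (rule submodule_fg[OF F_sub])
    show "F (Suc n) = ideal_smult R M (Q (Suc 0)) (F n)" if "n \<ge> k" for n using k[OF that] Q1 by simp
    show "len (F (Suc n)) (F n) = enat (hilb (L 0) n)" for n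
      unfolding hilb_L0 by (rule len_nlen[OF F_sub F_sub F_Suc subset_refl])
    show "real (\<Sum>j<n. hilb (L 0) j) \<le> ?C * real n ^ r" for n
    proof (cases n)
      case (Suc m)
      have "real (\<Sum>j<n. hilb (L 0) j) = psum (\<lambda>n. real (hilb (L 0) n)) m"
        by (simp add: psum_def Suc lessThan_Suc_atMost)
      also have "\<dots> \<le> psum ((psum ^^ r) bound) m" using psum_mono[OF hilb_le] by (simp add: le_fun_def)
      also have "\<dots> = (psum ^^ Suc r) bound m" by simp
      also have "\<dots> \<le> ?C * real (Suc m) ^ r" by (rule psum_growth[OF psum_bound_le]) simp
      finally show ?thesis using Suc by simp
    qed simp
  qed
  thus ?thesis using R.gr_ring_eq[OF q_ideal] by simp
qed

end

context superficial_eq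
begin

text \<open>The regular forms and the growth bound enclose both invariants:
  \<open>r <= depth <= dim <= r\<close>.\<close>

lemma cohen_macaulay_gr: "cohen_macaulay (gr_ring R \<qq>) (gr_max_ideal R \<mm> \<qq>) (gr_module M F)"
proof -
  interpret gr: graded R M Q F by (rule graded_F)
  interpret GN: rmodule gr.G gr.N by (rule gr.N_module)
  have "depth (gr_ring R \<qq>) (gr_max_ideal R \<mm> \<qq>) (gr_module M F) \<le>
      module_dim (gr_ring R \<qq>) (gr_module M F)"
    using GN.depth_le_dim R.gr_ring_eq[OF q_ideal] by simp
  thus ?thesis
    using dim_gr depth_gr_ge unfolding cohen_macaulay_def by (metis order_antisym order_trans)
qed

end

theorem theorem1p4p1:
  fixes A :: "('a, 'k) ring_scheme"
    and \<mm> \<qq> :: "'a set"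
    and M :: "('a, 'b) module"
    and F :: "nat \<Rightarrow> 'b set"
    and as :: "'a list"
    and r :: nat
  assumes "noetherian_ring A" and "local_ring A \<mm>" and "primary_to A \<mm> \<qq>"
    and "Module.module A M" and "fin_gen_module A M" and "carrier M \<noteq> {\<zero>\<^bsub>M\<^esub>}"
    and "module_dim A M = enat r" and "r \<ge> 1"
    and "good_filtration A \<qq> M F"
    and "maximal_superficial_sequence A \<qq> M F as"
  shows
    "let J = Idl\<^bsub>A\<^esub> (set as);
         JM = ideal_smult A M J (carrier M);
         P = hilbert_series A M F;
         Q = (fps_const (real (subquot_length A M (carrier M) (F 1)))
              + fps_const (real (subquot_length A M (F 1) JM)) * fps_X) / (1 - fps_X) ^ r
     in (\<forall>n. fps_nth P n \<le> fps_nth Q n) \<and>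
        (P = Q \<longrightarrow>
           cohen_macaulay (gr_ring A \<qq>) (gr_max_ideal A \<mm> \<qq>) (gr_module M F) \<and>
           cohen_macaulay A \<mm> M)"
proof -
  interpret superficial A M \<mm> \<qq> F as r
    by (intro superficial.intro filtered.intro rmoduleI filtered_axioms.intro superficial_axioms.intro)
      (use assms in auto)
  \<comment> \<open>The argument orders differ: \<open>subquot_length\<close> takes the larger
    module first, \<open>nlen\<close> the smaller.\<close>
  have n: "subquot_length A M X Y = nlen Y X" if "sub X" "sub Y" "Y \<subseteq> X" for X Y
    using subquot_length_eq[OF that(2,1,3)] by (simp add: nlen_def)
  have P: "hilbert_series A M F = Abs_fps (\<lambda>n. real (hilb (L 0) n))"
    using n[OF F_sub F_sub F_Suc] by (simp add: hilbert_series_def hilb_L0)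
  have 0: "subquot_length A M (carrier M) (F 1) = nlen (F 1) (carrier M)"
    by (rule n[OF carrier_is_submodule F_sub F_carrier])
  have 1: "subquot_length A M (F 1) (ideal_smult A M (Idl\<^bsub>A\<^esub> (set as)) (carrier M)) = nlen (L t) (F 1)"
    unfolding L_t[symmetric] by (rule n[OF F_sub L_sub L_le_F1[OF order_refl]])
  have "fps_const (real (nlen (F 1) (carrier M))) + fps_const (real (nlen (L t) (F 1))) * fps_X =
      Abs_fps bound"
    by (rule fps_ext) (auto simp: bound_def)
  \<comment> \<open>Division by \<open>(1 - X)^r\<close> is \<open>r\<close>-fold summation, so
    comparison of power series becomes comparison of the functions treated above.\<close>
  hence Q: "(fps_const (real (nlen (F 1) (carrier M))) + fps_const (real (nlen (L t) (F 1))) * fps_X) /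
      (1 - fps_X) ^ r = Abs_fps ((psum ^^ r) bound)" by (simp add: Abs_fps_psum_pow)
  have "cohen_macaulay (gr_ring A \<qq>) (gr_max_ideal A \<mm> \<qq>) (gr_module M F) \<and> cohen_macaulay A \<mm> M"
    if "Abs_fps (\<lambda>n. real (hilb (L 0) n)) = Abs_fps ((psum ^^ r) bound)"
  proof -
    have "(\<lambda>n. real (hilb (L 0) n)) = (psum ^^ r) bound"
      using that by (metis fps_nth_Abs_fps ext)
    then interpret superficial_eq A M \<mm> \<qq> F as r by unfold_locales
    show ?thesis using cohen_macaulay_gr cohen_macaulay_M by blast
  qed
  thus ?thesis
    using hilb_le unfolding Let_def P 0 1 Q by (auto simp: le_fun_def)
qed

end
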